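(* Let $\Bbbk=\mathbb{R}$ or $\mathbb{C}$, let $\pi\subset\{1,\ldots,m\}$, $\pi^c=\{1,\ldots,m\}\setminus\pi$, and let $A\in\mathcal{U}_\pi\subset\Bbbk^{m\times n}$ be of rank $r$. Let $A=U\Sigma V^H$ be a full SVD of $A$ (so $\Sigma\in\mathbb{R}^{m\times n}$) with $\sigma_1\ge\cdots\ge\sigma_r>\sigma_{r+1}=\cdots=\sigma_m=0$. Let $i\in\pi$ and $j\in\pi^c$ be any indices that realize the maximum in $$\kappa[\mathcal{L}_\pi^{\Bbbk}](A)=\max_{i\in\pi,\;j\in\pi^c}\frac{1}{|\sigma_i-\sigma_j|}\sqrt{\frac{\sigma_i^2+\sigma_j^2}{(\sigma_i+\sigma_j)^2}}.$$ Then the perturbation $$ \dot A=U(\mathbf{e}_j\mathbf{e}_i^T-\mathbf{e}_i\mathbf{e}_j^T)\Sigma V^H+\begin{cases}2\dfrac{\sigma_i\sigma_j}{\sigma_i^2+\sigma_j^2}\,U\Sigma(\mathbf{e}_i\mathbf{e}_j^T-\mathbf{e}_j\mathbf{e}_i^T)V^H, & \text{if }1\le i,j\le r,\\ 0,&\text{otherwise,}\end{cases} $$ infinitesimally attains the condition number as $t\to0$: $$d_{\mathrm{Gr}}^\star\bigl(\mathcal{L}_\pi^{\Bbbk}(A),\mathcal{L}_\pi^{\Bbbk}(A+t\dot A)\bigr)=\kappa[\mathcal{L}_\pi^{\Bbbk}](A)\cdot\|t\dot A\|_F\cdot(1+o(1)),$$ where $\star\in\{c,G,P\}$, i.e.,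 $d_{\mathrm{Gr}}^\star$ is the chordal, Grassmann, or Procrustes distance.
   Context: Condition number: for a map $f:X\to Y$ between metric spaces $(X,d_X)$, $(Y,d_Y)$ and $x\in X$, $$\kappa[f](x):=\lim_{\epsilon\to0}\ \sup_{x'\in X,\ 0<d_X(x,x')\le\epsilon}\frac{d_Y(f(x),f(x'))}{d_X(x,x')}.$$ Singular subspaces: a full SVD of $A\in\Bbbk^{m\times n}$ of rank $r$ is $A=U\Sigma V^H$ with $U\in\Bbbk^{m\times m}$, $V\in\Bbbk^{n\times n}$ unitary (orthogonal if $\Bbbk=\mathbb{R}$) and $\Sigma$ the $m\times n$ matrix whose upper left $r\times r$ block is $\mathrm{diag}(\sigma_1,\ldots,\sigma_r)$, $\sigma_1\ge\cdots\ge\sigma_r>0$, and which is zero elsewhere. For a nonzero singular value $\sigma'$ of $A$, $\mathrm{U}_{\sigma'}\subset\Bbbk^m$ is the span of the columns of $U$ corresponding to $\sigma'$, i.e., the eigenspace of $AA^H$ with eigenvalue $\sigma'^2$; $\mathrm{U}_0$ is the cokernel of $A$ (the kernel of $AA^H$). A left singular subspace of $A$ is a direct sum of the spaces $\mathrm{U}_{\sigma'}$ over a subset of the set consisting of the distinct nonzero singular values and $0$. For $\pi\subset\{1,\ldots,m\}$ with $\sharp\pi=k$, let $\mathrm{U}_\pi$ be the span of the columns $\mathbf{u}_i$, $i\in\pi$, of $U$ in a full SVD of $A$, and let $\mathcal{U}_\pi=\{A\in\Bbbk^{m\times n}\mid \mathrm{U}_\pi\text{ is a left singular subspace of }A\}$;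 that is, with $\sigma_{r+1}=\cdots=\sigma_m=0$, whenever $i\in\pi$, all indices $j\in\{1,\ldots,m\}$ with $\sigma_j=\sigma_i$ also lie in $\pi$. On $\mathcal{U}_\pi$ the space $\mathrm{U}_\pi$ is well defined, and $\mathcal{L}_\pi^{\Bbbk}:\mathcal{U}_\pi\to\mathrm{Gr}(k,\Bbbk^m)$, $A\mapsto\mathrm{U}_\pi$. Its condition number is taken with respect to the Frobenius distance $\|A-A'\|_F$ on the domain and any of the three distances below on the codomain. Distances: $\mathrm{Gr}(d,\Bbbk^p)$ is the Grassmannian of $d$-dimensional linear subspaces of $\Bbbk^p$, identified with the rank-$d$ orthogonal projectors $QQ^H$, $Q\in\Bbbk^{p\times d}$, $Q^HQ=I_d$. The principal angles between $P=QQ^H$ and $P'=Q'Q'^H$ are $\theta_i=\cos^{-1}(\sigma_i(Q^HQ'))$, $i=1,\ldots,d$, with $\sigma_i(\cdot)$ the $i$th largest singular value; $\boldsymbol\theta=(\theta_1,\ldots,\theta_d)$. The chordal distance is $d_{\mathrm{Gr}}^c(P,P')=\|\sin\boldsymbol\theta\|=\frac1{\sqrt2}\|P-P'\|_F$, the Grassmann distance is $d_{\mathrm{Gr}}^G(P,P')=\|\boldsymbol\theta\|$, and the Procrustes distance is $d_{\mathrm{Gr}}^P(P,P')=\|2\sin(\boldsymbol\theta/2)\|$ (functions applied elementwise). $\mathbf{e}_i$ denotes the $i$th standard basis vector of the appropriate length ($m$ when the matrix $\mathbf{e}_j\mathbf{e}_i^T$ multiplies $\Sigma$ from the left, $n$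 when it multiplies $\Sigma$ from the right). *)

theory Defs
  imports
    "Jordan_Normal_Form.Schur_Decomposition"
    "Jordan_Normal_Form.DL_Rank"
    "HOL-Library.Extended_Real"
begin

text \<open>
  A type of this class is a copy of the real or of the complex numbers, with the usual absolute
  value and conjugation: the last assumption leaves no other choice. The order of
  \<^class>\<open>conjugatable_ordered_field\<close> is not used below; that class is the one for which the
  library provides orthogonalization.
\<close>

class real_or_complex = real_normed_field + conjugatable_ordered_field +
  fixes to_complex :: "'a \<Rightarrow> complex"
  assumes to_complex_add: "to_complex (x + y) = to_complex x + to_complex y"
    and to_complex_mult: "to_complex (x * y) = to_complex x * to_complex y"
    and to_complex_of_real: "to_complex (a *\<^sub>R 1) = complex_of_real a"
    and to_complex_conjugate: "to_complex (conjugate x) = cnj (to_complex x)"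
    and norm_to_complex: "cmod (to_complex x) = norm x"
    and range_to_complex: "range to_complex = \<real> \<or> range to_complex = UNIV"

instantiation real :: real_or_complex
begin
definition to_complex_real :: "real \<Rightarrow> complex" where "to_complex_real = complex_of_real"
instance by standard (auto simp: to_complex_real_def Reals_def)
end

instantiation complex :: real_or_complex
begin
definition to_complex_complex :: "complex \<Rightarrow> complex" where "to_complex_complex = id"
instance by standard (auto simp: to_complex_complex_def scaleR_conv_of_real)
end

text \<open>
  The domain of \<open>f\<close> is \<open>X\<close>; the limit is taken in the extended reals, where it always exists.
\<close>

definition condition_number ::
    "'a set \<Rightarrow> ('a \<Rightarrow> 'a \<Rightarrow> real) \<Rightarrow> ('b \<Rightarrow> 'b \<Rightarrow> real) \<Rightarrow> ('a \<Rightarrow> 'b) \<Rightarrow> 'a \<Rightarrow> ereal" where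
  "condition_number X dX dY f x =
     Lim (at_right (0::real))
       (\<lambda>\<epsilon>. SUP x'\<in>{x'\<in>X. 0 < dX x x' \<and> dX x x' \<le> \<epsilon>}. ereal (dY (f x) (f x') / dX x x'))"

text \<open>
  Rows, columns, singular values and the members of \<open>\<pi>\<close> are numbered from 0.
\<close>

definition frobenius_norm :: "'k::real_or_complex mat \<Rightarrow> real" where
  "frobenius_norm A = sqrt (\<Sum>i<dim_row A. \<Sum>j<dim_col A. (norm (A $$ (i, j)))\<^sup>2)"

definition frobenius_dist :: "'k::real_or_complex mat \<Rightarrow> 'k mat \<Rightarrow> real" where
  "frobenius_dist A B = frobenius_norm (A - B)"

definition unitary_mat :: "nat \<Rightarrow> 'k::real_or_complex mat \<Rightarrow> bool" where
  "unitary_mat p U \<longleftrightarrow>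
     U \<in> carrier_mat p p \<and> mat_adjoint U * U = 1\<^sub>m p \<and> U * mat_adjoint U = 1\<^sub>m p"

definition sigma_mat :: "nat \<Rightarrow> nat \<Rightarrow> nat \<Rightarrow> (nat \<Rightarrow> real) \<Rightarrow> 'k::real_or_complex mat" where
  "sigma_mat m n r \<sigma> = mat m n (\<lambda>(i, j). if i = j \<and> i < r then of_real (\<sigma> i) else 0)"

text \<open>
  The sequence \<open>\<sigma>\<close> is padded by zeros up to the number \<open>m\<close> of rows, also when \<open>n < m\<close>.
\<close>

definition full_svd ::
    "nat \<Rightarrow> nat \<Rightarrow> 'k::real_or_complex mat \<Rightarrow> 'k mat \<Rightarrow> (nat \<Rightarrow> real) \<Rightarrow> 'k mat \<Rightarrow> bool" where
  "full_svd m n A U \<sigma> V \<longleftrightarrow>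
     (let r = vec_space.rank m A in
        A \<in> carrier_mat m n \<and> unitary_mat m U \<and> unitary_mat n V \<and>
        A = U * sigma_mat m n r \<sigma> * mat_adjoint V \<and>
        (\<forall>i j. i \<le> j \<and> j < r \<longrightarrow> \<sigma> j \<le> \<sigma> i) \<and>
        (\<forall>i<r. 0 < \<sigma> i) \<and>
        (\<forall>i. r \<le> i \<and> i < m \<longrightarrow> \<sigma> i = 0))"

definition nonzero_singular_values :: "nat \<Rightarrow> nat \<Rightarrow> 'k::real_or_complex mat \<Rightarrow> real set" where
  "nonzero_singular_values m n A =
     {\<sigma> i | U \<sigma> V i. full_svd m n A U \<sigma> V \<and> i < vec_space.rank m A}"

definition singular_component :: "nat \<Rightarrow> 'k::real_or_complex mat \<Rightarrow> real \<Rightarrow> 'k vec set" where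
  "singular_component m A s =
     {v \<in> carrier_vec m. (A * mat_adjoint A) *\<^sub>v v = of_real (s\<^sup>2) \<cdot>\<^sub>v v}"

definition vec_span :: "nat \<Rightarrow> 'k::field vec set \<Rightarrow> 'k vec set" where
  "vec_span m S = LinearCombinations.module.span class_ring (module_vec TYPE('k) m) S"

text \<open>
  The components are eigenspaces for distinct eigenvalues, so their sum, which is the span of
  their union, is direct.
\<close>

definition left_singular_subspace ::
    "nat \<Rightarrow> nat \<Rightarrow> 'k::real_or_complex mat \<Rightarrow> 'k vec set \<Rightarrow> bool" where
  "left_singular_subspace m n A W \<longleftrightarrow>
     (\<exists>S \<subseteq> insert 0 (nonzero_singular_values m n A).
        W = vec_span m (\<Union>s\<in>S. singular_component m A s))"

definition column_span :: "nat \<Rightarrow> 'k::real_or_complex mat \<Rightarrow> nat set \<Rightarrow> 'k vec set" where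
  "column_span m U \<pi> = vec_span m (col U ` \<pi>)"

definition singular_domain :: "nat \<Rightarrow> nat \<Rightarrow> nat set \<Rightarrow> 'k::real_or_complex mat set" where
  "singular_domain m n \<pi> =
     {A \<in> carrier_mat m n. \<exists>U \<sigma> V. full_svd m n A U \<sigma> V \<and>
        left_singular_subspace m n A (column_span m U \<pi>)}"

text \<open>
  On \<^const>\<open>singular_domain\<close> the span does not depend on the decomposition.
\<close>

definition singular_map :: "nat \<Rightarrow> nat \<Rightarrow> nat set \<Rightarrow> 'k::real_or_complex mat \<Rightarrow> 'k vec set" where
  "singular_map m n \<pi> A =
     (THE W. \<exists>U \<sigma> V. full_svd m n A U \<sigma> V \<and> W = column_span m U \<pi>)"

text \<open>
  A point of the Grassmannian is a \<open>d\<close>-dimensional subspace \<open>W\<close> of the column vectors of length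
  \<open>p\<close>; the projector identified with it is \<open>Q * mat_adjoint Q\<close> for any \<open>Q\<close> with
  \<open>orthonormal_basis_mat p d W Q\<close>. Neither the singular values of a matrix nor the principal
  angles depend on the choices bound by the existential quantifiers.
\<close>

definition orthonormal_basis_mat ::
    "nat \<Rightarrow> nat \<Rightarrow> 'k::real_or_complex vec set \<Rightarrow> 'k mat \<Rightarrow> bool" where
  "orthonormal_basis_mat p d W Q \<longleftrightarrow>
     Q \<in> carrier_mat p d \<and> mat_adjoint Q * Q = 1\<^sub>m d \<and> W = column_span p Q {..<d}"

definition singular_value :: "nat \<Rightarrow> nat \<Rightarrow> 'k::real_or_complex mat \<Rightarrow> nat \<Rightarrow> real" where
  "singular_value m n A i = (THE s. \<exists>U \<sigma> V. full_svd m n A U \<sigma> V \<and> s = \<sigma> i)"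

definition principal_angle ::
    "nat \<Rightarrow> nat \<Rightarrow> 'k::real_or_complex vec set \<Rightarrow> 'k vec set \<Rightarrow> nat \<Rightarrow> real" where
  "principal_angle p d W W' i =
     (THE \<theta>. \<exists>Q Q'. orthonormal_basis_mat p d W Q \<and> orthonormal_basis_mat p d W' Q' \<and>
        \<theta> = arccos (singular_value d d (mat_adjoint Q * Q') i))"

definition chordal_dist ::
    "nat \<Rightarrow> nat \<Rightarrow> 'k::real_or_complex vec set \<Rightarrow> 'k vec set \<Rightarrow> real" where
  "chordal_dist p d W W' = sqrt (\<Sum>i<d. (sin (principal_angle p d W W' i))\<^sup>2)"

definition grassmann_dist ::
    "nat \<Rightarrow> nat \<Rightarrow> 'k::real_or_complex vec set \<Rightarrow> 'k vec set \<Rightarrow> real" where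
  "grassmann_dist p d W W' = sqrt (\<Sum>i<d. (principal_angle p d W W' i)\<^sup>2)"

definition procrustes_dist ::
    "nat \<Rightarrow> nat \<Rightarrow> 'k::real_or_complex vec set \<Rightarrow> 'k vec set \<Rightarrow> real" where
  "procrustes_dist p d W W' = sqrt (\<Sum>i<d. (2 * sin (principal_angle p d W W' i / 2))\<^sup>2)"

definition pair_condition :: "(nat \<Rightarrow> real) \<Rightarrow> nat \<Rightarrow> nat \<Rightarrow> real" where
  "pair_condition \<sigma> i j =
     1 / \<bar>\<sigma> i - \<sigma> j\<bar> * sqrt (((\<sigma> i)\<^sup>2 + (\<sigma> j)\<^sup>2) / (\<sigma> i + \<sigma> j)\<^sup>2)"

definition elem_mat :: "nat \<Rightarrow> nat \<Rightarrow> nat \<Rightarrow> 'k::real_or_complex mat" where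
  "elem_mat p i j = mat_of_cols p [unit_vec p i] * mat_of_rows p [unit_vec p j]"

definition extremal_perturbation ::
    "nat \<Rightarrow> nat \<Rightarrow> nat \<Rightarrow> 'k::real_or_complex mat \<Rightarrow> (nat \<Rightarrow> real) \<Rightarrow> 'k mat \<Rightarrow>
     nat \<Rightarrow> nat \<Rightarrow> 'k mat" where
  "extremal_perturbation m n r U \<sigma> V i j =
     U * (elem_mat m j i - elem_mat m i j) * sigma_mat m n r \<sigma> * mat_adjoint V +
     (if i < r \<and> j < r
      then of_real (2 * (\<sigma> i * \<sigma> j / ((\<sigma> i)\<^sup>2 + (\<sigma> j)\<^sup>2))) \<cdot>\<^sub>m
             (U * sigma_mat m n r \<sigma> * (elem_mat n i j - elem_mat n j i) * mat_adjoint V)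
      else 0\<^sub>m m n)"

end

theory Submission
  imports Defs "Jordan_Normal_Form.Spectral_Radius" "HOL-Analysis.L2_Norm"
begin

text \<open>
  The left singular subspaces of \<open>A\<close> are the spectral subspaces of \<open>A A\<^sup>H\<close>, so the statement is
  about the first-order perturbation of a spectral projector. Write everything in the coordinates of
  the left singular vectors \<open>U\<close> of \<open>A\<close>. The projector onto \<open>U\<^sub>\<pi>\<close> becomes the coordinate projector
  \<open>D\<close> of \<open>\<pi>\<close>, and the projector of a nearby matrix \<open>A + E\<close> becomes some projector \<open>T\<close>. Since \<open>T\<close>
  commutes with \<open>(A + E) (A + E)\<^sup>H\<close>, it solves the Sylvester equation
  \<open>(\<sigma>\<^sub>b\<^sup>2 - \<sigma>\<^sub>a\<^sup>2) T\<^sub>a\<^sub>b = (G T - T G)\<^sub>a\<^sub>b\<close>, where \<open>G\<close> is the perturbation of \<open>A A\<^sup>H\<close>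
  (lemma \<open>sylvester_equation\<close>). Replacing \<open>T\<close> by \<open>D\<close> on the right costs only a quadratic error, so for
  \<open>a \<notin> \<pi>\<close>, \<open>b \<in> \<pi>\<close> the entry \<open>T\<^sub>a\<^sub>b\<close> is, up to \<open>O(\<parallel>E\<parallel>\<^sup>2)\<close>,
  \<open>(\<sigma>\<^sub>a conj(e\<^sub>b\<^sub>a) + \<sigma>\<^sub>b e\<^sub>a\<^sub>b) / (\<sigma>\<^sub>b\<^sup>2 - \<sigma>\<^sub>a\<^sup>2)\<close> with \<open>e = U\<^sup>H E V\<close>. This linear map of \<open>E\<close> is called
  \<open>first_order\<close> below.

  The chordal distance of the two subspaces is \<open>\<parallel>(1 - D) T\<parallel>\<close>, which equals the norm of the corner
  block \<open>a \<notin> \<pi>\<close>, \<open>b \<in> \<pi>\<close> of \<open>T\<close> up to a quadratic error. So it is \<open>\<parallel>first_order E\<parallel>\<close> up to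
  \<open>O(\<parallel>E\<parallel>\<^sup>2)\<close> (lemma \<open>singular_map_expansion\<close>). By Cauchy-Schwarz applied to each entry,
  \<open>\<parallel>first_order E\<parallel>\<close> is at most the maximum of the pair conditions times \<open>\<parallel>E\<parallel>\<close>, with equality
  if \<open>e\<close> is supported on the positions \<open>(j, i)\<close> and \<open>(i, j)\<close> of a maximizing pair, with real entries
  proportional to \<open>\<sigma>\<^sub>i\<close> and \<open>\<sigma>\<^sub>j\<close> there. The perturbation of the theorem is of this form
  (lemmas \<open>first_order_bound\<close> and \<open>extremal_perturbation_attains\<close>).

  The Grassmann and Procrustes distances differ from the chordal one by a factor that tends to 1
  (lemma \<open>distances_comparable\<close>), so one expansion serves all three.

  Three things are needed before this argument makes sense for the relational definitions of
  singular values and angles: singular value decompositions exist over both fields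
  (lemma \<open>full_svd_exists\<close>), the singular values are unique and depend continuously on the matrix
  (lemma \<open>singular_value_perturbation\<close>), and the domain consists of the matrices for which no
  singular value with index in \<open>\<pi>\<close> equals one with index outside \<open>\<pi>\<close>
  (lemmas \<open>separated_if_singular_domain\<close> and \<open>singular_domain_if_separated\<close>). Continuity then shows
  that all matrices near \<open>A\<close> belong to the domain.
\<close>

section \<open>Scalars\<close>

lemma to_complex_diff: "to_complex (x - y) = to_complex x - to_complex (y::'k::real_or_complex)"
  using to_complex_add[of "x - y" y] by simp

lemma to_complex_0 [simp]: "to_complex (0::'k::real_or_complex) = 0"
  using to_complex_diff[of "0::'k" 0] by simp

lemma to_complex_of_real' [simp]: "to_complex (of_real a :: 'k::real_or_complex) = of_real a"
  by (simp add: of_real_def to_complex_of_real flip: scaleR_conv_of_real)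

lemma to_complex_1 [simp]: "to_complex (1::'k::real_or_complex) = 1"
  using to_complex_of_real'[of 1, where 'k='k] by simp

lemma to_complex_eq_iff [simp]: "to_complex x = to_complex y \<longleftrightarrow> x = (y::'k::real_or_complex)"
proof
  assume "to_complex x = to_complex y"
  then have "norm (x - y) = 0"
    using norm_to_complex[of "x - y"] by (simp add: to_complex_diff)
  then show "x = y" by simp
qed simp

text \<open>Determinants commute with this embedding, so singularity of a matrix can be tested over the
  complex numbers, where characteristic polynomials have roots.\<close>

lemma inj_comm_ring_hom_to_complex:
  "inj_comm_ring_hom (to_complex :: 'k::real_or_complex \<Rightarrow> complex)"
proof unfold_locales
  show "x = 0" if "to_complex x = 0" for x :: 'k
    using that to_complex_eq_iff[of x 0] by simp
qed (auto simp: to_complex_add to_complex_mult intro: injI)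

lemma norm_conjugate [simp]: "norm (conjugate x) = norm (x::'k::real_or_complex)"
  using norm_to_complex[of x] norm_to_complex[of "conjugate x"] by (simp add: to_complex_conjugate)

lemma conjugate_of_real [simp]: "conjugate (of_real a) = (of_real a :: 'k::real_or_complex)"
  by (subst to_complex_eq_iff[symmetric]) (simp add: to_complex_conjugate)

lemma conjugate_1 [simp]: "conjugate 1 = (1 :: 'k::real_or_complex)"
  using conjugate_of_real[of 1, where 'k='k] by simp

lemma conjugate_diff: "conjugate (x - y) = conjugate x - conjugate (y :: 'k::real_or_complex)"
  using conjugate_dist_add[of x "-y"] by (simp add: conjugate_neg)

lemma conjugate_mult_self: "conjugate x * x = of_real ((norm x)\<^sup>2)" for x :: "'k::real_or_complex"
  by (subst to_complex_eq_iff[symmetric])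
    (simp only: to_complex_conjugate to_complex_mult to_complex_of_real' mult.commute[of "cnj _"] complex_norm_square[symmetric] norm_to_complex)

section \<open>Adjoints\<close>

abbreviation adjoint :: "'k::real_or_complex mat \<Rightarrow> 'k mat"  ("_\<^sup>H" [1000] 1000)
  where "A\<^sup>H \<equiv> mat_adjoint A"

lemma dim_adjoint [simp]: "dim_row A\<^sup>H = dim_col A" "dim_col A\<^sup>H = dim_row A"
  by (simp_all add: mat_adjoint_def)

lemma index_adjoint [simp]:
  "i < dim_col A \<Longrightarrow> j < dim_row A \<Longrightarrow> A\<^sup>H $$ (i, j) = conjugate (A $$ (j, i))"
  by (simp add: mat_adjoint_def mat_of_rows_index)

lemma adjoint_carrier [simp, intro]: "A \<in> carrier_mat m n \<Longrightarrow> A\<^sup>H \<in> carrier_mat n m"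
  by (auto intro: carrier_matI)

lemma adjoint_adjoint [simp]: "(A\<^sup>H)\<^sup>H = A"
  by (rule eq_matI) auto

lemma adjoint_add:
  "dim_row A = dim_row B \<Longrightarrow> dim_col A = dim_col B \<Longrightarrow> (A + B)\<^sup>H = A\<^sup>H + B\<^sup>H"
  by (rule eq_matI) (auto simp: conjugate_dist_add)

lemma adjoint_diff:
  "dim_row A = dim_row B \<Longrightarrow> dim_col A = dim_col B \<Longrightarrow> (A - B)\<^sup>H = A\<^sup>H - B\<^sup>H"
  by (rule eq_matI) (auto simp: conjugate_diff)

lemma index_mult_mat_sum:
  "i < dim_row A \<Longrightarrow> j < dim_col B \<Longrightarrow> dim_row B = dim_col A \<Longrightarrow>
     (A * B) $$ (i, j) = (\<Sum>l<dim_col A. A $$ (i, l) * B $$ (l, j))"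
  by (simp add: scalar_prod_def atLeast0LessThan)

lemma index_mult_mat_vec_sum:
  "i < dim_row A \<Longrightarrow> dim_vec v = dim_col A \<Longrightarrow>
     (A *\<^sub>v v) $ i = (\<Sum>l<dim_col A. A $$ (i, l) * v $ l)"
  by (simp add: scalar_prod_def atLeast0LessThan)

text \<open>The default rules expand entries of products into scalar products of rows and columns and
  reassociate under carrier conditions; the dimension-based rules of this section replace them.\<close>

declare index_mult_mat(1) [simp del] index_mult_mat_vec [simp del] assoc_mult_mat [simp del]

lemma adjoint_mult:
  assumes "dim_col A = dim_row B"
  shows "(A * B)\<^sup>H = B\<^sup>H * A\<^sup>H"
  using assms
  by (intro eq_matI)
    (auto simp: index_mult_mat_sum sum_conjugate conjugate_dist_mul mult.commute)

text \<open>Stated with dimensions instead of carriers, so that the simplifier can discharge the side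
  conditions when it normalizes products.\<close>

lemma mult_mat_assoc:
  "dim_col A = dim_row B \<Longrightarrow> dim_col B = dim_row C \<Longrightarrow> (A * B) * C = A * (B * C)"
  for A :: "'k::semiring_0 mat"
  by (rule assoc_mult_mat[of A "dim_row A" "dim_col A" B "dim_col B" C "dim_col C"]) auto

lemma mult_mat_cancel:
  assumes "A * B = 1\<^sub>m p" "dim_col A = dim_row B" "dim_col B = dim_row C" "dim_row C = p"
  shows "A * (B * C) = (C :: 'k::semiring_1 mat)"
  using assms mult_mat_assoc[of A B C] left_mult_one_mat[of C p "dim_col C"] by simp

lemma unitary_matD:
  assumes "unitary_mat p U"
  shows "dim_row U = p" "dim_col U = p" "U \<in> carrier_mat p p" "U\<^sup>H * U = 1\<^sub>m p" "U * U\<^sup>H = 1\<^sub>m p"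
  using assms by (auto simp: unitary_mat_def)

lemma unitary_cancel:
  assumes "unitary_mat p U" "dim_row C = p"
  shows "U\<^sup>H * (U * C) = C" "U * (U\<^sup>H * C) = C"
  using assms by (auto simp: unitary_mat_def intro!: mult_mat_cancel)

lemma unitary_mat_if_isometry:
  assumes "U \<in> carrier_mat p p" "U\<^sup>H * U = 1\<^sub>m p"
  shows "unitary_mat p U"
  using assms mat_mult_left_right_inverse[of "U\<^sup>H" p U] by (auto simp: unitary_mat_def)

lemma unitary_mat_adjoint: "unitary_mat p U \<Longrightarrow> unitary_mat p U\<^sup>H"
  by (auto simp: unitary_mat_def)

lemma unitary_mat_mult:
  assumes "unitary_mat p U" "unitary_mat p U'"
  shows "unitary_mat p (U * U')"
  using unitary_matD[OF assms(1)] unitary_matD[OF assms(2)]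
  by (intro unitary_mat_if_isometry)
    (auto simp: adjoint_mult mult_mat_assoc unitary_cancel[OF assms(1)])

section \<open>The Frobenius norm\<close>

abbreviation "fnorm \<equiv> frobenius_norm"

lemma frobenius_norm_L2:
  "fnorm A = L2_set (\<lambda>(i, j). norm (A $$ (i, j))) ({..<dim_row A} \<times> {..<dim_col A})"
  by (simp add: frobenius_norm_def L2_set_def sum.cartesian_product case_prod_unfold)

lemma frobenius_norm_nonneg [simp]: "0 \<le> fnorm A"
  by (simp add: frobenius_norm_def sum_nonneg)

lemma frobenius_norm_sq:
  "(fnorm A)\<^sup>2 = (\<Sum>i<dim_row A. \<Sum>j<dim_col A. (norm (A $$ (i, j)))\<^sup>2)"
  by (simp add: frobenius_norm_def sum_nonneg)

lemma frobenius_norm_mono: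
  assumes "dim_row A = dim_row B" "dim_col A = dim_col B"
    and "\<And>i j. i < dim_row B \<Longrightarrow> j < dim_col B \<Longrightarrow> norm (A $$ (i, j)) \<le> norm (B $$ (i, j))"
  shows "fnorm A \<le> fnorm B"
  unfolding frobenius_norm_L2 using assms by (auto intro!: L2_set_mono)

lemma frobenius_norm_smult: "fnorm (c \<cdot>\<^sub>m A) = norm c * fnorm A"
  by (simp add: frobenius_norm_def norm_mult power_mult_distrib real_sqrt_mult
      flip: sum_distrib_left)

lemma frobenius_norm_triangle:
  assumes "dim_row A = dim_row B" "dim_col A = dim_col B"
  shows "fnorm (A + B) \<le> fnorm A + fnorm B"
proof -
  let ?I = "{..<dim_row B} \<times> {..<dim_col B}"
  have "fnorm (A + B) = L2_set (\<lambda>(i, j). norm (A $$ (i, j) + B $$ (i, j))) ?I"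
    unfolding frobenius_norm_L2 using assms by (auto intro!: L2_set_cong)
  also have "\<dots> \<le> L2_set (\<lambda>x. (\<lambda>(i, j). norm (A $$ (i, j))) x + (\<lambda>(i, j). norm (B $$ (i, j))) x) ?I"
    by (intro L2_set_mono) (auto intro: norm_triangle_ineq)
  also have "\<dots> \<le> fnorm A + fnorm B"
    unfolding frobenius_norm_L2 using assms L2_set_triangle_ineq[of "\<lambda>(i, j). norm (A $$ (i, j))"
        "\<lambda>(i, j). norm (B $$ (i, j))" ?I] by simp
  finally show ?thesis .
qed

lemma frobenius_norm_uminus [simp]: "fnorm (- A) = fnorm A"
  by (simp add: frobenius_norm_def)

lemma frobenius_norm_diff_triangle:
  assumes "dim_row A = dim_row B" "dim_col A = dim_col B"
  shows "fnorm (A - B) \<le> fnorm A + fnorm B"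
proof -
  have "A - B = A + (- B)" using assms by (intro eq_matI) auto
  then show ?thesis using frobenius_norm_triangle[of A "- B"] assms by simp
qed

lemma frobenius_norm_diff_ineq:
  assumes "dim_row A = dim_row B" "dim_col A = dim_col B"
  shows "\<bar>fnorm A - fnorm B\<bar> \<le> fnorm (A - B)"
proof -
  have "A = (A - B) + B" "B = A - (A - B)" using assms by (auto intro!: eq_matI)
  then show ?thesis
    using frobenius_norm_triangle[of "A - B" B] frobenius_norm_diff_triangle[of A "A - B"] assms
    by simp
qed

lemma frobenius_norm_adjoint [simp]: "fnorm A\<^sup>H = fnorm A"
  unfolding frobenius_norm_def by (subst sum.swap) simp

lemma frobenius_norm_mult:
  assumes "dim_col A = dim_row B"
  shows "fnorm (A * B) \<le> fnorm A * fnorm B"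
proof -
  have "(norm ((A * B) $$ (i, j)))\<^sup>2
      \<le> (\<Sum>l<dim_col A. (norm (A $$ (i, l)))\<^sup>2) * (\<Sum>l<dim_col A. (norm (B $$ (l, j)))\<^sup>2)"
    if "i < dim_row A" "j < dim_col B" for i j
  proof -
    have "norm ((A * B) $$ (i, j)) \<le> (\<Sum>l<dim_col A. norm (A $$ (i, l)) * norm (B $$ (l, j)))"
      using that assms
      by (auto simp: index_mult_mat_sum norm_mult
          intro!: order_trans[OF norm_sum])
    also have "\<dots> \<le> L2_set (\<lambda>l. norm (A $$ (i, l))) {..<dim_col A}
        * L2_set (\<lambda>l. norm (B $$ (l, j))) {..<dim_col A}"
      using L2_set_mult_ineq[of "\<lambda>l. norm (A $$ (i, l))" "\<lambda>l. norm (B $$ (l, j))"] by simp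
    finally have "(norm ((A * B) $$ (i, j)))\<^sup>2 \<le> (L2_set (\<lambda>l. norm (A $$ (i, l))) {..<dim_col A}
        * L2_set (\<lambda>l. norm (B $$ (l, j))) {..<dim_col A})\<^sup>2"
      by (intro power_mono) auto
    then show ?thesis by (simp add: power_mult_distrib L2_set_def sum_nonneg)
  qed
  then have "(fnorm (A * B))\<^sup>2 \<le> (\<Sum>i<dim_row A. \<Sum>j<dim_col B.
      (\<Sum>l<dim_col A. (norm (A $$ (i, l)))\<^sup>2) * (\<Sum>l<dim_col A. (norm (B $$ (l, j)))\<^sup>2))"
    unfolding frobenius_norm_sq by (auto intro!: sum_mono)
  also have "\<dots> = (\<Sum>i<dim_row A. \<Sum>l<dim_col A. (norm (A $$ (i, l)))\<^sup>2)
      * (\<Sum>j<dim_col B. \<Sum>l<dim_col A. (norm (B $$ (l, j)))\<^sup>2)"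
    by (rule sum_product[symmetric])
  also have "\<dots> = (fnorm A * fnorm B)\<^sup>2"
    by (simp only: power_mult_distrib frobenius_norm_sq assms
        sum.swap[of "\<lambda>j l. (norm (B $$ (l, j)))\<^sup>2" "{..<dim_row B}" "{..<dim_col B}"])
  finally show ?thesis by (rule power2_le_imp_le) simp
qed

lemma gram_diagonal:
  assumes "j < dim_col A"
  shows "(A\<^sup>H * A) $$ (j, j) = of_real (\<Sum>i<dim_row A. (norm (A $$ (i, j)))\<^sup>2)"
  using assms by (simp add: index_mult_mat_sum conjugate_mult_self)

text \<open>The squared norm is the trace of the Gram matrix.\<close>

lemma frobenius_norm_gram:
  assumes "A\<^sup>H * A = B\<^sup>H * B"
  shows "fnorm A = fnorm B"
proof -
  have dim: "dim_col A = dim_col B" using arg_cong[OF assms, of dim_col] by simp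
  have "(\<Sum>i<dim_row A. (norm (A $$ (i, j)))\<^sup>2) = (\<Sum>i<dim_row B. (norm (B $$ (i, j)))\<^sup>2)"
    if "j < dim_col B" for j
    using gram_diagonal[of j A] gram_diagonal[of j B] assms that dim by (simp only: of_real_eq_iff)
  then show ?thesis
    unfolding frobenius_norm_def
    by (subst (1 2) sum.swap) (simp add: dim)
qed

lemma frobenius_norm_isometry:
  assumes "Q\<^sup>H * Q = 1\<^sub>m (dim_row B)" "dim_col Q = dim_row B"
  shows "fnorm (Q * B) = fnorm B"
  using assms by (intro frobenius_norm_gram) (simp add: adjoint_mult mult_mat_assoc mult_mat_cancel)

lemma frobenius_norm_unitary_left:
  assumes "unitary_mat p U" "dim_row B = p"
  shows "fnorm (U * B) = fnorm B" "fnorm (U\<^sup>H * B) = fnorm B"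
  using assms by (auto simp: unitary_mat_def intro!: frobenius_norm_isometry)

lemma frobenius_norm_unitary_right:
  assumes "unitary_mat p U" "dim_col B = p"
  shows "fnorm (B * U) = fnorm B" "fnorm (B * U\<^sup>H) = fnorm B"
  using frobenius_norm_unitary_left[OF assms(1), of "B\<^sup>H"] assms unitary_matD[OF assms(1)]
    frobenius_norm_adjoint[of "B * U"] frobenius_norm_adjoint[of "B * U\<^sup>H"]
  by (auto simp: adjoint_mult)

section \<open>Spectral theorem\<close>

definition real_diag :: "nat \<Rightarrow> (nat \<Rightarrow> real) \<Rightarrow> 'k::real_or_complex mat" where
  "real_diag p f = mat p p (\<lambda>(i, j). if i = j then of_real (f i) else 0)"

lemma real_diag_dim [simp]:
  "dim_row (real_diag p f) = p" "dim_col (real_diag p f) = p"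
  by (simp_all add: real_diag_def)

lemma real_diag_carrier [simp]: "real_diag p f \<in> carrier_mat p p"
  by (simp add: real_diag_def)

lemma real_diag_index [simp]:
  "i < p \<Longrightarrow> j < p \<Longrightarrow> real_diag p f $$ (i, j) = (if i = j then of_real (f i) else 0)"
  by (simp add: real_diag_def)

lemma adjoint_real_diag [simp]: "(real_diag p f)\<^sup>H = (real_diag p f :: 'k::real_or_complex mat)"
  by (rule eq_matI) auto

lemma index_mult_real_diag:
  assumes "i < dim_row A" "j < dim_col A" "dim_col A = p"
  shows "(A * real_diag p f) $$ (i, j) = A $$ (i, j) * of_real (f j)"
  using assms
  by (simp add: index_mult_mat_sum if_distrib [of "(*) _"] sum.delta' cong: if_cong)

lemma index_real_diag_mult:
  assumes "i < dim_row A" "j < dim_col A" "dim_row A = p"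
  shows "(real_diag p f * A) $$ (i, j) = of_real (f i) * A $$ (i, j)"
proof -
  have "(\<Sum>l<p. (if i = l then of_real (f i) else 0) * A $$ (l, j))
      = (\<Sum>l<p. if i = l then of_real (f i) * A $$ (l, j) else 0)"
    by (intro sum.cong) auto
  then show ?thesis
    using assms by (simp add: index_mult_mat_sum)
qed

lemma real_diag_mult_real_diag:
  "real_diag p f * real_diag p g = (real_diag p (\<lambda>i. f i * g i) :: 'k::real_or_complex mat)"
  by (rule eq_matI) (auto simp: index_mult_real_diag)

lemma isometry_columns:
  assumes "Q\<^sup>H * Q = 1\<^sub>m d" "i < d" "j < d" "dim_row Q = m"
  shows "(\<Sum>a<m. conjugate (Q $$ (a, i)) * Q $$ (a, j)) = (if i = j then 1 else 0)"
proof -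
  have "dim_col Q = d"
    using arg_cong[OF assms(1), of dim_col] by simp
  then show ?thesis
    using assms index_mult_mat_sum[of i "Q\<^sup>H" j Q] by simp
qed

lemma isometry_column_norm:
  assumes "Q\<^sup>H * Q = 1\<^sub>m d" "j < d" "dim_row Q = m"
  shows "(\<Sum>a<m. (norm (Q $$ (a, j)))\<^sup>2) = 1"
proof -
  have "of_real (\<Sum>a<m. (norm (Q $$ (a, j)))\<^sup>2) = (of_real 1 :: 'a)"
    using isometry_columns[OF assms(1,2,2,3)] by (simp add: conjugate_mult_self)
  then show ?thesis by (simp only: of_real_eq_iff)
qed

lemma unitary_row_norm:
  assumes "unitary_mat m X" "a < m"
  shows "(\<Sum>b<m. (norm (X $$ (a, b)))\<^sup>2) = 1"
  using isometry_column_norm[of "X\<^sup>H" m a m] assms unitary_matD[OF assms(1)] by simp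

lemma unitary_column_norm:
  assumes "unitary_mat m X" "b < m"
  shows "(\<Sum>a<m. (norm (X $$ (a, b)))\<^sup>2) = 1"
  using isometry_column_norm[of "X" m b m] assms unitary_matD[OF assms(1)] by simp

lemma exists_unit_multiple:
  fixes v :: "'k::real_or_complex vec"
  assumes "v \<in> carrier_vec n" "v \<noteq> 0\<^sub>v n"
  obtains c :: real where "(\<Sum>a<n. (norm ((of_real c \<cdot>\<^sub>v v) $ a))\<^sup>2) = 1"
proof -
  define s where "s = (\<Sum>a<n. (norm (v $ a))\<^sup>2)"
  obtain a where "a < n" "v $ a \<noteq> 0"
    using assms by (metis carrier_vecD eq_vecI index_zero_vec)
  then have "0 < s"
    unfolding s_def by (intro sum_pos2[of _ a]) auto
  have "(\<Sum>a<n. (norm ((of_real (1 / sqrt s) \<cdot>\<^sub>v v) $ a))\<^sup>2) = (1 / sqrt s)\<^sup>2 * s"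
    unfolding s_def sum_distrib_left using assms
    by (intro sum.cong) (auto simp: norm_mult norm_divide power_mult_distrib power_divide)
  also have "\<dots> = 1" using \<open>0 < s\<close> by (simp add: power_divide)
  finally show thesis by (rule that)
qed

text \<open>Over the complex numbers the characteristic polynomial has a root. It is real because the
  matrix is hermitian, so the characteristic matrix at this root already has entries in the original
  field, and it is singular there as well.\<close>

lemma hermitian_eigenvector:
  fixes B :: "'k::real_or_complex mat"
  assumes B: "B \<in> carrier_mat n n" "B\<^sup>H = B" and n: "0 < n"
  obtains \<mu> :: real and x where "x \<in> carrier_vec n" "(\<Sum>a<n. (norm (x $ a))\<^sup>2) = 1"
    "B *\<^sub>v x = of_real \<mu> \<cdot>\<^sub>v x"
proof -
  interpret h: inj_comm_ring_hom "to_complex :: 'k \<Rightarrow> complex"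
    by (rule inj_comm_ring_hom_to_complex)
  define C where "C = map_mat to_complex B"
  have C: "C \<in> carrier_mat n n" using B by (simp add: C_def)
  have C_sym: "cnj (C $$ (a, b)) = C $$ (b, a)" if "a < n" "b < n" for a b
    using index_adjoint[of b B a] that B by (simp add: C_def flip: to_complex_conjugate)
  obtain z where "eigenvalue C z"
    using spectrum_non_empty[OF C n] by (auto simp: spectrum_def)
  then obtain w where w: "w \<in> carrier_vec n" "w \<noteq> 0\<^sub>v n" "C *\<^sub>v w = z \<cdot>\<^sub>v w"
    using C by (auto simp: eigenvalue_def eigenvector_def)
  have entry: "(\<Sum>b<n. C $$ (a, b) * w $ b) = z * w $ a" if "a < n" for a
  proof -
    have "(\<Sum>b<n. C $$ (a, b) * w $ b) = (C *\<^sub>v w) $ a"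
      using that C w(1) by (subst index_mult_mat_vec_sum) auto
    then show ?thesis using w(1,3) that by simp
  qed
  define s where "s = (\<Sum>a<n. (cmod (w $ a))\<^sup>2)"
  obtain a where "a < n" "w $ a \<noteq> 0"
    using w by (metis carrier_vecD eq_vecI index_zero_vec)
  then have "0 < s"
    unfolding s_def by (intro sum_pos2[of _ a]) auto
  define q where "q = (\<Sum>a<n. \<Sum>b<n. cnj (w $ a) * (C $$ (a, b) * w $ b))"
  have "q = (\<Sum>a<n. cnj (w $ a) * (z * w $ a))"
    unfolding q_def sum_distrib_left[symmetric] by (intro sum.cong) (auto simp: entry)
  also have "\<dots> = z * of_real s"
    unfolding s_def of_real_sum complex_norm_square sum_distrib_left
    by (intro sum.cong) (auto simp: mult_ac)
  finally have "q = z * of_real s" .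
  moreover have "cnj q = q"
    unfolding q_def by (subst (2) sum.swap) (auto simp: C_sym mult_ac intro!: sum.cong)
  ultimately have "cnj z = z"
    using \<open>0 < s\<close> by (metis complex_cnj_complex_of_real complex_cnj_mult less_numeral_extra(3)
        mult_right_cancel of_real_eq_0_iff)
  then obtain \<mu> where \<mu>: "z = of_real \<mu>" by (metis Reals_cnj_iff Reals_cases)
  have "char_matrix C z = map_mat to_complex (char_matrix B (of_real \<mu>))"
    using B by (intro eq_matI) (auto simp: char_matrix_def C_def \<mu> to_complex_diff)
  then have "det (char_matrix B (of_real \<mu>)) = 0"
    using \<open>eigenvalue C z\<close> eigenvalue_det[OF C] by simp
  then obtain v where v: "v \<in> carrier_vec n" "v \<noteq> 0\<^sub>v n" "B *\<^sub>v v = of_real \<mu> \<cdot>\<^sub>v v"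
    using eigenvalue_det[OF B(1)] B(1) by (auto simp: eigenvalue_def eigenvector_def)
  obtain c :: real where c: "(\<Sum>a<n. (norm ((of_real c \<cdot>\<^sub>v v) $ a))\<^sup>2) = 1"
    using exists_unit_multiple[OF v(1,2)] .
  have "B *\<^sub>v (of_real c \<cdot>\<^sub>v v) = of_real \<mu> \<cdot>\<^sub>v (of_real c \<cdot>\<^sub>v v)"
    using B v by (simp add: mult_mat_vec smult_smult_assoc mult.commute)
  with c v(1) show thesis by (intro that[of "of_real c \<cdot>\<^sub>v v"]) auto
qed

definition append_column :: "'k mat \<Rightarrow> 'k vec \<Rightarrow> 'k mat" where
  "append_column Q x = mat (dim_row Q) (Suc (dim_col Q))
     (\<lambda>(a, j). if j < dim_col Q then Q $$ (a, j) else x $ a)"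

lemma append_column_isometry:
  fixes Q :: "'k::real_or_complex mat"
  assumes Q: "Q \<in> carrier_mat m d" "Q\<^sup>H * Q = 1\<^sub>m d"
    and x: "x \<in> carrier_vec m" "(\<Sum>a<m. (norm (x $ a))\<^sup>2) = 1" "Q\<^sup>H *\<^sub>v x = 0\<^sub>v d"
  shows "append_column Q x \<in> carrier_mat m (Suc d)"
    "(append_column Q x)\<^sup>H * append_column Q x = 1\<^sub>m (Suc d)"
proof -
  let ?R = "append_column Q x"
  show R: "?R \<in> carrier_mat m (Suc d)"
    using Q by (auto simp: append_column_def)
  have orth: "(\<Sum>a<m. conjugate (Q $$ (a, i)) * x $ a) = 0" if "i < d" for i
  proof -
    have "(\<Sum>a<m. conjugate (Q $$ (a, i)) * x $ a) = (Q\<^sup>H *\<^sub>v x) $ i"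
      using that Q(1) x(1) by (subst index_mult_mat_vec_sum) auto
    then show ?thesis using x(3) that by simp
  qed
  have orth': "(\<Sum>a<m. conjugate (x $ a) * Q $$ (a, i)) = 0" if "i < d" for i
    using arg_cong[OF orth[OF that], of conjugate]
    by (simp add: sum_conjugate conjugate_dist_mul mult.commute)
  have unit: "(\<Sum>a<m. conjugate (x $ a) * x $ a) = 1"
  proof -
    have "(\<Sum>a<m. conjugate (x $ a) * x $ a) = of_real (\<Sum>a<m. (norm (x $ a))\<^sup>2)"
      by (simp add: conjugate_mult_self)
    then show ?thesis by (simp only: x(2) of_real_1)
  qed
  show "?R\<^sup>H * ?R = 1\<^sub>m (Suc d)"
  proof (rule eq_matI)
    fix i j assume "i < dim_row (1\<^sub>m (Suc d))" "j < dim_col (1\<^sub>m (Suc d))"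
    then show "(?R\<^sup>H * ?R) $$ (i, j) = 1\<^sub>m (Suc d) $$ (i, j)"
      using R Q orth orth' unit isometry_columns[OF Q(2), of i j m]
      by (cases "i < d"; cases "j < d")
        (auto simp: index_mult_mat_sum append_column_def less_Suc_eq)
  qed (use R in auto)
qed

text \<open>Fewer than \<open>m\<close> linear equations in \<open>m\<close> unknowns have a nonzero solution: after padding with
  zero rows the coefficient matrix is square and singular.\<close>

lemma exists_kernel_vector:
  fixes A :: "'k::field mat"
  assumes "A \<in> carrier_mat d m" "d < m"
  obtains x where "x \<in> carrier_vec m" "x \<noteq> 0\<^sub>v m" "A *\<^sub>v x = 0\<^sub>v d"
proof -
  define M where "M = mat m m (\<lambda>(i, j). if i < d then A $$ (i, j) else 0)"
  have M: "M \<in> carrier_mat m m" by (simp add: M_def)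
  have "M\<^sup>T *\<^sub>v unit_vec m (m - 1) = 0\<^sub>v m"
    using assms by (intro eq_vecI) (auto simp: M_def index_mult_mat_vec)
  then have "det M = 0"
    using det_0_iff_vec_prod_zero[of "M\<^sup>T" m] M assms
    by (auto simp: det_transpose intro!: exI[of _ "unit_vec m (m - 1)"])
  then obtain x where x: "x \<in> carrier_vec m" "x \<noteq> 0\<^sub>v m" "M *\<^sub>v x = 0\<^sub>v m"
    using det_0_iff_vec_prod_zero[OF M] by auto
  have "(A *\<^sub>v x) $ i = 0" if "i < d" for i
    using arg_cong[OF x(3), of "\<lambda>v. v $ i"] that assms x(1)
    by (auto simp: index_mult_mat_vec_sum M_def)
  then have "A *\<^sub>v x = 0\<^sub>v d"
    using assms by (intro eq_vecI) auto
  with x show thesis by (intro that) auto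
qed

text \<open>While there are fewer than \<open>m\<close> columns, a unit vector in the kernel of \<open>Q\<^sup>H\<close> can be appended.\<close>

lemma isometry_extends_to_unitary:
  fixes Q :: "'k::real_or_complex mat"
  assumes "Q \<in> carrier_mat m d" "Q\<^sup>H * Q = 1\<^sub>m d" "d \<le> m"
  shows "\<exists>U. unitary_mat m U \<and> (\<forall>a<m. \<forall>j<d. U $$ (a, j) = Q $$ (a, j))"
  using assms
proof (induction "m - d" arbitrary: d Q)
  case 0
  then show ?case
    by (intro exI[of _ Q]) (auto intro!: unitary_mat_if_isometry)
next
  case (Suc e)
  have d: "d < m" using Suc by auto
  obtain v where v: "v \<in> carrier_vec m" "v \<noteq> 0\<^sub>v m" "Q\<^sup>H *\<^sub>v v = 0\<^sub>v d"
    using exists_kernel_vector[of "Q\<^sup>H" d m] Suc d by auto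
  obtain c :: real where c: "(\<Sum>a<m. (norm ((of_real c \<cdot>\<^sub>v v) $ a))\<^sup>2) = 1"
    using exists_unit_multiple[OF v(1,2)] .
  define x where "x = of_real c \<cdot>\<^sub>v v"
  have x: "x \<in> carrier_vec m" "(\<Sum>a<m. (norm (x $ a))\<^sup>2) = 1" "Q\<^sup>H *\<^sub>v x = 0\<^sub>v d"
    using v c Suc.prems by (auto simp: x_def mult_mat_vec[of _ d m])
  have "e = m - Suc d" "Suc d \<le> m"
    using Suc d by auto
  then obtain U where "unitary_mat m U" "\<forall>a<m. \<forall>j<Suc d. U $$ (a, j) = append_column Q x $$ (a, j)"
    using Suc.hyps(1)[OF _ append_column_isometry[OF Suc.prems(1,2) x]] by auto
  then show ?case
    using Suc.prems by (intro exI[of _ U]) (auto simp: append_column_def)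
qed

lemma isometry_dim_le:
  fixes Q :: "'k::real_or_complex mat"
  assumes "Q \<in> carrier_mat m d" "Q\<^sup>H * Q = 1\<^sub>m d"
  shows "d \<le> m"
proof (rule ccontr)
  assume "\<not> d \<le> m"
  then obtain x where x: "x \<in> carrier_vec d" "x \<noteq> 0\<^sub>v d" "Q *\<^sub>v x = 0\<^sub>v m"
    using exists_kernel_vector[OF assms(1)] by auto
  have "(Q\<^sup>H * Q) *\<^sub>v x = Q\<^sup>H *\<^sub>v (Q *\<^sub>v x)"
    using assms x by (intro assoc_mult_mat_vec[of _ d m _ d]) auto
  then show False using assms x by (auto simp: index_mult_mat_vec)
qed

text \<open>Deflation: in a unitary basis that begins with the eigenvectors found so far, the matrix is
  block diagonal. An eigenvector of the remaining block gives one more eigenvector, orthogonal to the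
  earlier ones.\<close>

lemma hermitian_orthonormal_eigenvectors:
  fixes B :: "'k::real_or_complex mat"
  assumes B: "B \<in> carrier_mat n n" "B\<^sup>H = B" and "d \<le> n"
  shows "\<exists>Q \<mu>. Q \<in> carrier_mat n d \<and> Q\<^sup>H * Q = 1\<^sub>m d \<and> B * Q = Q * real_diag d \<mu>"
  using assms(3)
proof (induction d)
  case 0
  show ?case
    by (intro exI[of _ "0\<^sub>m n 0"]) (use B in \<open>auto intro!: eq_matI\<close>)
next
  case (Suc d)
  then obtain Q \<mu> where Q: "Q \<in> carrier_mat n d" "Q\<^sup>H * Q = 1\<^sub>m d" "B * Q = Q * real_diag d \<mu>"
    by auto
  have d: "d < n" using Suc by auto
  obtain U where U: "unitary_mat n U" and U_Q: "\<And>a j. a < n \<Longrightarrow> j < d \<Longrightarrow> U $$ (a, j) = Q $$ (a, j)"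
    using isometry_extends_to_unitary[OF Q(1,2)] d by auto
  note U' = unitary_matD[OF U]
  define C where "C = U\<^sup>H * (B * U)"
  have C: "C \<in> carrier_mat n n" "C\<^sup>H = C"
    using U' B by (auto simp: C_def adjoint_mult mult_mat_assoc)
  have BU: "B * U = U * C"
    using unitary_cancel(2)[OF U, of "B * U"] B by (simp add: C_def)
  have C0: "C $$ (i, j) = (if i = j then of_real (\<mu> j) else 0)" if "j < d" "i < n" for i j
  proof -
    have "(B * U) $$ (a, j) = U $$ (a, j) * of_real (\<mu> j)" if "a < n" for a
    proof -
      have "(B * U) $$ (a, j) = (B * Q) $$ (a, j)"
        using that \<open>j < d\<close> d B(1) Q(1) U'(1,2) U_Q by (simp add: index_mult_mat_sum)
      also have "\<dots> = Q $$ (a, j) * of_real (\<mu> j)"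
        unfolding Q(3) using that \<open>j < d\<close> Q(1) by (subst index_mult_real_diag) auto
      finally show ?thesis using that \<open>j < d\<close> U_Q by simp
    qed
    then have "C $$ (i, j) = (\<Sum>a<n. conjugate (U $$ (a, i)) * U $$ (a, j)) * of_real (\<mu> j)"
      using that d U' B unfolding C_def sum_distrib_right
      by (subst index_mult_mat_sum) (auto simp: mult_ac)
    then show ?thesis
      using isometry_columns[OF U'(4), of i j n] that d U' by simp
  qed
  have C0': "C $$ (j, i) = (if i = j then of_real (\<mu> j) else 0)" if "j < d" "i < n" for i j
    using C0[OF that] C d that index_adjoint[of j C i] by auto
  \<comment> \<open>the block of \<open>C = U\<^sup>H B U\<close> that belongs to the new basis vectors\<close>
  define S where "S = mat (n - d) (n - d) (\<lambda>(i, j). C $$ (d + i, d + j))"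
  have S: "S \<in> carrier_mat (n - d) (n - d)" "0 < n - d"
    using d by (auto simp: S_def)
  have S_sym: "S\<^sup>H = S"
  proof (rule eq_matI)
    fix i j assume "i < dim_row S" "j < dim_col S"
    then show "S\<^sup>H $$ (i, j) = S $$ (i, j)"
      using C index_adjoint[of "d + i" C "d + j"] by (auto simp: S_def)
  qed (auto simp: S_def)
  obtain \<nu> y where y: "y \<in> carrier_vec (n - d)" "(\<Sum>a<n - d. (norm (y $ a))\<^sup>2) = 1"
    "S *\<^sub>v y = of_real \<nu> \<cdot>\<^sub>v y"
    by (rule hermitian_eigenvector[OF S(1) S_sym S(2)])
  define z where "z = vec n (\<lambda>i. if i < d then 0 else y $ (i - d))"
  have z: "z \<in> carrier_vec n" by (simp add: z_def)
  have split: "(\<Sum>l<n. f l) = (\<Sum>l<d. f l) + (\<Sum>l<n - d. f (d + l))" for f :: "nat \<Rightarrow> 'b::comm_monoid_add"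
    using d sum.nat_group[of f d 1] sum.atLeastLessThan_concat[of 0 d n f] sum.shift_bounds_nat_ivl[of f 0 d "n - d"]
    by (simp add: atLeast0LessThan add.commute)
  have Cz: "C *\<^sub>v z = of_real \<nu> \<cdot>\<^sub>v z"
  proof (rule eq_vecI)
    fix i assume "i < dim_vec (of_real \<nu> \<cdot>\<^sub>v z)"
    then have i: "i < n" by (simp add: z_def)
    have "(C *\<^sub>v z) $ i = (\<Sum>l<n - d. C $$ (i, d + l) * y $ l)"
      using i C z by (simp add: index_mult_mat_vec_sum split z_def)
    also have "\<dots> = of_real \<nu> * z $ i"
    proof (cases "i < d")
      case True
      then show ?thesis using i d C0' by (simp add: z_def)
    next
      case False
      then have "(\<Sum>l<n - d. C $$ (i, d + l) * y $ l) = (S *\<^sub>v y) $ (i - d)"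
        using i y by (subst index_mult_mat_vec_sum) (auto simp: S_def)
      then show ?thesis using False i y by (simp add: z_def)
    qed
    finally show "(C *\<^sub>v z) $ i = (of_real \<nu> \<cdot>\<^sub>v z) $ i" using i z by simp
  qed (use C z in auto)
  define x where "x = U *\<^sub>v z"
  have x: "x \<in> carrier_vec n" using U' z by (simp add: x_def)
  have Bx: "B *\<^sub>v x = of_real \<nu> \<cdot>\<^sub>v x"
  proof -
    have "B *\<^sub>v x = (B * U) *\<^sub>v z" using B U' z by (simp add: x_def)
    also have "\<dots> = U *\<^sub>v (C *\<^sub>v z)" unfolding BU using C U' z by simp
    also have "\<dots> = of_real \<nu> \<cdot>\<^sub>v x" unfolding Cz x_def using U' z by (simp add: mult_mat_vec)
    finally show ?thesis .
  qed
  have Ux: "U\<^sup>H *\<^sub>v x = z"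
    using U' z assoc_mult_mat_vec[of "U\<^sup>H" n n U n z] by (simp add: x_def)
  have Qx: "Q\<^sup>H *\<^sub>v x = 0\<^sub>v d"
  proof (rule eq_vecI)
    fix j assume "j < dim_vec (0\<^sub>v d :: 'k vec)"
    then have "(Q\<^sup>H *\<^sub>v x) $ j = (U\<^sup>H *\<^sub>v x) $ j"
      using d Q U' U_Q x by (simp add: index_mult_mat_vec_sum)
    then show "(Q\<^sup>H *\<^sub>v x) $ j = 0\<^sub>v d $ j"
      using \<open>j < dim_vec (0\<^sub>v d :: 'k vec)\<close> d by (simp add: Ux z_def)
  qed (use Q in auto)
  have norm_x: "(\<Sum>a<n. (norm (x $ a))\<^sup>2) = 1"
  proof -
    have eq: "mat n 1 (\<lambda>(a, _). x $ a) = U * mat n 1 (\<lambda>(a, _). z $ a)"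
      using U' z by (intro eq_matI)
        (auto simp: x_def index_mult_mat_vec_sum index_mult_mat_sum)
    have "(\<Sum>a<n. (norm (x $ a))\<^sup>2) = (fnorm (mat n 1 (\<lambda>(a, _). x $ a)))\<^sup>2"
      by (simp add: frobenius_norm_sq)
    also have "\<dots> = (fnorm (mat n 1 (\<lambda>(a, _). z $ a)))\<^sup>2"
      unfolding eq by (simp add: frobenius_norm_unitary_left[OF U])
    also have "\<dots> = 1"
      using y(2) by (simp add: frobenius_norm_sq split z_def)
    finally show ?thesis .
  qed
  let ?\<mu> = "\<mu>(d := \<nu>)"
  have R: "append_column Q x \<in> carrier_mat n (Suc d)"
    using append_column_isometry[OF Q(1,2) x norm_x Qx] by auto
  have "B * append_column Q x = append_column Q x * real_diag (Suc d) ?\<mu>"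
  proof (rule eq_matI)
    fix a j assume "a < dim_row (append_column Q x * real_diag (Suc d) ?\<mu>)"
      "j < dim_col (append_column Q x * real_diag (Suc d) ?\<mu>)"
    then have aj: "a < n" "j < Suc d" using R by auto
    show "(B * append_column Q x) $$ (a, j) = (append_column Q x * real_diag (Suc d) ?\<mu>) $$ (a, j)"
    proof (cases "j < d")
      case True
      have "(B * append_column Q x) $$ (a, j) = (B * Q) $$ (a, j)"
        using aj True B(1) Q(1) R
        by (simp add: index_mult_mat_sum append_column_def)
      then show ?thesis
        using aj True Q R by (simp add: index_mult_real_diag append_column_def)
    next
      case False
      then have "j = d" using aj by simp
      have "(B * append_column Q x) $$ (a, j) = (B *\<^sub>v x) $ a"
        using aj \<open>j = d\<close> B Q R x
        by (simp add: index_mult_mat_sum index_mult_mat_vec_sum append_column_def)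
      then show ?thesis
        using aj \<open>j = d\<close> Q R x
        by (simp add: Bx index_mult_real_diag append_column_def mult.commute)
    qed
  qed (use B R in auto)
  with append_column_isometry[OF Q(1,2) x norm_x Qx] show ?case by blast
qed

lemma sorting_permutation:
  fixes f :: "nat \<Rightarrow> real"
  obtains p where "bij_betw p {..<n} {..<n}" "antimono_on {..<n} (f \<circ> p)"
proof -
  define xs where "xs = sort_key (\<lambda>i. - f i) [0..<n]"
  have xs: "length xs = n" "distinct xs" "set xs = {..<n}" "sorted (map (\<lambda>i. - f i) xs)"
    by (auto simp: xs_def)
  have "bij_betw ((!) xs) {..<n} {..<n}"
    by (rule bij_betw_nth) (simp_all only: xs(1-3))
  moreover have "antimono_on {..<n} (f \<circ> (!) xs)"
  proof (rule monotone_onI)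
    fix i j assume "i \<in> {..<n}" "j \<in> {..<n}" "i \<le> j"
    then show "(f \<circ> (!) xs) j \<le> (f \<circ> (!) xs) i"
      using sorted_nth_mono[OF xs(4), of i j] by (simp add: xs(1))
  qed
  ultimately show thesis by (rule that)
qed

lemma hermitian_spectral_theorem:
  fixes B :: "'k::real_or_complex mat"
  assumes B: "B \<in> carrier_mat n n" "B\<^sup>H = B"
  obtains U \<mu> where "unitary_mat n U" "antimono_on {..<n} \<mu>" "B * U = U * real_diag n \<mu>"
proof -
  obtain Q \<mu> where Q: "Q \<in> carrier_mat n n" "Q\<^sup>H * Q = 1\<^sub>m n" "B * Q = Q * real_diag n \<mu>"
    using hermitian_orthonormal_eigenvectors[OF B order_refl] by auto
  obtain p where p: "bij_betw p {..<n} {..<n}" "antimono_on {..<n} (\<mu> \<circ> p)"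
    using sorting_permutation[of n \<mu>] .
  have p_less: "p j < n" if "j < n" for j
    using bij_betw_apply[OF p(1), of j] that by simp
  have p_inj: "p i = p j \<longleftrightarrow> i = j" if "i < n" "j < n" for i j
    using p(1) that by (auto simp: bij_betw_def inj_on_def)
  define U where "U = mat n n (\<lambda>(a, j). Q $$ (a, p j))"
  have U: "U \<in> carrier_mat n n" by (simp add: U_def)
  have "U\<^sup>H * U = 1\<^sub>m n"
    using isometry_columns[OF Q(2), of _ _ n] Q p_less p_inj
    by (intro eq_matI) (auto simp: index_mult_mat_sum U_def)
  with U have "unitary_mat n U" by (rule unitary_mat_if_isometry)
  moreover have "B * U = U * real_diag n (\<mu> \<circ> p)"
  proof (rule eq_matI)
    fix a j assume "a < dim_row (U * real_diag n (\<mu> \<circ> p))" "j < dim_col (U * real_diag n (\<mu> \<circ> p))"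
    then have aj: "a < n" "j < n" using U by auto
    have "(B * U) $$ (a, j) = (B * Q) $$ (a, p j)"
      using aj p_less B(1) Q(1) U
      by (simp add: index_mult_mat_sum) (simp add: U_def)
    then show "(B * U) $$ (a, j) = (U * real_diag n (\<mu> \<circ> p)) $$ (a, j)"
      using aj p_less Q U
      by (simp add: index_mult_real_diag) (simp add: U_def)
  qed (use B U in auto)
  ultimately show thesis using p(2) that by blast
qed

section \<open>Singular value decompositions\<close>

lemma vec_span_columns:
  fixes Q :: "'k::real_or_complex mat"
  assumes "Q \<in> carrier_mat m d"
  shows "vec_span m (col Q ` {..<d}) = {Q *\<^sub>v c | c. c \<in> carrier_vec d}"
proof -
  interpret v: vec_space "TYPE('k)" m .
  have "set (cols Q) = col Q ` {..<d}"
    using assms by (auto simp: cols_def)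
  then have "vec_span m (col Q ` {..<d}) = v.col_space Q"
    by (simp add: vec_span_def v.col_space_def)
  then show ?thesis
    using v.col_space_eq[OF assms] assms by auto
qed

lemma rank_isometry:
  fixes Q :: "'k::real_or_complex mat"
  assumes Q: "Q \<in> carrier_mat m d" "Q\<^sup>H * Q = 1\<^sub>m d"
  shows "vec_space.rank m Q = d"
proof -
  interpret v: vec_space "TYPE('k)" m .
  have "distinct (cols Q)"
  proof -
    have "i = j" if "i < d" "j < d" "col Q i = col Q j" for i j
    proof -
      have "Q $$ (a, i) = Q $$ (a, j)" if "a < m" for a
        using arg_cong[OF \<open>col Q i = col Q j\<close>, of "\<lambda>v. v $ a"] that \<open>i < d\<close> \<open>j < d\<close> Q by simp
      then have "(\<Sum>a<m. conjugate (Q $$ (a, i)) * Q $$ (a, j))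
          = (\<Sum>a<m. conjugate (Q $$ (a, i)) * Q $$ (a, i))"
        by simp
      then show ?thesis
        using isometry_columns[OF Q(2), of i j m] isometry_columns[OF Q(2), of i i m] that(1,2) Q(1)
        by (auto split: if_splits)
    qed
    then show ?thesis
      using Q(1) by (auto simp: distinct_conv_nth cols_length)
  qed
  moreover have "v.lin_indpt (set (cols Q))"
  proof
    assume "v.lin_dep (set (cols Q))"
    then obtain x where x: "x \<in> carrier_vec d" "x \<noteq> 0\<^sub>v d" "Q *\<^sub>v x = 0\<^sub>v m"
      using v.lin_depE[OF Q(1) _ \<open>distinct (cols Q)\<close>] by blast
    have "(Q\<^sup>H * Q) *\<^sub>v x = Q\<^sup>H *\<^sub>v (Q *\<^sub>v x)"
      using Q x by (intro assoc_mult_mat_vec[of _ d m _ d]) auto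
    then show False using Q x by (auto simp: index_mult_mat_vec)
  qed
  ultimately show ?thesis
    using v.lin_indpt_full_rank[OF Q(1)] by simp
qed

lemma rank_eq_if_same_range:
  fixes A :: "'k::real_or_complex mat"
  assumes A: "A \<in> carrier_mat m n" and Q: "Q \<in> carrier_mat m d"
    and M: "M \<in> carrier_mat d n" "A = Q * M" and N: "N \<in> carrier_mat n d" "Q = A * N"
  shows "vec_space.rank m A = vec_space.rank m Q"
proof -
  interpret v: vec_space "TYPE('k)" m .
  have "\<exists>c'\<in>carrier_vec d. A *\<^sub>v c = Q *\<^sub>v c'" if "c \<in> carrier_vec n" for c
    using that M Q by (intro bexI[of _ "M *\<^sub>v c"]) auto
  moreover have "\<exists>c'\<in>carrier_vec n. Q *\<^sub>v c = A *\<^sub>v c'" if "c \<in> carrier_vec d" for c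
    using that N A by (intro bexI[of _ "N *\<^sub>v c"]) (subst N(2), auto)
  ultimately have "v.col_space A = v.col_space Q"
    unfolding v.col_space_eq[OF A] v.col_space_eq[OF Q] using A Q by auto metis+
  then show ?thesis
    by (simp add: v.rank_def v.col_space_def)
qed

lemma sigma_mat_dim [simp]:
  "dim_row (sigma_mat m n r \<sigma>) = m" "dim_col (sigma_mat m n r \<sigma>) = n"
  by (simp_all add: sigma_mat_def)

lemma sigma_mat_carrier [simp]: "sigma_mat m n r \<sigma> \<in> carrier_mat m n"
  by (simp add: sigma_mat_def)

text \<open>The number of positive singular values in a factorization is the rank: the product has the same
  range as its first \<open>r\<close> left singular vectors, because the remaining factors can be inverted on the
  right.\<close>

lemma rank_svd:
  fixes U V :: "'k::real_or_complex mat"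
  assumes U: "unitary_mat m U" and V: "unitary_mat n V" and r: "r \<le> m" "r \<le> n"
    and pos: "\<And>i. i < r \<Longrightarrow> 0 < \<sigma> i"
  shows "vec_space.rank m (U * sigma_mat m n r \<sigma> * V\<^sup>H) = r"
proof -
  note U' = unitary_matD[OF U] and V' = unitary_matD[OF V]
  define E :: "'k mat" where "E = mat m r (\<lambda>(i, j). if i = j then 1 else 0)"
  define M :: "'k mat" where "M = mat r n (\<lambda>(i, j). if i = j then of_real (\<sigma> i) else 0)"
  \<comment> \<open>\<open>N\<close> is a right inverse of \<open>\<Sigma>\<close> on the first \<open>r\<close> coordinates\<close>
  define N :: "'k mat" where "N = mat n r (\<lambda>(i, j). if i = j then of_real (1 / \<sigma> i) else 0)"
  have dims: "E \<in> carrier_mat m r" "M \<in> carrier_mat r n" "N \<in> carrier_mat n r"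
    by (auto simp: E_def M_def N_def)
  have s1: "sigma_mat m n r \<sigma> = E * M"
    by (rule eq_matI) (use r in \<open>auto simp: index_mult_mat_sum E_def M_def sigma_mat_def
        if_distrib[of "\<lambda>x. x * _"] cong: if_cong\<close>)
  have s2: "sigma_mat m n r \<sigma> * N = E"
    by (rule eq_matI) (use r pos in \<open>auto simp: index_mult_mat_sum E_def N_def sigma_mat_def
        if_distrib[of "\<lambda>x. x * _"] less_imp_neq[THEN not_sym] cong: if_cong\<close>)
  have eq1: "U * sigma_mat m n r \<sigma> * V\<^sup>H = (U * E) * (M * V\<^sup>H)"
    unfolding s1 using U'(1,2) V'(1,2) dims by (simp add: mult_mat_assoc)
  have "(U * sigma_mat m n r \<sigma> * V\<^sup>H) * (V * N) = U * (sigma_mat m n r \<sigma> * N)"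
    using U'(1,2) V'(1,2) dims
    by (simp add: mult_mat_assoc unitary_cancel[OF V])
  then have eq2: "U * E = (U * sigma_mat m n r \<sigma> * V\<^sup>H) * (V * N)"
    unfolding s2 by simp
  have "E\<^sup>H * E = 1\<^sub>m r"
    by (rule eq_matI) (use r in \<open>auto simp: index_mult_mat_sum E_def if_distrib[of conjugate]
        if_distrib[of "\<lambda>x. x * _"] cong: if_cong\<close>)
  then have "(U * E)\<^sup>H * (U * E) = 1\<^sub>m r"
    using U' dims by (simp add: adjoint_mult mult_mat_assoc unitary_cancel[OF U])
  then have "vec_space.rank m (U * E) = r"
    using U' dims by (intro rank_isometry) auto
  moreover have "vec_space.rank m (U * sigma_mat m n r \<sigma> * V\<^sup>H) = vec_space.rank m (U * E)"
    using U' V' dims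
    by (intro rank_eq_if_same_range[OF _ _ _ eq1 _ eq2]) auto
  ultimately show ?thesis by simp
qed

lemma full_svdD:
  assumes "full_svd m n A U \<sigma> V"
  shows "A \<in> carrier_mat m n" "unitary_mat m U" "unitary_mat n V"
    "A = U * sigma_mat m n (vec_space.rank m A) \<sigma> * V\<^sup>H"
    "\<And>i. i < vec_space.rank m A \<Longrightarrow> 0 < \<sigma> i"
    "\<And>i. vec_space.rank m A \<le> i \<Longrightarrow> i < m \<Longrightarrow> \<sigma> i = 0"
    "\<And>i. i < m \<Longrightarrow> 0 \<le> \<sigma> i"
    "antimono_on {..<m} \<sigma>"
    "vec_space.rank m A \<le> n"
proof -
  let ?r = "vec_space.rank m A"
  show A: "A \<in> carrier_mat m n" and "unitary_mat m U" "unitary_mat n V"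
    "A = U * sigma_mat m n ?r \<sigma> * V\<^sup>H"
    and pos: "\<And>i. i < ?r \<Longrightarrow> 0 < \<sigma> i" and zero: "\<And>i. ?r \<le> i \<Longrightarrow> i < m \<Longrightarrow> \<sigma> i = 0"
    using assms by (auto simp: full_svd_def Let_def)
  have mono: "\<And>i j. i \<le> j \<Longrightarrow> j < ?r \<Longrightarrow> \<sigma> j \<le> \<sigma> i"
    using assms by (auto simp: full_svd_def Let_def)
  show nonneg: "\<And>i. i < m \<Longrightarrow> 0 \<le> \<sigma> i"
    using pos zero by (metis less_le_not_le linorder_not_less order_refl)
  show "antimono_on {..<m} \<sigma>"
    by (rule monotone_onI) (metis mono nonneg zero lessThan_iff linorder_not_less)
  show "?r \<le> n"
    using vec_space.rank_le_nc[OF A] .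
qed

lemma sigma_mat_gram:
  assumes "r \<le> n" "\<And>i. r \<le> i \<Longrightarrow> i < m \<Longrightarrow> \<sigma> i = 0"
  shows "sigma_mat m n r \<sigma> * (sigma_mat m n r \<sigma>)\<^sup>H
    = (real_diag m (\<lambda>i. (\<sigma> i)\<^sup>2) :: 'k::real_or_complex mat)"
proof (rule eq_matI)
  fix i j assume "i < dim_row (real_diag m (\<lambda>i. (\<sigma> i)\<^sup>2) :: 'k mat)"
    "j < dim_col (real_diag m (\<lambda>i. (\<sigma> i)\<^sup>2) :: 'k mat)"
  then have ij: "i < m" "j < m" by auto
  let ?S = "sigma_mat m n r \<sigma> :: 'k mat"
  have "(?S * ?S\<^sup>H) $$ (i, j) = (\<Sum>l<n. ?S $$ (i, l) * conjugate (?S $$ (j, l)))"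
    using ij by (simp add: index_mult_mat_sum)
  also have "\<dots> = (\<Sum>l<n. if l = i then (if i = j \<and> i < r then of_real ((\<sigma> i)\<^sup>2) else 0) else 0)"
    using ij by (intro sum.cong) (auto simp: sigma_mat_def power2_eq_square)
  also have "\<dots> = (if i = j then of_real ((\<sigma> i)\<^sup>2) else 0)"
    using ij assms by (cases "i < r") auto
  finally show "(?S * ?S\<^sup>H) $$ (i, j) = real_diag m (\<lambda>i. (\<sigma> i)\<^sup>2) $$ (i, j)"
    using ij by (simp only: real_diag_index)
qed auto

lemma gram_eigen_decomposition:
  fixes A :: "'k::real_or_complex mat"
  assumes "full_svd m n A U \<sigma> V"
  shows "A * A\<^sup>H = U * (real_diag m (\<lambda>i. (\<sigma> i)\<^sup>2) * U\<^sup>H)"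
proof -
  let ?S = "sigma_mat m n (vec_space.rank m A) \<sigma> :: 'k mat"
  note S = full_svdD[OF assms]
  note U = unitary_matD[OF S(2)] and V = unitary_matD[OF S(3)]
  have "A * A\<^sup>H = (U * ?S * V\<^sup>H) * (U * ?S * V\<^sup>H)\<^sup>H"
    using S(4) by metis
  also have "\<dots> = U * ((?S * ?S\<^sup>H) * U\<^sup>H)"
    using U(1,2) V(1,2) by (simp add: adjoint_mult mult_mat_assoc unitary_cancel[OF S(3)])
  finally show ?thesis
    using sigma_mat_gram[of "vec_space.rank m A" n m \<sigma>, where 'k='k] S(6,9) by simp
qed

text \<open>The right singular vectors are sorted eigenvectors \<open>v\<^sub>j\<close> of \<open>A\<^sup>H A\<close>. The vectors \<open>A v\<^sub>j\<close> are then
  orthogonal with squared norms \<open>\<mu>\<^sub>j\<close>, and the nonzero ones become the left singular vectors after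
  scaling.\<close>

lemma full_svd_exists:
  fixes A :: "'k::real_or_complex mat"
  assumes A: "A \<in> carrier_mat m n"
  obtains U \<sigma> V where "full_svd m n A U \<sigma> V"
proof -
  obtain V \<mu> where V: "unitary_mat n V" and mono: "antimono_on {..<n} \<mu>"
    and eig: "A\<^sup>H * A * V = V * real_diag n \<mu>"
    by (rule hermitian_spectral_theorem[of "A\<^sup>H * A" n])
      (use A in \<open>auto simp: adjoint_mult\<close>)
  note V' = unitary_matD[OF V]
  have AV: "(A * V)\<^sup>H * (A * V) = real_diag n \<mu>"
  proof -
    have "(A * V)\<^sup>H * (A * V) = V\<^sup>H * (A\<^sup>H * A * V)"
      using A V' by (simp add: adjoint_mult mult_mat_assoc)
    then show ?thesis unfolding eig using V' by (simp add: unitary_cancel[OF V])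
  qed
  have col_norm: "(\<Sum>a<m. (norm ((A * V) $$ (a, j)))\<^sup>2) = \<mu> j" if "j < n" for j
  proof -
    have "of_real (\<Sum>a<m. (norm ((A * V) $$ (a, j)))\<^sup>2) = (of_real (\<mu> j) :: 'k)"
      using gram_diagonal[of j "A * V"] AV that A V' by simp
    then show ?thesis by (simp only: of_real_eq_iff)
  qed
  then have \<mu>_nonneg: "0 \<le> \<mu> j" if "j < n" for j
    using that by (metis sum_nonneg zero_le_power2)
  define r where "r = card {i. i < n \<and> 0 < \<mu> i}"
  have down: "0 < \<mu> i" if "i \<le> j" "j < n" "0 < \<mu> j" for i j
    using monotone_onD[OF mono, of i j] that by auto
  have r: "{i. i < n \<and> 0 < \<mu> i} = {..<r}"
  proof -
    let ?S = "{i. i < n \<and> 0 < \<mu> i}"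
    have "finite ?S" by simp
    have below: "i < r" if "i \<in> ?S" for i
    proof -
      have "{..i} \<subseteq> ?S" using that down[of _ i] by force
      then have "card {..i} \<le> card ?S" by (rule card_mono[OF \<open>finite ?S\<close>])
      then show ?thesis by (simp only: r_def card_atMost Suc_le_eq)
    qed
    show ?thesis
    proof (rule card_subset_eq)
      show "?S \<subseteq> {..<r}" using below by auto
      show "card ?S = card {..<r}" by (simp only: card_lessThan r_def)
    qed simp
  qed
  have r_n: "r \<le> n" using card_mono[of "{..<n}" "{i. i < n \<and> 0 < \<mu> i}"] by (auto simp: r_def)
  have pos: "0 < \<mu> i" if "i < r" for i using r that by blast
  have zero: "\<mu> i = 0" if "r \<le> i" "i < n" for i
    using r \<mu>_nonneg[of i] that by (metis (mono_tags, lifting) lessThan_iff linorder_not_less mem_Collect_eq order_antisym)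
  define \<sigma> where "\<sigma> i = (if i < r then sqrt (\<mu> i) else 0)" for i
  have \<sigma>_pos: "0 < \<sigma> i" if "i < r" for i using pos[OF that] that by (simp add: \<sigma>_def)
  define Q where "Q = mat m r (\<lambda>(a, j). (A * V) $$ (a, j) * of_real (1 / \<sigma> j))"
  have Q: "Q \<in> carrier_mat m r" by (simp add: Q_def)
  have Q_entry: "Q $$ (a, j) = (A * V) $$ (a, j) * of_real (1 / \<sigma> j)" if "a < m" "j < r" for a j
    using that unfolding Q_def by (subst index_mat) auto
  have inv: "of_real (1 / (\<sigma> i * \<sigma> j)) = (of_real (1 / \<sigma> i) * of_real (1 / \<sigma> j) :: 'k)" for i j
    by simp
  have "Q\<^sup>H * Q = 1\<^sub>m r"
  proof (rule eq_matI)
    fix i j assume "i < dim_row (1\<^sub>m r :: 'k mat)" "j < dim_col (1\<^sub>m r :: 'k mat)"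
    then have ij: "i < r" "j < r" by auto
    have "(Q\<^sup>H * Q) $$ (i, j) = (\<Sum>a<m. conjugate (Q $$ (a, i)) * Q $$ (a, j))"
      using ij Q by (subst index_mult_mat_sum) auto
    also have "\<dots> = (\<Sum>a<m. conjugate ((A * V) $$ (a, i)) * (A * V) $$ (a, j)) * of_real (1 / (\<sigma> i * \<sigma> j))"
      unfolding sum_distrib_right
      by (intro sum.cong refl)
        (use ij in \<open>simp only: Q_entry lessThan_iff conjugate_dist_mul conjugate_of_real inv mult_ac\<close>)
    also have "(\<Sum>a<m. conjugate ((A * V) $$ (a, i)) * (A * V) $$ (a, j)) = ((A * V)\<^sup>H * (A * V)) $$ (i, j)"
      using ij r_n A V' by (subst index_mult_mat_sum) auto
    also have "\<dots> * of_real (1 / (\<sigma> i * \<sigma> j))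
        = of_real ((if i = j then \<mu> i else 0) * (1 / (\<sigma> i * \<sigma> j)))"
      unfolding AV using ij r_n by (subst real_diag_index) auto
    also have "(if i = j then \<mu> i else 0) * (1 / (\<sigma> i * \<sigma> j)) = (if i = j then 1 else 0)"
      using ij pos[of i] by (auto simp: \<sigma>_def)
    finally show "(Q\<^sup>H * Q) $$ (i, j) = 1\<^sub>m r $$ (i, j)" using ij by simp
  qed (use Q in auto)
  then obtain U where U: "unitary_mat m U" and U_Q: "\<And>a j. a < m \<Longrightarrow> j < r \<Longrightarrow> U $$ (a, j) = Q $$ (a, j)"
    and r_m: "r \<le> m"
    using isometry_extends_to_unitary[OF Q] isometry_dim_le[OF Q] by blast
  note U' = unitary_matD[OF U]
  have eq: "A * V = U * sigma_mat m n r \<sigma>"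
  proof (rule eq_matI)
    fix a j assume "a < dim_row (U * sigma_mat m n r \<sigma>)" "j < dim_col (U * sigma_mat m n r \<sigma>)"
    then have aj: "a < m" "j < n" using U' by auto
    have "(U * sigma_mat m n r \<sigma>) $$ (a, j) = (\<Sum>l<m. U $$ (a, l) * sigma_mat m n r \<sigma> $$ (l, j))"
      using aj U' by (simp add: index_mult_mat_sum)
    also have "\<dots> = (\<Sum>l<m. if l = j then (if j < r then U $$ (a, j) * of_real (\<sigma> j) else 0) else 0)"
      using aj by (intro sum.cong) (auto simp: sigma_mat_def)
    also have "\<dots> = (if j < r then U $$ (a, j) * of_real (\<sigma> j) else 0)"
      using r_m by auto
    also have "\<dots> = (A * V) $$ (a, j)"
    proof (cases "j < r")
      case True
      then show ?thesis
        using aj \<sigma>_pos[OF True] by (simp add: U_Q Q_def)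
    next
      case False
      then have "(\<Sum>a<m. (norm ((A * V) $$ (a, j)))\<^sup>2) = 0"
        using col_norm zero aj by simp
      then show ?thesis using False aj by (simp add: sum_nonneg_eq_0_iff)
    qed
    finally show "(A * V) $$ (a, j) = (U * sigma_mat m n r \<sigma>) $$ (a, j)" by simp
  qed (use A U' V' in auto)
  have A_eq: "A = U * sigma_mat m n r \<sigma> * V\<^sup>H"
  proof -
    have "A = A * V * V\<^sup>H"
      using A V' by (simp add: mult_mat_assoc)
    then show ?thesis unfolding eq .
  qed
  have rank: "vec_space.rank m A = r"
    unfolding A_eq by (rule rank_svd[OF U V r_m r_n \<sigma>_pos])
  have "\<sigma> j \<le> \<sigma> i" if "i \<le> j" "j < r" for i j
    using monotone_onD[OF mono, of i j] that r_n by (simp add: \<sigma>_def)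
  then have "full_svd m n A U \<sigma> V"
    unfolding full_svd_def Let_def rank using A U V A_eq \<sigma>_pos by (auto simp: \<sigma>_def)
  then show thesis by (rule that)
qed

section \<open>Stability of singular values\<close>

text \<open>Continuity of sorted eigenvalues without dimension counting. The numbers \<open>|X\<^sub>a\<^sub>b|\<^sup>2\<close> form a doubly
  stochastic matrix, so the block of the \<open>m - j\<close> last rows and the \<open>j + 1\<close> first columns has total
  weight at least 1. On this block the factor \<open>\<nu>\<^sub>b - \<mu>\<^sub>a\<close> is at least \<open>\<nu>\<^sub>j - \<mu>\<^sub>j\<close>.\<close>

lemma weyl_one_sided:
  fixes X Y :: "'k::real_or_complex mat"
  assumes X: "unitary_mat m X" and Y: "Y \<in> carrier_mat m m"
    and mono: "antimono_on {..<m} \<mu>" "antimono_on {..<m} \<nu>"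
    and XY: "\<And>a b. a < m \<Longrightarrow> b < m \<Longrightarrow> Y $$ (a, b) = of_real (\<nu> b - \<mu> a) * X $$ (a, b)"
    and j: "j < m"
  shows "\<nu> j - \<mu> j \<le> fnorm Y"
proof (rule ccontr)
  assume neg: "\<not> \<nu> j - \<mu> j \<le> fnorm Y"
  define \<delta> where "\<delta> = \<nu> j - \<mu> j"
  have \<delta>: "fnorm Y < \<delta>" "0 < \<delta>"
    using neg frobenius_norm_nonneg[of Y] by (auto simp: \<delta>_def simp del: frobenius_norm_nonneg)
  let ?w = "\<lambda>a b. (norm (X $$ (a, b)))\<^sup>2"
  have row: "(\<Sum>b<m. ?w a b) = 1" if "a < m" for a
    using unitary_row_norm[OF X that] .
  have col: "(\<Sum>a<m. ?w a b) = 1" if "b < m" for b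
    using unitary_column_norm[OF X that] .
  have "(\<Sum>b\<le>j. \<Sum>a<j. ?w a b) \<le> (\<Sum>b<m. \<Sum>a<j. ?w a b)"
    using j by (intro sum_mono2) (auto intro: sum_nonneg)
  also have "\<dots> = (\<Sum>a<j. \<Sum>b<m. ?w a b)" by (rule sum.swap)
  also have "\<dots> = real j" using j by (simp add: row)
  finally have upper: "(\<Sum>b\<le>j. \<Sum>a<j. ?w a b) \<le> real j" .
  have split: "(\<Sum>a<m. g a) = (\<Sum>a<j. g a) + (\<Sum>a\<in>{j..<m}. g a)" for g :: "nat \<Rightarrow> real"
    using j sum.atLeastLessThan_concat[of 0 j m g] by (simp add: atLeast0LessThan)
  have "real (Suc j) = (\<Sum>b\<le>j. \<Sum>a<m. ?w a b)" using j by (simp add: col)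
  also have "\<dots> = (\<Sum>b\<le>j. (\<Sum>a<j. ?w a b) + (\<Sum>a\<in>{j..<m}. ?w a b))"
    by (simp only: split)
  finally have lower: "1 \<le> (\<Sum>b\<le>j. \<Sum>a\<in>{j..<m}. ?w a b)"
    using upper by (simp add: sum.distrib)
  have "\<delta>\<^sup>2 * ?w a b \<le> (norm (Y $$ (a, b)))\<^sup>2" if "b \<le> j" "a \<in> {j..<m}" for a b
  proof -
    have "\<nu> j \<le> \<nu> b" "\<mu> a \<le> \<mu> j"
      using monotone_onD[OF mono(2), of b j] monotone_onD[OF mono(1), of j a] that j by auto
    then have "\<delta>\<^sup>2 \<le> (\<nu> b - \<mu> a)\<^sup>2"
      using \<delta> by (intro power_mono) (auto simp: \<delta>_def)
    then show ?thesis
      using that j by (simp add: XY norm_mult power_mult_distrib mult_right_mono del: of_real_diff)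
  qed
  then have "\<delta>\<^sup>2 * (\<Sum>b\<le>j. \<Sum>a\<in>{j..<m}. ?w a b) \<le> (\<Sum>b\<le>j. \<Sum>a\<in>{j..<m}. (norm (Y $$ (a, b)))\<^sup>2)"
    unfolding sum_distrib_left by (intro sum_mono) auto
  also have "\<dots> \<le> (\<Sum>b<m. \<Sum>a<m. (norm (Y $$ (a, b)))\<^sup>2)"
    using j by (intro order_trans[OF sum_mono2 sum_mono] sum_mono2) (auto intro: sum_nonneg)
  also have "\<dots> = (fnorm Y)\<^sup>2"
    using Y by (simp add: frobenius_norm_sq) (rule sum.swap)
  finally have "\<delta>\<^sup>2 * 1 \<le> (fnorm Y)\<^sup>2"
    using lower mult_left_mono[OF lower, of "\<delta>\<^sup>2"] by simp
  then show False
    using \<delta> power2_le_imp_le[of \<delta> "fnorm Y"] by simp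
qed

lemma weyl_frobenius:
  fixes X Y :: "'k::real_or_complex mat"
  assumes X: "unitary_mat m X" and Y: "Y \<in> carrier_mat m m"
    and mono: "antimono_on {..<m} \<mu>" "antimono_on {..<m} \<nu>"
    and XY: "\<And>a b. a < m \<Longrightarrow> b < m \<Longrightarrow> Y $$ (a, b) = of_real (\<nu> b - \<mu> a) * X $$ (a, b)"
    and j: "j < m"
  shows "\<bar>\<nu> j - \<mu> j\<bar> \<le> fnorm Y"
proof -
  note X' = unitary_matD[OF X]
  have "(- Y\<^sup>H) $$ (a, b) = of_real (\<mu> b - \<nu> a) * X\<^sup>H $$ (a, b)" if "a < m" "b < m" for a b
    using that Y X'(1,2) by (simp add: XY conjugate_dist_mul del: of_real_diff) (simp add: algebra_simps)
  then have "\<mu> j - \<nu> j \<le> fnorm (- Y\<^sup>H)"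
    using Y by (intro weyl_one_sided[OF unitary_mat_adjoint[OF X] _ mono(2,1) _ j]) auto
  then show ?thesis
    using weyl_one_sided[OF X Y mono XY j] by simp
qed

text \<open>Both Gram matrices are diagonal in their own singular bases, so in the mixed bases their
  difference multiplies each entry of \<open>U\<^sup>H U'\<close> by a difference of squared singular values.\<close>

lemma gram_difference_entries:
  assumes svd: "full_svd m n A U \<sigma> V" and svd': "full_svd m n A' U' \<sigma>' V'"
    and "a < m" "b < m"
  shows "(U\<^sup>H * ((A' * A'\<^sup>H - A * A\<^sup>H) * U')) $$ (a, b)
    = of_real ((\<sigma>' b)\<^sup>2 - (\<sigma> a)\<^sup>2) * (U\<^sup>H * U') $$ (a, b)"
proof -
  note U = unitary_matD[OF full_svdD(2)[OF svd]] and U' = unitary_matD[OF full_svdD(2)[OF svd']]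
  note uc = unitary_cancel[OF full_svdD(2)[OF svd]] unitary_cancel[OF full_svdD(2)[OF svd']]
  let ?L = "real_diag m (\<lambda>i. (\<sigma> i)\<^sup>2) :: 'a mat" and ?L' = "real_diag m (\<lambda>i. (\<sigma>' i)\<^sup>2) :: 'a mat"
  have "U\<^sup>H * ((A' * A'\<^sup>H - A * A\<^sup>H) * U') = U\<^sup>H * (A' * A'\<^sup>H * U') - U\<^sup>H * (A * A\<^sup>H * U')"
    using full_svdD(1)[OF svd] full_svdD(1)[OF svd'] U(3) U'(3)
    by (subst minus_mult_distrib_mat[of _ m m _ _ m], simp, simp, simp,
        subst mult_minus_distrib_mat[of _ m m _ m]) auto
  also have "A' * A'\<^sup>H * U' = U' * ?L'"
    using U' by (simp add: gram_eigen_decomposition[OF svd'] mult_mat_assoc)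
  also have "U\<^sup>H * (A * A\<^sup>H * U') = ?L * (U\<^sup>H * U')"
    using U U' by (simp add: gram_eigen_decomposition[OF svd] mult_mat_assoc uc)
  also have "U\<^sup>H * (U' * ?L') = (U\<^sup>H * U') * ?L'"
    using U U' by (simp add: mult_mat_assoc)
  finally show ?thesis
    using assms(3,4) U(1,2) U'(1,2)
    by (simp add: index_mult_real_diag index_real_diag_mult algebra_simps)
qed

lemma singular_value_perturbation:
  assumes svd: "full_svd m n A U \<sigma> V" and svd': "full_svd m n A' U' \<sigma>' V'" and j: "j < m"
  shows "\<bar>(\<sigma>' j)\<^sup>2 - (\<sigma> j)\<^sup>2\<bar> \<le> fnorm (A' * A'\<^sup>H - A * A\<^sup>H)"
proof -
  let ?F = "A' * A'\<^sup>H - A * A\<^sup>H"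
  note S = full_svdD[OF svd] and S' = full_svdD[OF svd']
  note U = unitary_matD[OF S(2)] and U' = unitary_matD[OF S'(2)]
  have mono: "antimono_on {..<m} (\<lambda>i. (\<sigma> i)\<^sup>2)" "antimono_on {..<m} (\<lambda>i. (\<sigma>' i)\<^sup>2)"
    using monotone_onD[OF S(8)] monotone_onD[OF S'(8)] S(7) S'(7)
    by (auto intro!: monotone_onI power_mono)
  have "\<bar>(\<sigma>' j)\<^sup>2 - (\<sigma> j)\<^sup>2\<bar> \<le> fnorm (U\<^sup>H * (?F * U'))"
    using U U' S(1) S'(1)
    by (intro weyl_frobenius[OF unitary_mat_mult[OF unitary_mat_adjoint[OF S(2)] S'(2)] _ mono
          gram_difference_entries[OF svd svd'] j]) auto
  also have "\<dots> = fnorm ?F"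
    using U U' S(1) S'(1)
    by (simp add: frobenius_norm_unitary_left[OF S(2)] frobenius_norm_unitary_right[OF S'(2)])
  finally show ?thesis .
qed

lemma singular_values_unique:
  assumes "full_svd m n A U \<sigma> V" "full_svd m n A U' \<sigma>' V'" "j < m"
  shows "\<sigma>' j = \<sigma> j"
proof -
  have "fnorm (A * A\<^sup>H - A * A\<^sup>H) = 0"
    by (simp add: frobenius_norm_def)
  then have "(\<sigma>' j)\<^sup>2 = (\<sigma> j)\<^sup>2"
    using singular_value_perturbation[OF assms] by simp
  then show ?thesis
    using full_svdD(7)[OF assms(1,3)] full_svdD(7)[OF assms(2,3)] by (simp add: power2_eq_iff_nonneg)
qed

section \<open>Singular subspaces\<close>

definition coord_projector :: "nat \<Rightarrow> nat set \<Rightarrow> 'k::real_or_complex mat" where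
  "coord_projector m \<pi> = real_diag m (\<lambda>i. if i \<in> \<pi> then 1 else 0)"

lemma coord_projector_dim [simp]:
  "dim_row (coord_projector m \<pi>) = m" "dim_col (coord_projector m \<pi>) = m"
  by (simp_all add: coord_projector_def)

lemma coord_projector_carrier [simp]: "coord_projector m \<pi> \<in> carrier_mat m m"
  by (simp add: coord_projector_def)

lemma adjoint_coord_projector [simp]:
  "(coord_projector m \<pi>)\<^sup>H = coord_projector m \<pi>"
  by (simp add: coord_projector_def)

lemma coord_projector_idem [simp]:
  "coord_projector m \<pi> * coord_projector m \<pi> = coord_projector m \<pi>"
  by (simp add: coord_projector_def real_diag_mult_real_diag if_distrib[of "\<lambda>x. x * _"] cong: if_cong)

lemma coord_projector_mult_index:
  assumes "dim_row A = m" "i < m" "j < dim_col A"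
  shows "(coord_projector m \<pi> * A) $$ (i, j) = (if i \<in> \<pi> then A $$ (i, j) else 0)"
  unfolding coord_projector_def using assms by (subst index_real_diag_mult) auto

lemma mult_coord_projector_index:
  assumes "dim_col A = m" "i < dim_row A" "j < m"
  shows "(A * coord_projector m \<pi>) $$ (i, j) = (if j \<in> \<pi> then A $$ (i, j) else 0)"
  unfolding coord_projector_def using assms by (subst index_mult_real_diag) auto

lemma column_span_eq_range:
  fixes Q :: "'k::real_or_complex mat"
  assumes "Q \<in> carrier_mat m d"
  shows "column_span m Q {..<d} = {Q *\<^sub>v c | c. c \<in> carrier_vec d}"
  unfolding column_span_def using vec_span_columns[OF assms] .

lemma column_span_eq_fixed_points:
  fixes Q :: "'k::real_or_complex mat"
  assumes Q: "Q \<in> carrier_mat m d" "Q\<^sup>H * Q = 1\<^sub>m d"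
  shows "column_span m Q {..<d} = {x \<in> carrier_vec m. (Q * Q\<^sup>H) *\<^sub>v x = x}"
proof -
  have "(Q * Q\<^sup>H) *\<^sub>v (Q *\<^sub>v c) = Q *\<^sub>v c" if "c \<in> carrier_vec d" for c
  proof -
    have "(Q * Q\<^sup>H) *\<^sub>v (Q *\<^sub>v c) = (Q * Q\<^sup>H * Q) *\<^sub>v c"
      using Q that by (intro assoc_mult_mat_vec[symmetric, of _ m m _ d]) auto
    also have "Q * Q\<^sup>H * Q = Q"
      using Q by (simp add: mult_mat_assoc)
    finally show ?thesis .
  qed
  moreover have "\<exists>c. x = Q *\<^sub>v c \<and> c \<in> carrier_vec d" if "x \<in> carrier_vec m" "(Q * Q\<^sup>H) *\<^sub>v x = x" for x
    using that Q assoc_mult_mat_vec[of Q m d "Q\<^sup>H" m x] mult_mat_vec_carrier[of "Q\<^sup>H" d m x]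
    by (intro exI[of _ "Q\<^sup>H *\<^sub>v x"]) auto
  ultimately show ?thesis
    unfolding column_span_eq_range[OF Q(1)] using Q(1) by auto
qed

text \<open>Enumerating \<open>\<pi>\<close> turns the selected columns into a matrix with orthonormal columns, whose
  projector is \<open>U D U\<^sup>H\<close> with \<open>D\<close> the coordinate projector.\<close>

lemma column_span_orthonormal_basis:
  fixes U :: "'k::real_or_complex mat"
  assumes U: "unitary_mat m U" and \<pi>: "\<pi> \<subseteq> {..<m}" "card \<pi> = k"
  obtains Q where "orthonormal_basis_mat m k (column_span m U \<pi>) Q"
    "Q * Q\<^sup>H = U * (coord_projector m \<pi> * U\<^sup>H)"
proof -
  note U' = unitary_matD[OF U]
  have "finite \<pi>" using \<pi>(1) finite_subset by blast
  then obtain e where e: "bij_betw e {..<k} \<pi>"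
    using ex_bij_betw_nat_finite[of \<pi>] \<pi>(2) by (auto simp: atLeast0LessThan)
  have e_less: "e j < m" if "j < k" for j
    using bij_betw_apply[OF e, of j] that \<pi>(1) by auto
  have e_inj: "e i = e j \<longleftrightarrow> i = j" if "i < k" "j < k" for i j
    using e that by (auto simp: bij_betw_def inj_on_def)
  define Q where "Q = mat m k (\<lambda>(a, j). U $$ (a, e j))"
  have Q: "Q \<in> carrier_mat m k" by (simp add: Q_def)
  have "Q\<^sup>H * Q = 1\<^sub>m k"
    using isometry_columns[OF U'(4), of _ _ m] U' e_less e_inj
    by (intro eq_matI) (auto simp: index_mult_mat_sum Q_def)
  moreover have "col Q ` {..<k} = col U ` \<pi>"
  proof -
    have "col Q j = col U (e j)" if "j < k" for j
      using that e_less U' by (intro eq_vecI) (auto simp: Q_def)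
    then have "col Q ` {..<k} = (\<lambda>j. col U (e j)) ` {..<k}" by (intro image_cong) auto
    also have "\<dots> = col U ` \<pi>" using e by (auto simp: bij_betw_def image_image[symmetric])
    finally show ?thesis .
  qed
  ultimately have "orthonormal_basis_mat m k (column_span m U \<pi>) Q"
    using Q by (simp add: orthonormal_basis_mat_def column_span_def)
  moreover have "Q * Q\<^sup>H = U * (coord_projector m \<pi> * U\<^sup>H)"
  proof (rule eq_matI)
    fix a b assume "a < dim_row (U * (coord_projector m \<pi> * U\<^sup>H))"
      "b < dim_col (U * (coord_projector m \<pi> * U\<^sup>H))"
    then have ab: "a < m" "b < m" using U' by auto
    have "(Q * Q\<^sup>H) $$ (a, b) = (\<Sum>j<k. U $$ (a, e j) * conjugate (U $$ (b, e j)))"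
      using ab Q by (simp add: index_mult_mat_sum) (simp add: Q_def)
    also have "\<dots> = (\<Sum>i\<in>\<pi>. U $$ (a, i) * conjugate (U $$ (b, i)))"
      by (rule sum.reindex_bij_betw[OF e])
    also have "\<dots> = (\<Sum>i<m. if i \<in> \<pi> then U $$ (a, i) * conjugate (U $$ (b, i)) else 0)"
      using \<pi>(1) by (simp add: sum.If_cases Int_absorb1 Int_absorb2)
    also have "\<dots> = (U * (coord_projector m \<pi> * U\<^sup>H)) $$ (a, b)"
      using ab U' by (simp add: index_mult_mat_sum[of _ U] coord_projector_mult_index
          if_distrib[of "\<lambda>x. _ * x"] cong: if_cong)
    finally show "(Q * Q\<^sup>H) $$ (a, b) = (U * (coord_projector m \<pi> * U\<^sup>H)) $$ (a, b)" .
  qed (use Q U' in auto)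
  ultimately show thesis by (rule that)
qed

lemma carrier_vec_eq_iff:
  "v \<in> carrier_vec m \<Longrightarrow> w \<in> carrier_vec m \<Longrightarrow> v = w \<longleftrightarrow> (\<forall>i<m. v $ i = w $ i)"
  by auto

lemma unitary_mult_vec_inject:
  fixes U :: "'k::real_or_complex mat"
  assumes U: "unitary_mat m U" and z: "z \<in> carrier_vec m" and w: "w \<in> carrier_vec m"
  shows "U *\<^sub>v z = U *\<^sub>v w \<longleftrightarrow> z = w"
proof
  note U' = unitary_matD[OF U]
  have cancel: "U\<^sup>H *\<^sub>v (U *\<^sub>v x) = x" if "x \<in> carrier_vec m" for x
    using assoc_mult_mat_vec[of "U\<^sup>H" m m U m x] U' that by simp
  assume "U *\<^sub>v z = U *\<^sub>v w"
  then have "U\<^sup>H *\<^sub>v (U *\<^sub>v z) = U\<^sup>H *\<^sub>v (U *\<^sub>v w)" by (rule arg_cong)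
  then show "z = w" unfolding cancel[OF z] cancel[OF w] .
qed simp

text \<open>Membership in a span of columns of a unitary matrix is a condition on coordinates; this replaces
  all later arguments with linear combinations.\<close>

lemma column_span_coordinates:
  fixes U :: "'k::real_or_complex mat"
  assumes U: "unitary_mat m U" and \<pi>: "\<pi> \<subseteq> {..<m}"
  shows "column_span m U \<pi> = {x \<in> carrier_vec m. \<forall>i<m. i \<notin> \<pi> \<longrightarrow> (U\<^sup>H *\<^sub>v x) $ i = 0}"
proof -
  note U' = unitary_matD[OF U]
  let ?D = "coord_projector m \<pi> :: 'k mat"
  obtain Q where Q: "orthonormal_basis_mat m (card \<pi>) (column_span m U \<pi>) Q"
    "Q * Q\<^sup>H = U * (?D * U\<^sup>H)"
    using column_span_orthonormal_basis[OF U \<pi> refl] .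
  have "column_span m U \<pi> = {x \<in> carrier_vec m. (U * (?D * U\<^sup>H)) *\<^sub>v x = x}"
    using column_span_eq_fixed_points[of Q m "card \<pi>"] Q by (auto simp: orthonormal_basis_mat_def)
  also have "\<dots> = {x \<in> carrier_vec m. \<forall>i<m. i \<notin> \<pi> \<longrightarrow> (U\<^sup>H *\<^sub>v x) $ i = 0}"
  proof (intro Collect_cong conj_cong refl)
    fix x :: "'k vec" assume x: "x \<in> carrier_vec m"
    let ?y = "U\<^sup>H *\<^sub>v x"
    have y: "?y \<in> carrier_vec m" by (rule mult_mat_vec_carrier[OF adjoint_carrier[OF U'(3)] x])
    have Ux: "U *\<^sub>v ?y = x"
      using assoc_mult_mat_vec[of U m m "U\<^sup>H" m x] U' x by simp
    have eq: "(U * (?D * U\<^sup>H)) *\<^sub>v x = U *\<^sub>v (?D *\<^sub>v ?y)"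
      using U' x mult_carrier_mat[OF coord_projector_carrier adjoint_carrier[OF U'(3)]]
        assoc_mult_mat_vec[of U m m "?D * U\<^sup>H" m x] assoc_mult_mat_vec[of ?D m m "U\<^sup>H" m x]
      by (simp del: assoc_mult_mat_vec)
    have "U *\<^sub>v (?D *\<^sub>v ?y) = U *\<^sub>v ?y \<longleftrightarrow> ?D *\<^sub>v ?y = ?y"
      by (rule unitary_mult_vec_inject[OF U mult_mat_vec_carrier[OF coord_projector_carrier y] y])
    then have "(U * (?D * U\<^sup>H)) *\<^sub>v x = x \<longleftrightarrow> ?D *\<^sub>v ?y = ?y"
      unfolding eq Ux .
    also have "\<dots> \<longleftrightarrow> (\<forall>i<m. (?D *\<^sub>v ?y) $ i = ?y $ i)"
      by (rule carrier_vec_eq_iff[OF mult_mat_vec_carrier[OF coord_projector_carrier y] y])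
    also have "\<dots> \<longleftrightarrow> (\<forall>i<m. i \<notin> \<pi> \<longrightarrow> ?y $ i = 0)"
    proof -
      have "(?D *\<^sub>v ?y) $ i = (if i \<in> \<pi> then ?y $ i else 0)" if "i < m" for i
      proof -
        have "(?D *\<^sub>v ?y) $ i = (\<Sum>l<m. ?D $$ (i, l) * ?y $ l)"
          using that y U'(2) by (subst index_mult_mat_vec_sum) auto
        also have "\<dots> = (\<Sum>l<m. if l = i then (if i \<in> \<pi> then ?y $ i else 0) else 0)"
          using that by (intro sum.cong) (auto simp: coord_projector_def)
        also have "\<dots> = (if i \<in> \<pi> then ?y $ i else 0)" using that by simp
        finally show ?thesis .
      qed
      then show ?thesis by auto
    qed
    finally show "(U * (?D * U\<^sup>H)) *\<^sub>v x = x \<longleftrightarrow> (\<forall>i<m. i \<notin> \<pi> \<longrightarrow> ?y $ i = 0)" .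
  qed
  finally show ?thesis .
qed

lemma column_mem_column_span_iff:
  fixes U :: "'k::real_or_complex mat"
  assumes U: "unitary_mat m U" and \<pi>: "\<pi> \<subseteq> {..<m}" and "i < m"
  shows "col U i \<in> column_span m U \<pi> \<longleftrightarrow> i \<in> \<pi>"
proof -
  note U' = unitary_matD[OF U]
  have "(U\<^sup>H *\<^sub>v col U i) $ l = (if l = i then 1 else 0)" if "l < m" for l
    using isometry_columns[OF U'(4), of l i m] that assms(3) U'(1,2)
    by (simp add: index_mult_mat_vec_sum)
  then show ?thesis
    unfolding column_span_coordinates[OF U \<pi>] using U' assms(3)
    by auto
qed

lemma column_span_inject:
  fixes U :: "'k::real_or_complex mat"
  assumes "unitary_mat m U" "\<pi> \<subseteq> {..<m}" "\<tau> \<subseteq> {..<m}" "column_span m U \<pi> = column_span m U \<tau>"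
  shows "\<pi> = \<tau>"
  using column_mem_column_span_iff[OF assms(1,2)] column_mem_column_span_iff[OF assms(1,3)] assms
  by (metis lessThan_iff subset_antisym subset_iff)

lemma singular_component_eq_column_span:
  fixes A :: "'k::real_or_complex mat"
  assumes svd: "full_svd m n A U \<sigma> V" and "0 \<le> s"
  shows "singular_component m A s = column_span m U {i. i < m \<and> \<sigma> i = s}"
proof -
  note S = full_svdD[OF svd]
  note U' = unitary_matD[OF S(2)]
  let ?L = "real_diag m (\<lambda>i. (\<sigma> i)\<^sup>2) :: 'k mat"
  have "{i. i < m \<and> \<sigma> i = s} \<subseteq> {..<m}" by auto
  note coords = column_span_coordinates[OF S(2) this]
  show ?thesis
    unfolding coords singular_component_def
  proof (intro Collect_cong conj_cong refl)
    fix x :: "'k vec" assume x: "x \<in> carrier_vec m"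
    let ?y = "U\<^sup>H *\<^sub>v x"
    have y: "?y \<in> carrier_vec m" by (rule mult_mat_vec_carrier[OF adjoint_carrier[OF U'(3)] x])
    have Ux: "U *\<^sub>v ?y = x"
      using assoc_mult_mat_vec[of U m m "U\<^sup>H" m x] U' x by simp
    have eq: "(A * A\<^sup>H) *\<^sub>v x = U *\<^sub>v (?L *\<^sub>v ?y)"
      unfolding gram_eigen_decomposition[OF svd]
      using U' x mult_carrier_mat[OF real_diag_carrier adjoint_carrier[OF U'(3)]]
        assoc_mult_mat_vec[of U m m "?L * U\<^sup>H" m x] assoc_mult_mat_vec[of ?L m m "U\<^sup>H" m x]
      by (simp del: assoc_mult_mat_vec)
    have eq': "of_real (s\<^sup>2) \<cdot>\<^sub>v x = U *\<^sub>v (of_real (s\<^sup>2) \<cdot>\<^sub>v ?y)"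
      using Ux U' y by (simp add: mult_mat_vec[of _ m m])
    have "(A * A\<^sup>H) *\<^sub>v x = of_real (s\<^sup>2) \<cdot>\<^sub>v x \<longleftrightarrow> ?L *\<^sub>v ?y = of_real (s\<^sup>2) \<cdot>\<^sub>v ?y"
      unfolding eq eq'
      by (rule unitary_mult_vec_inject[OF S(2) mult_mat_vec_carrier[OF real_diag_carrier y]
            smult_carrier_vec[THEN iffD2, OF y]])
    also have "\<dots> \<longleftrightarrow> (\<forall>i<m. (?L *\<^sub>v ?y) $ i = (of_real (s\<^sup>2) \<cdot>\<^sub>v ?y) $ i)"
      by (rule carrier_vec_eq_iff[OF mult_mat_vec_carrier[OF real_diag_carrier y] smult_carrier_vec[THEN iffD2, OF y]])
    also have "\<dots> \<longleftrightarrow> (\<forall>i<m. (?L *\<^sub>v ?y) $ i = of_real (s\<^sup>2) * ?y $ i)"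
      using y U'(2) by simp
    also have "\<dots> \<longleftrightarrow> (\<forall>i<m. i \<notin> {i. i < m \<and> \<sigma> i = s} \<longrightarrow> ?y $ i = 0)"
    proof -
      have "(?L *\<^sub>v ?y) $ i = of_real ((\<sigma> i)\<^sup>2) * ?y $ i" if "i < m" for i
      proof -
        have "(?L *\<^sub>v ?y) $ i = (\<Sum>l<m. ?L $$ (i, l) * ?y $ l)"
          using that y U'(2) by (subst index_mult_mat_vec_sum) auto
        also have "\<dots> = (\<Sum>l<m. if l = i then of_real ((\<sigma> i)\<^sup>2) * ?y $ i else 0)"
          using that by (intro sum.cong) auto
        also have "\<dots> = of_real ((\<sigma> i)\<^sup>2) * ?y $ i" using that by simp
        finally show ?thesis .
      qed
      moreover have "(\<sigma> i)\<^sup>2 = s\<^sup>2 \<longleftrightarrow> \<sigma> i = s" if "i < m" for i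
        using S(7)[OF that] assms(2) by (simp add: power2_eq_iff_nonneg)
      ultimately show ?thesis
        by (auto simp del: of_real_power)
    qed
    finally show "(A * A\<^sup>H) *\<^sub>v x = of_real (s\<^sup>2) \<cdot>\<^sub>v x
      \<longleftrightarrow> (\<forall>i<m. i \<notin> {i. i < m \<and> \<sigma> i = s} \<longrightarrow> ?y $ i = 0)" .
  qed
qed

lemma span_singular_components:
  fixes A :: "'k::real_or_complex mat"
  assumes svd: "full_svd m n A U \<sigma> V" and S: "\<And>s. s \<in> S \<Longrightarrow> 0 \<le> s"
  shows "vec_span m (\<Union>s\<in>S. singular_component m A s) = column_span m U {i. i < m \<and> \<sigma> i \<in> S}"
proof -
  interpret v: vec_space "TYPE('k)" m .
  let ?\<tau> = "{i. i < m \<and> \<sigma> i \<in> S}"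
  note U = full_svdD(2)[OF svd]
  have \<tau>: "?\<tau> \<subseteq> {..<m}" by auto
  have cols: "col U ` ?\<tau> \<subseteq> carrier_vec m" using unitary_matD[OF U] by auto
  have "(\<Union>s\<in>S. singular_component m A s) \<subseteq> column_span m U ?\<tau>"
  proof (intro UN_least)
    fix s assume s: "s \<in> S"
    have "{i. i < m \<and> \<sigma> i = s} \<subseteq> {..<m}" by auto
    then show "singular_component m A s \<subseteq> column_span m U ?\<tau>"
      unfolding singular_component_eq_column_span[OF svd S[OF s]] column_span_coordinates[OF U \<tau>]
      using s by (subst column_span_coordinates[OF U]) auto
  qed
  then have "vec_span m (\<Union>s\<in>S. singular_component m A s) \<subseteq> column_span m U ?\<tau>"
    unfolding column_span_def vec_span_def by (rule v.span_subsetI[OF cols])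
  moreover have "col U i \<in> singular_component m A (\<sigma> i)" if "i < m" for i
    unfolding singular_component_eq_column_span[OF svd full_svdD(7)[OF svd that]]
    by (subst column_mem_column_span_iff[OF U]) (use that in auto)
  then have "col U ` ?\<tau> \<subseteq> (\<Union>s\<in>S. singular_component m A s)" by auto
  then have "column_span m U ?\<tau> \<subseteq> vec_span m (\<Union>s\<in>S. singular_component m A s)"
    unfolding column_span_def vec_span_def by (rule v.span_is_monotone)
  ultimately show ?thesis by blast
qed

text \<open>\<open>\<pi>\<close> is a union of clusters of equal singular values; the lemmas below identify this with
  membership in the domain of the singular subspace map.\<close>

definition separated :: "nat \<Rightarrow> nat set \<Rightarrow> (nat \<Rightarrow> real) \<Rightarrow> bool" where
  "separated m \<pi> \<sigma> \<longleftrightarrow> (\<forall>i\<in>\<pi>. \<forall>j\<in>{..<m} - \<pi>. \<sigma> i \<noteq> \<sigma> j)"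

lemma separated_if_singular_domain:
  fixes A :: "'k::real_or_complex mat"
  assumes \<pi>: "\<pi> \<subseteq> {..<m}" and A: "A \<in> singular_domain m n \<pi>" and svd: "full_svd m n A U \<sigma> V"
  shows "separated m \<pi> \<sigma>"
proof -
  obtain U1 \<sigma>1 V1 S where svd1: "full_svd m n A U1 \<sigma>1 V1"
    and S: "S \<subseteq> insert 0 (nonzero_singular_values m n A)"
    and span: "column_span m U1 \<pi> = vec_span m (\<Union>s\<in>S. singular_component m A s)"
    using A by (auto simp: singular_domain_def left_singular_subspace_def)
  have "0 \<le> s" if "s \<in> S" for s
    using S that full_svdD(5) by (fastforce simp: nonzero_singular_values_def)
  then have "column_span m U1 \<pi> = column_span m U1 {i. i < m \<and> \<sigma>1 i \<in> S}"
    unfolding span by (rule span_singular_components[OF svd1])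
  then have \<pi>_eq: "\<pi> = {i. i < m \<and> \<sigma>1 i \<in> S}"
    by (intro column_span_inject[OF full_svdD(2)[OF svd1] \<pi>]) auto
  have eq: "\<sigma>1 i = \<sigma> i" if "i < m" for i
    by (rule singular_values_unique[OF svd svd1 that])
  show ?thesis
    unfolding separated_def
  proof (intro ballI notI)
    fix i j assume i: "i \<in> \<pi>" and j: "j \<in> {..<m} - \<pi>" and "\<sigma> i = \<sigma> j"
    then have "i < m" "j < m" using \<pi> by auto
    then have "\<sigma>1 j = \<sigma>1 i" using \<open>\<sigma> i = \<sigma> j\<close> by (simp add: eq)
    moreover have "\<sigma>1 i \<in> S" using i \<pi>_eq by blast
    ultimately have "j \<in> {i. i < m \<and> \<sigma>1 i \<in> S}" using \<open>j < m\<close> by simp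
    then show False using j \<pi>_eq by blast
  qed
qed

lemma column_span_separated:
  fixes A :: "'k::real_or_complex mat"
  assumes \<pi>: "\<pi> \<subseteq> {..<m}" and svd: "full_svd m n A U \<sigma> V" and sep: "separated m \<pi> \<sigma>"
  shows "column_span m U \<pi> = vec_span m (\<Union>s\<in>\<sigma> ` \<pi>. singular_component m A s)"
proof -
  have "\<pi> = {i. i < m \<and> \<sigma> i \<in> \<sigma> ` \<pi>}"
  proof (intro equalityI subsetI)
    fix i assume "i \<in> \<pi>"
    then show "i \<in> {i. i < m \<and> \<sigma> i \<in> \<sigma> ` \<pi>}" using \<pi> by auto
  next
    fix i assume "i \<in> {i. i < m \<and> \<sigma> i \<in> \<sigma> ` \<pi>}"
    then obtain l where "i < m" "l \<in> \<pi>" "\<sigma> l = \<sigma> i" by auto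
    then show "i \<in> \<pi>" using sep unfolding separated_def by blast
  qed
  then have "column_span m U \<pi> = column_span m U {i. i < m \<and> \<sigma> i \<in> \<sigma> ` \<pi>}"
    by (rule arg_cong)
  also have "\<dots> = vec_span m (\<Union>s\<in>\<sigma> ` \<pi>. singular_component m A s)"
    using \<pi> full_svdD(7)[OF svd] by (intro span_singular_components[OF svd, symmetric]) auto
  finally show ?thesis .
qed

lemma singular_domain_if_separated:
  fixes A :: "'k::real_or_complex mat"
  assumes \<pi>: "\<pi> \<subseteq> {..<m}" and svd: "full_svd m n A U \<sigma> V" and sep: "separated m \<pi> \<sigma>"
  shows "A \<in> singular_domain m n \<pi>"
proof -
  have "\<sigma> ` \<pi> \<subseteq> insert 0 (nonzero_singular_values m n A)"
  proof
    fix s assume "s \<in> \<sigma> ` \<pi>"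
    then obtain i where i: "i < m" "s = \<sigma> i" using \<pi> by auto
    show "s \<in> insert 0 (nonzero_singular_values m n A)"
    proof (cases "i < vec_space.rank m A")
      case True
      then show ?thesis using svd i by (auto simp: nonzero_singular_values_def)
    next
      case False
      then show ?thesis using full_svdD(6)[OF svd, of i] i by simp
    qed
  qed
  then have "left_singular_subspace m n A (column_span m U \<pi>)"
    using column_span_separated[OF assms] by (auto simp: left_singular_subspace_def)
  then show ?thesis
    using svd full_svdD(1)[OF svd] by (auto simp: singular_domain_def)
qed

lemma singular_map_eq:
  fixes A :: "'k::real_or_complex mat"
  assumes \<pi>: "\<pi> \<subseteq> {..<m}" and svd: "full_svd m n A U \<sigma> V" and sep: "separated m \<pi> \<sigma>"
  shows "singular_map m n \<pi> A = column_span m U \<pi>"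
  unfolding singular_map_def
proof (rule the_equality)
  show "\<exists>U' \<sigma> V. full_svd m n A U' \<sigma> V \<and> column_span m U \<pi> = column_span m U' \<pi>"
    using svd by blast
next
  fix W assume "\<exists>U \<sigma> V. full_svd m n A U \<sigma> V \<and> W = column_span m U \<pi>"
  then obtain U1 \<sigma>1 V1 where svd1: "full_svd m n A U1 \<sigma>1 V1" and W: "W = column_span m U1 \<pi>"
    by blast
  have eq: "\<sigma>1 i = \<sigma> i" if "i < m" for i
    by (rule singular_values_unique[OF svd svd1 that])
  have less: "i < m" if "i \<in> \<pi>" for i
    using \<pi> that by auto
  have "separated m \<pi> \<sigma>1"
    using sep by (simp add: separated_def eq less)
  moreover have "\<sigma>1 ` \<pi> = \<sigma> ` \<pi>"
    by (intro image_cong) (simp_all add: eq less)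
  ultimately show "W = column_span m U \<pi>"
    using column_span_separated[OF \<pi> svd1] column_span_separated[OF \<pi> svd sep] W by simp
qed

section \<open>Principal angles\<close>

lemma orthonormal_basis_matD:
  assumes "orthonormal_basis_mat p d W Q"
  shows "Q \<in> carrier_mat p d" "Q\<^sup>H * Q = 1\<^sub>m d" "W = column_span p Q {..<d}"
    "dim_row Q = p" "dim_col Q = d"
  using assms by (auto simp: orthonormal_basis_mat_def)

lemma orthonormal_basis_change:
  fixes Q :: "'k::real_or_complex mat"
  assumes Q: "orthonormal_basis_mat p d W Q" and Q1: "orthonormal_basis_mat p d W Q1"
  shows "Q * (Q\<^sup>H * Q1) = Q1" "unitary_mat d (Q\<^sup>H * Q1)"
proof -
  note q = orthonormal_basis_matD[OF Q] and q1 = orthonormal_basis_matD[OF Q1]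
  show change: "Q * (Q\<^sup>H * Q1) = Q1"
  proof (rule mat_col_eqI)
    fix j assume "j < dim_col Q1"
    then have j: "j < d" using q1 by simp
    have "col Q1 j = Q1 *\<^sub>v unit_vec d j"
      using col_mult2[OF q1(1) one_carrier_mat j] q1(1) j by simp
    then have "col Q1 j \<in> column_span p Q1 {..<d}"
      unfolding column_span_eq_range[OF q1(1)] by auto
    then have "col Q1 j \<in> column_span p Q {..<d}" using q(3) q1(3) by simp
    then have "(Q * Q\<^sup>H) *\<^sub>v col Q1 j = col Q1 j"
      unfolding column_span_eq_fixed_points[OF q(1,2)] by simp
    moreover have "col (Q * (Q\<^sup>H * Q1)) j = Q *\<^sub>v col (Q\<^sup>H * Q1) j"
      by (rule col_mult2[OF q(1) mult_carrier_mat[OF adjoint_carrier[OF q(1)] q1(1)] j])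
    moreover have "col (Q\<^sup>H * Q1) j = Q\<^sup>H *\<^sub>v col Q1 j"
      by (rule col_mult2[OF adjoint_carrier[OF q(1)] q1(1) j])
    moreover have "(Q * Q\<^sup>H) *\<^sub>v col Q1 j = Q *\<^sub>v (Q\<^sup>H *\<^sub>v col Q1 j)"
      using q1(4) by (intro assoc_mult_mat_vec[OF q(1) adjoint_carrier[OF q(1)]]) (auto intro: carrier_vecI)
    ultimately show "col (Q * (Q\<^sup>H * Q1)) j = col Q1 j" by metis
  qed (use q q1 in auto)
  have "(Q\<^sup>H * Q1)\<^sup>H * (Q\<^sup>H * Q1) = Q1\<^sup>H * (Q * (Q\<^sup>H * Q1))"
    using q(4,5) q1(4,5) by (simp add: adjoint_mult mult_mat_assoc)
  also have "\<dots> = 1\<^sub>m d" unfolding change by (rule q1(2))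
  finally show "unitary_mat d (Q\<^sup>H * Q1)"
    using q q1 by (intro unitary_mat_if_isometry) auto
qed

lemma full_svd_unitary_equivalent:
  fixes M :: "'k::real_or_complex mat"
  assumes svd: "full_svd d d M X s Y" and O: "unitary_mat d O1" "unitary_mat d O2"
  shows "full_svd d d (O1\<^sup>H * (M * O2)) (O1\<^sup>H * X) s (O2\<^sup>H * Y)"
proof -
  let ?r = "vec_space.rank d M"
  let ?S = "sigma_mat d d ?r s :: 'k mat"
  note S = full_svdD[OF svd]
  note O1 = unitary_matD[OF O(1)] and O2 = unitary_matD[OF O(2)]
  note X = unitary_matD[OF S(2)] and Y = unitary_matD[OF S(3)]
  have un: "unitary_mat d (O1\<^sup>H * X)" "unitary_mat d (O2\<^sup>H * Y)"
    using O S(2,3) by (auto intro: unitary_mat_mult unitary_mat_adjoint)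
  have eq: "O1\<^sup>H * (M * O2) = (O1\<^sup>H * X) * ?S * (O2\<^sup>H * Y)\<^sup>H"
  proof -
    have "O1\<^sup>H * (M * O2) = O1\<^sup>H * ((X * ?S * Y\<^sup>H) * O2)" using S(4) by simp
    then show ?thesis
      using O1(1,2) O2(1,2) X(1,2) Y(1,2) by (simp add: adjoint_mult mult_mat_assoc)
  qed
  have rank: "vec_space.rank d (O1\<^sup>H * (M * O2)) = ?r"
    unfolding eq by (rule rank_svd[OF un S(9) S(9) S(5)])
  show ?thesis
    unfolding full_svd_def Let_def rank using un eq svd O1 O2 S(1)
    by (auto simp: full_svd_def Let_def)
qed

lemma singular_value_eq:
  assumes "full_svd m n A U \<sigma> V" "i < m"
  shows "singular_value m n A i = \<sigma> i"
  unfolding singular_value_def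
proof (rule the_equality)
  show "\<exists>U' \<sigma>' V'. full_svd m n A U' \<sigma>' V' \<and> \<sigma> i = \<sigma>' i"
    using assms(1) by blast
next
  fix s assume "\<exists>U' \<sigma>' V'. full_svd m n A U' \<sigma>' V' \<and> s = \<sigma>' i"
  then obtain U' \<sigma>' V' where "full_svd m n A U' \<sigma>' V'" "s = \<sigma>' i" by blast
  then show "s = \<sigma> i" using singular_values_unique[OF assms(1) _ assms(2)] by simp
qed

text \<open>Changing the two orthonormal bases multiplies \<open>Q\<^sup>H Q'\<close> by unitary matrices on both sides, which
  does not affect its singular values.\<close>

lemma principal_angle_eq:
  fixes Q :: "'k::real_or_complex mat"
  assumes Q: "orthonormal_basis_mat p d W Q" and Q': "orthonormal_basis_mat p d W' Q'"
    and svd: "full_svd d d (Q\<^sup>H * Q') X s Y" and i: "i < d"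
  shows "principal_angle p d W W' i = arccos (s i)"
  unfolding principal_angle_def
proof (rule the_equality)
  have "arccos (s i) = arccos (singular_value d d (Q\<^sup>H * Q') i)"
    by (simp only: singular_value_eq[OF svd i])
  with Q Q' show "\<exists>Q Q'. orthonormal_basis_mat p d W Q \<and> orthonormal_basis_mat p d W' Q' \<and>
      arccos (s i) = arccos (singular_value d d (Q\<^sup>H * Q') i)"
    by blast
next
  fix \<theta> assume "\<exists>Q Q'. orthonormal_basis_mat p d W Q \<and> orthonormal_basis_mat p d W' Q' \<and>
      \<theta> = arccos (singular_value d d (Q\<^sup>H * Q') i)"
  then obtain R R' where R: "orthonormal_basis_mat p d W R" and R': "orthonormal_basis_mat p d W' R'"
    and \<theta>: "\<theta> = arccos (singular_value d d (R\<^sup>H * R') i)" by blast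
  note q = orthonormal_basis_matD[OF Q] and q' = orthonormal_basis_matD[OF Q']
  note r = orthonormal_basis_matD[OF R] and r' = orthonormal_basis_matD[OF R']
  note b = orthonormal_basis_change[OF Q R] and b' = orthonormal_basis_change[OF Q' R']
  have "(Q\<^sup>H * R)\<^sup>H * ((Q\<^sup>H * Q') * (Q'\<^sup>H * R')) = (Q * (Q\<^sup>H * R))\<^sup>H * (Q' * (Q'\<^sup>H * R'))"
    using q(4,5) q'(4,5) r(4,5) r'(4,5) by (simp add: adjoint_mult mult_mat_assoc)
  then have "(Q\<^sup>H * R)\<^sup>H * ((Q\<^sup>H * Q') * (Q'\<^sup>H * R')) = R\<^sup>H * R'"
    unfolding b(1) b'(1) .
  then show "\<theta> = arccos (s i)"
    using singular_value_eq[OF full_svd_unitary_equivalent[OF svd b(2) b'(2)] i] \<theta> by simp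
qed

text \<open>For \<open>M = Q\<^sup>H Q'\<close> the residual \<open>N = Q' - Q M\<close> satisfies \<open>N\<^sup>H N = 1 - M\<^sup>H M\<close>. In the basis of the
  right singular vectors of \<open>M\<close> this is diagonal with entries \<open>1 - s\<^sub>i\<^sup>2 = sin\<^sup>2 \<theta>\<^sub>i\<close>.\<close>

lemma principal_angles_gap:
  fixes Q :: "'k::real_or_complex mat"
  assumes Q: "orthonormal_basis_mat p d W Q" and Q': "orthonormal_basis_mat p d W' Q'"
    and svd: "full_svd d d (Q\<^sup>H * Q') X s Y"
  shows "\<And>i. i < d \<Longrightarrow> s i \<le> 1"
    "(\<Sum>i<d. 1 - (s i)\<^sup>2) = (fnorm (Q' - Q * (Q\<^sup>H * Q')))\<^sup>2"
proof -
  note q = orthonormal_basis_matD[OF Q] and q' = orthonormal_basis_matD[OF Q']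
  note S = full_svdD[OF svd]
  note X = unitary_matD[OF S(2)] and Y = unitary_matD[OF S(3)]
  let ?M = "Q\<^sup>H * Q'" and ?N = "Q' - Q * (Q\<^sup>H * Q')"
  have N: "?N \<in> carrier_mat p d" using q q' by auto
  have N_gram: "?N\<^sup>H * ?N = 1\<^sub>m d - ?M\<^sup>H * ?M"
  proof -
    have cM: "?M \<in> carrier_mat d d" and cQM: "Q * ?M \<in> carrier_mat p d"
      using q(1) q'(1) by auto
    have "Q\<^sup>H * ?N = Q\<^sup>H * Q' - Q\<^sup>H * (Q * ?M)"
      by (rule mult_minus_distrib_mat[OF adjoint_carrier[OF q(1)] q'(1) cQM])
    also have "Q\<^sup>H * (Q * ?M) = ?M"
      using q(2,4,5) by (intro mult_mat_cancel[of _ _ d]) auto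
    finally have 1: "Q\<^sup>H * ?N = 0\<^sub>m d d"
      using cM by simp
    have "?N\<^sup>H = Q'\<^sup>H - (Q * ?M)\<^sup>H"
      using q(4,5) q'(4,5) by (intro adjoint_diff) auto
    then have "?N\<^sup>H * ?N = Q'\<^sup>H * ?N - (Q * ?M)\<^sup>H * ?N"
      using minus_mult_distrib_mat[OF adjoint_carrier[OF q'(1)] adjoint_carrier[OF cQM] N] by simp
    also have "(Q * ?M)\<^sup>H * ?N = ?M\<^sup>H * (Q\<^sup>H * ?N)"
      using q(4,5) q'(4,5) by (simp add: adjoint_mult mult_mat_assoc)
    also have "\<dots> = 0\<^sub>m d d" unfolding 1 by (rule right_mult_zero_mat[OF adjoint_carrier[OF cM]])
    also have "Q'\<^sup>H * ?N = Q'\<^sup>H * Q' - Q'\<^sup>H * (Q * ?M)"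
      by (rule mult_minus_distrib_mat[OF adjoint_carrier[OF q'(1)] q'(1) cQM])
    also have "Q'\<^sup>H * (Q * ?M) = ?M\<^sup>H * ?M"
      using q(4,5) q'(4,5) by (simp add: adjoint_mult mult_mat_assoc)
    finally have "?N\<^sup>H * ?N = 1\<^sub>m d - ?M\<^sup>H * ?M - 0\<^sub>m d d" unfolding q'(2) .
    also have "\<dots> = 1\<^sub>m d - ?M\<^sup>H * ?M" using cM by (intro eq_matI) auto
    finally show ?thesis .
  qed
  have diag: "sigma_mat d d (vec_space.rank d ?M) s = (real_diag d s :: 'k mat)"
    using S(6) by (intro eq_matI) (auto simp: sigma_mat_def)
  have MY: "?M * Y = X * real_diag d s"
  proof -
    have "?M * Y = (X * real_diag d s * Y\<^sup>H) * Y" using S(4) unfolding diag by simp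
    then show ?thesis using X Y by (simp add: mult_mat_assoc)
  qed
  have MM: "?M\<^sup>H * ?M \<in> carrier_mat d d"
    using q(1) q'(1) by auto
  have NY: "(?N * Y)\<^sup>H * (?N * Y) = 1\<^sub>m d - real_diag d (\<lambda>i. s i * s i)"
  proof -
    have "(?N * Y)\<^sup>H * (?N * Y) = Y\<^sup>H * ((?N\<^sup>H * ?N) * Y)"
      using N Y q(4,5) q'(4,5) by (simp add: adjoint_mult mult_mat_assoc)
    also have "(?N\<^sup>H * ?N) * Y = 1\<^sub>m d * Y - (?M\<^sup>H * ?M) * Y"
      unfolding N_gram by (rule minus_mult_distrib_mat[OF one_carrier_mat MM Y(3)])
    also have "Y\<^sup>H * (1\<^sub>m d * Y - (?M\<^sup>H * ?M) * Y) = Y\<^sup>H * (1\<^sub>m d * Y) - Y\<^sup>H * ((?M\<^sup>H * ?M) * Y)"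
      using MM Y(3) by (intro mult_minus_distrib_mat[OF adjoint_carrier[OF Y(3)]]) auto
    also have "Y\<^sup>H * (1\<^sub>m d * Y) = 1\<^sub>m d" using Y by simp
    also have "Y\<^sup>H * ((?M\<^sup>H * ?M) * Y) = (?M * Y)\<^sup>H * (?M * Y)"
      using Y q(4,5) q'(4,5) by (simp add: adjoint_mult mult_mat_assoc)
    also have "\<dots> = real_diag d (\<lambda>i. s i * s i)"
      unfolding MY using X(1,2)
      by (simp add: adjoint_mult mult_mat_assoc unitary_cancel[OF S(2)] real_diag_mult_real_diag)
    finally show ?thesis .
  qed
  have entry: "(\<Sum>a<p. (norm ((?N * Y) $$ (a, i)))\<^sup>2) = 1 - (s i)\<^sup>2" if "i < d" for i
  proof -
    have "of_real (\<Sum>a<p. (norm ((?N * Y) $$ (a, i)))\<^sup>2) = ((?N * Y)\<^sup>H * (?N * Y)) $$ (i, i)"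
      using gram_diagonal[of i "?N * Y"] that N Y q q' by simp
    also have "\<dots> = of_real (1 - (s i)\<^sup>2)"
      unfolding NY using that by (simp add: power2_eq_square)
    finally show ?thesis by (simp only: of_real_eq_iff)
  qed
  show "s i \<le> 1" if "i < d" for i
  proof -
    have "0 \<le> 1 - (s i)\<^sup>2" unfolding entry[OF that, symmetric] by (intro sum_nonneg) auto
    then show ?thesis using power2_le_imp_le[of "s i" 1] by simp
  qed
  have "(\<Sum>i<d. 1 - (s i)\<^sup>2) = (\<Sum>i<d. \<Sum>a<p. (norm ((?N * Y) $$ (a, i)))\<^sup>2)"
    by (intro sum.cong) (auto simp: entry)
  also have "\<dots> = (\<Sum>a<p. \<Sum>i<d. (norm ((?N * Y) $$ (a, i)))\<^sup>2)" by (rule sum.swap)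
  also have "\<dots> = (fnorm (?N * Y))\<^sup>2"
    using N Y q q' by (simp add: frobenius_norm_sq)
  also have "\<dots> = (fnorm ?N)\<^sup>2"
    using q q' by (simp add: frobenius_norm_unitary_right[OF S(3)])
  finally show "(\<Sum>i<d. 1 - (s i)\<^sup>2) = (fnorm ?N)\<^sup>2" .
qed

lemma le_tan:
  fixes \<theta> :: real
  assumes "0 \<le> \<theta>" "\<theta> < pi / 2"
  shows "\<theta> \<le> tan \<theta>"
proof -
  have "tan 0 - 0 \<le> tan \<theta> - \<theta>"
  proof (rule DERIV_nonneg_imp_nondecreasing[OF assms(1)])
    fix x assume "0 \<le> x" "x \<le> \<theta>"
    then have cos: "0 < cos x" using assms by (intro cos_gt_zero_pi) auto
    then have "((\<lambda>x. tan x - x) has_real_derivative inverse ((cos x)\<^sup>2) - 1) (at x)"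
      by (auto intro!: derivative_eq_intros)
    moreover have "0 \<le> inverse ((cos x)\<^sup>2) - 1"
      using cos cos_le_one[of x] by (simp add: one_le_inverse power_le_one)
    ultimately show "\<exists>y. ((\<lambda>x. tan x - x) has_real_derivative y) (at x) \<and> 0 \<le> y" by blast
  qed
  then show ?thesis by simp
qed

text \<open>From \<open>sin \<theta> \<le> 2 sin (\<theta> / 2) \<le> \<theta> \<le> tan \<theta>\<close> and \<open>cos \<theta> \<ge> sqrt (1 - c\<^sup>2)\<close>, where \<open>c\<close> is the
  chordal distance.\<close>

lemma distances_comparable:
  fixes Q :: "'k::real_or_complex mat"
  assumes Q: "orthonormal_basis_mat p d W Q" and Q': "orthonormal_basis_mat p d W' Q'"
  defines "c \<equiv> fnorm (Q' - Q * (Q\<^sup>H * Q'))"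
  assumes c: "c < 1"
    and dst: "dst \<in> {chordal_dist p d, grassmann_dist p d, procrustes_dist p d}"
  shows "c \<le> dst W W'" "dst W W' \<le> c / sqrt (1 - c\<^sup>2)"
proof -
  have M: "Q\<^sup>H * Q' \<in> carrier_mat d d"
    using orthonormal_basis_matD[OF Q] orthonormal_basis_matD[OF Q'] by auto
  obtain X s Y where svd: "full_svd d d (Q\<^sup>H * Q') X s Y"
    using full_svd_exists[OF M] .
  note gap = principal_angles_gap[OF Q Q' svd]
  note nonneg = full_svdD(7)[OF svd]
  have c0: "0 \<le> c" by (simp add: c_def)
  have c1: "0 < 1 - c\<^sup>2" using c c0 by (simp add: power_less_one_iff)
  let ?\<theta> = "\<lambda>i. arccos (s i)"
  have sin: "sin (?\<theta> i) = sqrt (1 - (s i)\<^sup>2)" "cos (?\<theta> i) = s i" "0 \<le> ?\<theta> i" "?\<theta> i \<le> pi / 2" if "i < d" for i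
    using gap(1)[OF that] nonneg[OF that] arccos_le_pi2[OF nonneg[OF that] gap(1)[OF that]]
    by (auto simp: sin_arccos_abs arccos_lbound)
  have s_sq: "(s i)\<^sup>2 \<le> 1" if "i < d" for i
    using gap(1)[OF that] nonneg[OF that] by (simp add: power_le_one)
  have s_low: "sqrt (1 - c\<^sup>2) \<le> s i" if "i < d" for i
  proof -
    have "1 - (s i)\<^sup>2 \<le> (\<Sum>i<d. 1 - (s i)\<^sup>2)"
      using that s_sq by (intro member_le_sum) auto
    also have "\<dots> = c\<^sup>2" using gap(2) by (simp add: c_def)
    finally show ?thesis using nonneg[OF that] by (intro real_le_lsqrt) auto
  qed
  have chordal: "chordal_dist p d W W' = c"
  proof -
    have "(\<Sum>i<d. (sin (principal_angle p d W W' i))\<^sup>2) = (\<Sum>i<d. 1 - (s i)\<^sup>2)"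
      using s_sq by (intro sum.cong) (auto simp: principal_angle_eq[OF Q Q' svd] sin)
    then show ?thesis using gap(2) c0 by (simp add: chordal_dist_def c_def)
  qed
  have procrustes: "procrustes_dist p d W W' = sqrt (\<Sum>i<d. (2 * sin (?\<theta> i / 2))\<^sup>2)"
    and grassmann: "grassmann_dist p d W W' = sqrt (\<Sum>i<d. (?\<theta> i)\<^sup>2)"
    and chordal': "c = sqrt (\<Sum>i<d. (sin (?\<theta> i))\<^sup>2)"
    using chordal unfolding procrustes_dist_def grassmann_dist_def chordal_dist_def
    by (simp_all add: principal_angle_eq[OF Q Q' svd])
  have half: "sin (?\<theta> i) \<le> 2 * sin (?\<theta> i / 2)" "2 * sin (?\<theta> i / 2) \<le> ?\<theta> i" "0 \<le> sin (?\<theta> i)" "0 \<le> sin (?\<theta> i / 2)"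
    if "i < d" for i
  proof -
    have "0 \<le> sin (?\<theta> i / 2)" using sin(3,4)[OF that] by (intro sin_ge_zero) auto
    then show "0 \<le> sin (?\<theta> i / 2)" "sin (?\<theta> i) \<le> 2 * sin (?\<theta> i / 2)"
      using sin_double[of "?\<theta> i / 2"] mult_left_mono[OF cos_le_one, of "2 * sin (?\<theta> i / 2)" "?\<theta> i / 2"]
      by auto
    show "2 * sin (?\<theta> i / 2) \<le> ?\<theta> i"
      using sin_x_le_x[of "?\<theta> i / 2"] sin(3)[OF that] by simp
    show "0 \<le> sin (?\<theta> i)" using sin(3,4)[OF that] by (intro sin_ge_zero) auto
  qed
  have low: "c \<le> procrustes_dist p d W W'"
    unfolding chordal' procrustes using half by (intro real_sqrt_le_mono sum_mono power_mono) auto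
  have mid: "procrustes_dist p d W W' \<le> grassmann_dist p d W W'"
    unfolding grassmann procrustes using half by (intro real_sqrt_le_mono sum_mono power_mono) auto
  have "?\<theta> i \<le> sin (?\<theta> i) / sqrt (1 - c\<^sup>2)" if "i < d" for i
  proof -
    have "0 < s i" using s_low[OF that] c1 by (meson order_less_le_trans real_sqrt_gt_zero)
    then have "?\<theta> i < pi / 2" using sin[OF that] by (metis cos_pi_half less_irrefl order_le_less)
    then have "?\<theta> i \<le> sin (?\<theta> i) / s i"
      using le_tan[of "?\<theta> i"] sin[OF that] by (simp add: tan_def)
    also have "\<dots> \<le> sin (?\<theta> i) / sqrt (1 - c\<^sup>2)"
      using half(3)[OF that] s_low[OF that] c1 \<open>0 < s i\<close> by (intro divide_left_mono) auto
    finally show ?thesis .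
  qed
  then have "grassmann_dist p d W W' \<le> sqrt (\<Sum>i<d. (sin (?\<theta> i) / sqrt (1 - c\<^sup>2))\<^sup>2)"
    unfolding grassmann using sin(3) by (intro real_sqrt_le_mono sum_mono power_mono) auto
  also have "\<dots> = c / sqrt (1 - c\<^sup>2)"
    unfolding chordal' using c1
    by (simp add: power_divide real_sqrt_divide flip: sum_divide_distrib chordal')
  finally have high: "grassmann_dist p d W W' \<le> c / sqrt (1 - c\<^sup>2)" .
  show "c \<le> dst W W'" "dst W W' \<le> c / sqrt (1 - c\<^sup>2)"
    using dst low mid high chordal by auto
qed

section \<open>First-order perturbation of a singular subspace\<close>

lemma index_add_mult_sum:
  assumes "A \<in> carrier_mat m m" "B \<in> carrier_mat m m" "C \<in> carrier_mat m m" "a < m" "b < m"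
  shows "(C * (A + B)) $$ (a, b) = (C * A) $$ (a, b) + (C * B) $$ (a, b)"
    "((A + B) * C) $$ (a, b) = (A * C) $$ (a, b) + (B * C) $$ (a, b)"
  using assms mult_add_distrib_mat[OF assms(3,1,2)] add_mult_distrib_mat[OF assms(1,2,3)]
  by (simp_all)

lemma index_add_diff:
  assumes "A \<in> carrier_mat m m" "B \<in> carrier_mat m m" "C \<in> carrier_mat m m" "a < m" "b < m"
  shows "(A + (B - C)) $$ (a, b) = A $$ (a, b) + (B $$ (a, b) - C $$ (a, b))"
  using assms by simp

lemma add_add_diff_cancel:
  fixes B :: "'k::field mat"
  assumes "B \<in> carrier_mat m m" "B1 \<in> carrier_mat m m" "B2 \<in> carrier_mat m m" "B3 \<in> carrier_mat m m"
  shows "(B + B1) + (B2 + B3) - B = (B1 + B2) + B3"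
  using assms by (intro eq_matI) auto

lemma norm_smult_index:
  fixes B :: "'k::real_or_complex mat"
  assumes "B \<in> carrier_mat m m" "a < m" "b < m" "0 \<le> c"
  shows "norm ((of_real c \<cdot>\<^sub>m B) $$ (a, b)) = c * norm (B $$ (a, b))"
  using assms by (simp add: norm_mult)

lemma le_scaled_if_scaled_le: "0 < \<gamma> \<Longrightarrow> \<gamma> / 2 * x \<le> y \<Longrightarrow> x \<le> 2 / \<gamma> * y" for x y \<gamma> :: real
  by (simp add: field_simps)

lemma diff_divide_eq_if_mult_eq: "g \<noteq> 0 \<Longrightarrow> g * t = u + w \<Longrightarrow> t - u / g = w / g" for t :: "'a::field"
  by (simp add: field_simps)

locale separated_svd =
  fixes m n k :: nat and \<pi> :: "nat set" and A U V :: "'k::real_or_complex mat" and \<sigma> :: "nat \<Rightarrow> real"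
  assumes \<pi>: "\<pi> \<subseteq> {..<m}" and card_\<pi>: "card \<pi> = k"
    and svd: "full_svd m n A U \<sigma> V" and sep: "separated m \<pi> \<sigma>"
begin

lemmas svdD = full_svdD[OF svd]
lemmas UD = unitary_matD[OF svdD(2)]
lemmas VD = unitary_matD[OF svdD(3)]

text \<open>The corner block of the derivative of the spectral projector, in coordinates with respect to
  \<open>U\<close>: the derivative \<open>A E\<^sup>H + E A\<^sup>H\<close> of the Gram matrix, divided by the gaps of its eigenvalues.\<close>

definition first_order :: "'k mat \<Rightarrow> 'k mat" where
  "first_order E = mat m m (\<lambda>(a, b). if a \<notin> \<pi> \<and> b \<in> \<pi>
     then (U\<^sup>H * ((A * E\<^sup>H + E * A\<^sup>H) * U)) $$ (a, b) / of_real ((\<sigma> b)\<^sup>2 - (\<sigma> a)\<^sup>2) else 0)"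

lemma first_order_dim [simp]: "dim_row (first_order E) = m" "dim_col (first_order E) = m"
  by (simp_all add: first_order_def)

lemma gap_exists:
  obtains \<gamma> :: real where "0 < \<gamma>" "\<And>a b. a \<in> \<pi> \<Longrightarrow> b \<in> {..<m} - \<pi> \<Longrightarrow> \<gamma> \<le> \<bar>(\<sigma> a)\<^sup>2 - (\<sigma> b)\<^sup>2\<bar>"
proof -
  let ?S = "(\<lambda>(a, b). \<bar>(\<sigma> a)\<^sup>2 - (\<sigma> b)\<^sup>2\<bar>) ` (\<pi> \<times> ({..<m} - \<pi>))"
  have "finite \<pi>" using \<pi> finite_subset by blast
  \<comment> \<open>1 is inserted because \<open>\<pi>\<close> or its complement may be empty\<close>
  then have fin: "finite (insert 1 ?S)" by auto
  have "0 < s" if "s \<in> insert 1 ?S" for s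
  proof -
    have "0 < \<bar>(\<sigma> a)\<^sup>2 - (\<sigma> b)\<^sup>2\<bar>" if "a \<in> \<pi>" "b \<in> {..<m} - \<pi>" for a b
    proof -
      have "a < m" "b < m" "\<sigma> a \<noteq> \<sigma> b" using that \<pi> sep by (auto simp: separated_def)
      then show ?thesis using svdD(7)[of a] svdD(7)[of b] by (simp add: power2_eq_iff_nonneg)
    qed
    then show ?thesis using that by auto
  qed
  then have "0 < Min (insert 1 ?S)" using fin by (subst Min_gr_iff) auto
  moreover have "Min (insert 1 ?S) \<le> \<bar>(\<sigma> a)\<^sup>2 - (\<sigma> b)\<^sup>2\<bar>" if "a \<in> \<pi>" "b \<in> {..<m} - \<pi>" for a b
    using that by (intro Min_le[OF fin]) auto
  ultimately show thesis by (rule that)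
qed

lemma gram_perturbation:
  assumes "E \<in> carrier_mat m n"
  shows "(A + E) * (A + E)\<^sup>H - A * A\<^sup>H = (A * E\<^sup>H + E * A\<^sup>H) + E * E\<^sup>H"
proof -
  note A = svdD(1)
  have c: "A * A\<^sup>H \<in> carrier_mat m m" "A * E\<^sup>H \<in> carrier_mat m m" "E * A\<^sup>H \<in> carrier_mat m m"
    "E * E\<^sup>H \<in> carrier_mat m m"
    using A assms by auto
  have "(A + E)\<^sup>H = A\<^sup>H + E\<^sup>H"
    using A assms by (intro adjoint_add) auto
  then have "(A + E) * (A + E)\<^sup>H = A * (A\<^sup>H + E\<^sup>H) + E * (A\<^sup>H + E\<^sup>H)"
    using add_mult_distrib_mat[OF A assms, of "A\<^sup>H + E\<^sup>H" m] adjoint_carrier[OF A] adjoint_carrier[OF assms] by simp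
  also have "A * (A\<^sup>H + E\<^sup>H) = A * A\<^sup>H + A * E\<^sup>H"
    by (rule mult_add_distrib_mat[OF A adjoint_carrier[OF A] adjoint_carrier[OF assms]])
  also have "E * (A\<^sup>H + E\<^sup>H) = E * A\<^sup>H + E * E\<^sup>H"
    by (rule mult_add_distrib_mat[OF assms adjoint_carrier[OF A] adjoint_carrier[OF assms]])
  finally have "(A + E) * (A + E)\<^sup>H = (A * A\<^sup>H + A * E\<^sup>H) + (E * A\<^sup>H + E * E\<^sup>H)" .
  then show ?thesis
    using add_add_diff_cancel[OF c] by (simp only:)
qed

lemma gram_perturbation_norm:
  assumes "E \<in> carrier_mat m n" "fnorm E \<le> 1"
  shows "fnorm ((A + E) * (A + E)\<^sup>H - A * A\<^sup>H) \<le> (2 * fnorm A + 1) * fnorm E"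
proof -
  note A = svdD(1)
  let ?a = "fnorm A" and ?e = "fnorm E"
  have "fnorm ((A * E\<^sup>H + E * A\<^sup>H) + E * E\<^sup>H) \<le> fnorm (A * E\<^sup>H) + fnorm (E * A\<^sup>H) + fnorm (E * E\<^sup>H)"
    using A assms(1) frobenius_norm_triangle[of "A * E\<^sup>H + E * A\<^sup>H" "E * E\<^sup>H"] frobenius_norm_triangle[of "A * E\<^sup>H" "E * A\<^sup>H"]
    by simp
  also have "\<dots> \<le> ?a * ?e + ?e * ?a + ?e * ?e"
    by (intro add_mono)
      (use A assms(1) frobenius_norm_mult[of A "E\<^sup>H"] frobenius_norm_mult[of E "A\<^sup>H"] frobenius_norm_mult[of E "E\<^sup>H"]
        in simp_all)
  also have "\<dots> \<le> (2 * ?a + 1) * ?e"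
    using assms(2) mult_right_mono[of ?e 1 ?e] by (simp add: algebra_simps)
  finally show ?thesis unfolding gram_perturbation[OF assms(1)] .
qed

context
  fixes A' U' V' :: "'k mat" and \<sigma>' :: "nat \<Rightarrow> real"
  assumes svd': "full_svd m n A' U' \<sigma>' V'"
begin

abbreviation (input) "D \<equiv> coord_projector m \<pi> :: 'k mat"
abbreviation (input) "X \<equiv> U\<^sup>H * U'"
abbreviation (input) "F \<equiv> A' * A'\<^sup>H - A * A\<^sup>H"

text \<open>The projector onto the perturbed subspace, in coordinates with respect to \<open>U\<close>; that of the
  original subspace is \<open>D\<close>.\<close>

definition T :: "'k mat" where "T = X * (D * X\<^sup>H)"

lemmas svd'D = full_svdD[OF svd']
lemmas U'D = unitary_matD[OF svd'D(2)]

lemma X_unitary: "unitary_mat m X"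
  using svdD(2) svd'D(2) by (intro unitary_mat_mult unitary_mat_adjoint)

lemmas XD = unitary_matD[OF X_unitary]

lemma X_carrier: "X \<in> carrier_mat m m" and F_carrier: "F \<in> carrier_mat m m"
  using XD svdD(1) svd'D(1) by auto

lemma T_carrier [simp]: "T \<in> carrier_mat m m" "dim_row T = m" "dim_col T = m"
  using U'D UD by (auto simp: T_def)

lemma T_hermitian: "T\<^sup>H = T"
  using UD(1,2) U'D(1,2) by (simp add: T_def adjoint_mult mult_mat_assoc)

lemma T_idem: "T * T = T"
proof -
  have "T * T = X * (D * ((X\<^sup>H * X) * (D * X\<^sup>H)))"
    using UD(1,2) U'D(1,2) by (simp add: T_def adjoint_mult mult_mat_assoc)
  also have "\<dots> = X * ((D * D) * X\<^sup>H)"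
    unfolding XD(4) using UD(1,2) U'D(1,2) X_carrier
    by (simp add: mult_mat_assoc left_mult_one_mat[of _ m m] del: coord_projector_idem)
  finally show ?thesis by (simp add: T_def)
qed

text \<open>Multiplication by unitary matrices and by the isometry \<open>Q'\<close> preserves the Frobenius norm, so
  the residual that measures the chordal distance can be computed from \<open>T\<close> and \<open>D\<close>.\<close>

lemma chordal_coordinates:
  obtains Q Q' where "orthonormal_basis_mat m k (column_span m U \<pi>) Q"
    "orthonormal_basis_mat m k (column_span m U' \<pi>) Q'"
    "fnorm (Q' - Q * (Q\<^sup>H * Q')) = fnorm (T - D * T)"
proof -
  obtain Q where Q: "orthonormal_basis_mat m k (column_span m U \<pi>) Q" "Q * Q\<^sup>H = U * (D * U\<^sup>H)"
    using column_span_orthonormal_basis[OF svdD(2) \<pi> card_\<pi>] .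
  obtain Q' where Q': "orthonormal_basis_mat m k (column_span m U' \<pi>) Q'" "Q' * Q'\<^sup>H = U' * (D * U'\<^sup>H)"
    using column_span_orthonormal_basis[OF svd'D(2) \<pi> card_\<pi>] .
  note q = orthonormal_basis_matD[OF Q(1)] and q' = orthonormal_basis_matD[OF Q'(1)]
  let ?N = "Q' - Q * (Q\<^sup>H * Q')" and ?P' = "U' * (D * U'\<^sup>H)" and ?P = "U * (D * U\<^sup>H)"
  have N: "?N \<in> carrier_mat m k" using q(1) q'(1) by auto
  have P: "?P \<in> carrier_mat m m" "?P' \<in> carrier_mat m m" using UD(3) U'D(3) by auto
  have "fnorm ?N = fnorm (Q' * ?N\<^sup>H)"
    using q'(2,5) N frobenius_norm_isometry[of Q' "?N\<^sup>H"] by simp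
  also have "\<dots> = fnorm (Q' * ?N\<^sup>H)\<^sup>H" by simp
  also have "(Q' * ?N\<^sup>H)\<^sup>H = ?N * Q'\<^sup>H"
    using q'(4,5) N by (simp add: adjoint_mult)
  also have "\<dots> = ?P' - ?P * ?P'"
  proof -
    have "?N * Q'\<^sup>H = Q' * Q'\<^sup>H - Q * (Q\<^sup>H * Q') * Q'\<^sup>H"
      using q(1) q'(1) by (intro minus_mult_distrib_mat[OF q'(1) _ adjoint_carrier[OF q'(1)]]) auto
    also have "Q * (Q\<^sup>H * Q') * Q'\<^sup>H = (Q * Q\<^sup>H) * (Q' * Q'\<^sup>H)"
      using q(4,5) q'(4,5) by (simp add: mult_mat_assoc)
    finally show ?thesis unfolding Q(2) Q'(2) .
  qed
  also have "fnorm (?P' - ?P * ?P') = fnorm (U\<^sup>H * ((?P' - ?P * ?P') * U))"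
    using UD(1,2) U'D(1,2)
    by (simp add: frobenius_norm_unitary_left[OF svdD(2)] frobenius_norm_unitary_right[OF svdD(2)])
  also have "U\<^sup>H * ((?P' - ?P * ?P') * U) = T - D * T"
  proof -
    have "(?P' - ?P * ?P') * U = ?P' * U - ?P * ?P' * U"
      using P by (intro minus_mult_distrib_mat[OF P(2) _ UD(3)]) auto
    moreover have "U\<^sup>H * (?P' * U - ?P * ?P' * U) = U\<^sup>H * (?P' * U) - U\<^sup>H * (?P * ?P' * U)"
      using P UD(3) by (intro mult_minus_distrib_mat[OF adjoint_carrier[OF UD(3)]]) auto
    moreover have "U\<^sup>H * (?P' * U) = T"
      using UD(1,2) U'D(1,2) by (simp add: T_def adjoint_mult mult_mat_assoc)
    moreover have "U\<^sup>H * (?P * ?P' * U) = D * (U\<^sup>H * (?P' * U))"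
      using UD(1,2) U'D(1,2) by (simp add: mult_mat_assoc unitary_cancel[OF svdD(2)])
    ultimately show ?thesis by simp
  qed
  finally show thesis using Q(1) Q'(1) that by blast
qed

text \<open>The perturbed projector commutes with \<open>A' A'\<^sup>H\<close>, which is \<open>diag(\<sigma>\<^sup>2)\<close> plus a perturbation in
  these coordinates. The commutator with the diagonal part is a Sylvester operator.\<close>

lemma sylvester_equation:
  assumes "a < m" "b < m"
  defines "G \<equiv> U\<^sup>H * (F * U)"
  shows "of_real ((\<sigma> b)\<^sup>2 - (\<sigma> a)\<^sup>2) * T $$ (a, b) = (G * T) $$ (a, b) - (T * G) $$ (a, b)"
proof -
  let ?L = "real_diag m (\<lambda>i. (\<sigma> i)\<^sup>2) :: 'k mat" and ?L' = "real_diag m (\<lambda>i. (\<sigma>' i)\<^sup>2) :: 'k mat"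
  let ?K = "X * (?L' * X\<^sup>H)"
  have G: "G \<in> carrier_mat m m" using F_carrier UD by (auto simp: G_def)
  have K: "?K = ?L + G"
  proof -
    have "G = U\<^sup>H * (A' * A'\<^sup>H * U - A * A\<^sup>H * U)"
      unfolding G_def using svdD(1) svd'D(1) by (subst minus_mult_distrib_mat[OF _ _ UD(3)]) auto
    also have "\<dots> = U\<^sup>H * (A' * A'\<^sup>H * U) - U\<^sup>H * (A * A\<^sup>H * U)"
      using svdD(1) svd'D(1) UD(3) by (intro mult_minus_distrib_mat[OF adjoint_carrier[OF UD(3)]]) auto
    also have "U\<^sup>H * (A' * A'\<^sup>H * U) = ?K"
      using UD(1,2) U'D(1,2)
      by (simp add: gram_eigen_decomposition[OF svd'] adjoint_mult mult_mat_assoc)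
    also have "U\<^sup>H * (A * A\<^sup>H * U) = ?L"
      using UD by (simp add: gram_eigen_decomposition[OF svd] mult_mat_assoc unitary_cancel[OF svdD(2)])
    finally show ?thesis using X_carrier by (intro eq_matI) auto
  qed
  \<comment> \<open>\<open>T\<close> and \<open>A' A'\<^sup>H\<close> are diagonal in the same basis, hence commute\<close>
  have DL: "D * ?L' = ?L' * D"
    by (simp add: coord_projector_def real_diag_mult_real_diag mult.commute)
  have cancel: "X\<^sup>H * (X * C) = C" if "dim_row C = m" for C
    by (rule unitary_cancel(1)[OF X_unitary that])
  have dims: "dim_row X = m" "dim_col X = m" "dim_row X\<^sup>H = m" "dim_col X\<^sup>H = m"
    using XD(1,2) by auto
  have "T * ?K = X * (D * (X\<^sup>H * (X * (?L' * X\<^sup>H))))"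
    unfolding T_def using dims by (simp only: mult_mat_assoc real_diag_dim coord_projector_dim index_mult_mat(2,3))
  also have "\<dots> = X * ((D * ?L') * X\<^sup>H)"
    using dims by (simp only: cancel mult_mat_assoc real_diag_dim coord_projector_dim index_mult_mat(2,3))
  also have "\<dots> = X * (?L' * (X\<^sup>H * (X * (D * X\<^sup>H))))"
    unfolding DL using dims
    by (simp only: cancel mult_mat_assoc real_diag_dim coord_projector_dim index_mult_mat(2,3))
  also have "\<dots> = ?K * T"
    unfolding T_def using dims by (simp only: mult_mat_assoc real_diag_dim coord_projector_dim index_mult_mat(2,3))
  finally have "T * (?L + G) = (?L + G) * T" unfolding K .
  then have "(T * ?L) $$ (a, b) + (T * G) $$ (a, b) = (?L * T) $$ (a, b) + (G * T) $$ (a, b)"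
    using index_add_mult_sum[OF real_diag_carrier G T_carrier(1) assms(1,2), of "\<lambda>i. (\<sigma> i)\<^sup>2"] by metis
  moreover have "(T * ?L) $$ (a, b) = T $$ (a, b) * of_real ((\<sigma> b)\<^sup>2)"
    using assms(1,2) by (intro index_mult_real_diag) auto
  moreover have "(?L * T) $$ (a, b) = of_real ((\<sigma> a)\<^sup>2) * T $$ (a, b)"
    using assms(1,2) by (intro index_real_diag_mult) auto
  ultimately have "T $$ (a, b) * of_real ((\<sigma> b)\<^sup>2) + (T * G) $$ (a, b)
      = of_real ((\<sigma> a)\<^sup>2) * T $$ (a, b) + (G * T) $$ (a, b)"
    by (simp only:)
  then show ?thesis
    by (simp only: of_real_diff left_diff_distrib) (simp only: algebra_simps)
qed

text \<open>A crude linear bound. The entries of \<open>X\<close> that connect \<open>\<pi>\<close> with its complement are those of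
  \<open>U\<^sup>H F U'\<close> divided by differences between squared singular values of \<open>A'\<close> and of \<open>A\<close>, whose absolute
  values stay above \<open>\<gamma> / 2\<close>.\<close>

lemma norm_projector_gap:
  fixes \<gamma> :: real
  assumes \<gamma>: "0 < \<gamma>" "\<And>a b. a \<in> \<pi> \<Longrightarrow> b \<in> {..<m} - \<pi> \<Longrightarrow> \<gamma> \<le> \<bar>(\<sigma> a)\<^sup>2 - (\<sigma> b)\<^sup>2\<bar>"
    and small: "fnorm F \<le> \<gamma> / 2"
  shows "fnorm (T - D * T) \<le> 2 / \<gamma> * fnorm F"
    "fnorm (D - D * T) \<le> 2 / \<gamma> * fnorm F"
proof -
  let ?Y = "U\<^sup>H * (F * U')"
  have Y: "?Y \<in> carrier_mat m m" using F_carrier UD(3) U'D(3) by auto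
  have norm_Y: "fnorm ?Y = fnorm F"
    using UD(1,2) U'D(1,2) svdD(1) svd'D(1)
    by (simp add: frobenius_norm_unitary_left[OF svdD(2)] frobenius_norm_unitary_right[OF svd'D(2)])
  have bound: "norm (X $$ (a, b)) \<le> 2 / \<gamma> * norm (?Y $$ (a, b))"
    if "a < m" "b < m" "a \<in> \<pi> \<longleftrightarrow> b \<notin> \<pi>" for a b
  proof -
    have "\<gamma> \<le> \<bar>(\<sigma> b)\<^sup>2 - (\<sigma> a)\<^sup>2\<bar>"
      using \<gamma>(2)[of a b] \<gamma>(2)[of b a] that by (cases "a \<in> \<pi>") (auto simp: abs_minus_commute)
    moreover have "\<bar>(\<sigma>' b)\<^sup>2 - (\<sigma> b)\<^sup>2\<bar> \<le> \<gamma> / 2"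
      using singular_value_perturbation[OF svd svd' that(2)] small by linarith
    ultimately have "\<gamma> / 2 \<le> \<bar>(\<sigma>' b)\<^sup>2 - (\<sigma> a)\<^sup>2\<bar>" by linarith
    then have "\<gamma> / 2 * norm (X $$ (a, b)) \<le> \<bar>(\<sigma>' b)\<^sup>2 - (\<sigma> a)\<^sup>2\<bar> * norm (X $$ (a, b))"
      by (intro mult_right_mono) auto
    also have "\<dots> = norm (?Y $$ (a, b))"
      unfolding gram_difference_entries[OF svd svd' that(1,2)] norm_mult norm_of_real ..
    finally show ?thesis by (rule le_scaled_if_scaled_le[OF \<gamma>(1)])
  qed
  have scaled: "fnorm B \<le> 2 / \<gamma> * fnorm F"
    if "B \<in> carrier_mat m m"
      "\<And>a b. a < m \<Longrightarrow> b < m \<Longrightarrow> B $$ (a, b) = (if a \<in> \<pi> \<longleftrightarrow> b \<notin> \<pi> then c a b * X $$ (a, b) else 0)"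
      "\<And>a b. norm (c a b) \<le> 1" for B and c :: "nat \<Rightarrow> nat \<Rightarrow> 'k"
  proof -
    have "fnorm B \<le> fnorm (of_real (2 / \<gamma>) \<cdot>\<^sub>m ?Y)"
    proof (rule frobenius_norm_mono)
      fix a b assume "a < dim_row (of_real (2 / \<gamma>) \<cdot>\<^sub>m ?Y)" "b < dim_col (of_real (2 / \<gamma>) \<cdot>\<^sub>m ?Y)"
      then have ab: "a < m" "b < m" using Y by auto
      have rhs: "norm ((of_real (2 / \<gamma>) \<cdot>\<^sub>m ?Y) $$ (a, b)) = 2 / \<gamma> * norm (?Y $$ (a, b))"
        using \<gamma>(1) by (intro norm_smult_index[OF Y ab]) simp
      have "norm (c a b * X $$ (a, b)) \<le> norm (X $$ (a, b))"
        using that(3)[of a b] by (simp only: norm_mult mult_left_le_one_le norm_ge_zero)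
      then show "norm (B $$ (a, b)) \<le> norm ((of_real (2 / \<gamma>) \<cdot>\<^sub>m ?Y) $$ (a, b))"
        unfolding rhs that(2)[OF ab] using bound[OF ab] \<gamma>(1)
        by (cases "a \<in> \<pi> \<longleftrightarrow> b \<notin> \<pi>") auto
    qed (use that(1) Y in auto)
    also have "\<dots> = 2 / \<gamma> * fnorm F"
      unfolding frobenius_norm_smult norm_Y using \<gamma>(1) by (simp add: norm_divide)
    finally show ?thesis .
  qed
  have dims: "dim_row X = m" "dim_col X = m" "dim_row X\<^sup>H = m" "dim_col X\<^sup>H = m"
    using XD(1,2) by auto
  have cXD: "X * D \<in> carrier_mat m m" "D * (X * D) \<in> carrier_mat m m" "D * X \<in> carrier_mat m m"
    using mult_carrier_mat[OF X_carrier coord_projector_carrier]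
      mult_carrier_mat[OF coord_projector_carrier X_carrier]
      mult_carrier_mat[OF coord_projector_carrier mult_carrier_mat[OF X_carrier coord_projector_carrier]]
    by blast+
  have T1: "T = (X * D) * X\<^sup>H" and T2: "D * T = (D * (X * D)) * X\<^sup>H"
    unfolding T_def using dims by (simp_all only: mult_mat_assoc coord_projector_dim index_mult_mat(2,3))
  have "T - D * T = (X * D - D * (X * D)) * X\<^sup>H"
    unfolding T2 unfolding T1 by (rule minus_mult_distrib_mat[OF cXD(1,2) adjoint_carrier[OF X_carrier], symmetric])
  then have "fnorm (T - D * T) = fnorm (X * D - D * (X * D))"
    using frobenius_norm_unitary_right(2)[OF X_unitary] dims by simp
  also have "\<dots> \<le> 2 / \<gamma> * fnorm F"
  proof (rule scaled)
    show "(X * D - D * (X * D)) $$ (a, b) = (if a \<in> \<pi> \<longleftrightarrow> b \<notin> \<pi> then (if b \<in> \<pi> then 1 else 0) * X $$ (a, b) else 0)"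
      if "a < m" "b < m" for a b
      using that dims cXD
      by (simp add: coord_projector_mult_index mult_coord_projector_index)
  qed (use cXD in auto)
  finally show "fnorm (T - D * T) \<le> 2 / \<gamma> * fnorm F" .
  have "D = (D * X) * X\<^sup>H"
    using dims XD(5) by (simp only: mult_mat_assoc coord_projector_dim index_mult_mat(2,3)
        right_mult_one_mat[OF coord_projector_carrier])
  then have "D - D * T = (D * X - D * (X * D)) * X\<^sup>H"
    unfolding T2 using minus_mult_distrib_mat[OF cXD(3,2) adjoint_carrier[OF X_carrier]] by simp
  then have "fnorm (D - D * T) = fnorm (D * X - D * (X * D))"
    using frobenius_norm_unitary_right(2)[OF X_unitary] dims by simp
  also have "\<dots> \<le> 2 / \<gamma> * fnorm F"
  proof (rule scaled)
    show "(D * X - D * (X * D)) $$ (a, b) = (if a \<in> \<pi> \<longleftrightarrow> b \<notin> \<pi> then (if a \<in> \<pi> then 1 else 0) * X $$ (a, b) else 0)"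
      if "a < m" "b < m" for a b
      using that dims cXD
      by (simp add: coord_projector_mult_index mult_coord_projector_index)
  qed (use cXD in auto)
  finally show "fnorm (D - D * T) \<le> 2 / \<gamma> * fnorm F" .
qed

text \<open>The part of \<open>(1 - D) T\<close> outside the corner block is \<open>(1 - D) T (1 - D) = R R\<^sup>H\<close> for
  \<open>R = (1 - D) T\<close>, because \<open>T\<close> is a projector. So it is quadratically small.\<close>

lemma norm_corner:
  defines "R \<equiv> T - D * T"
  shows "\<bar>fnorm R - fnorm (R * D)\<bar> \<le> (fnorm R)\<^sup>2"
proof -
  have cR: "R \<in> carrier_mat m m" by (auto simp: R_def intro!: minus_carrier_mat mult_carrier_mat[of _ m m])
  have DT: "D * T \<in> carrier_mat m m" by (rule mult_carrier_mat[OF coord_projector_carrier T_carrier(1)])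
  have TD: "T * D \<in> carrier_mat m m" by (rule mult_carrier_mat[OF T_carrier(1) coord_projector_carrier])
  have RH: "R\<^sup>H = T - T * D"
    unfolding R_def using T_hermitian by (subst adjoint_diff) (auto simp: adjoint_mult)
  have RT: "R * T = R"
  proof -
    have "R * T = T * T - D * T * T"
      unfolding R_def by (rule minus_mult_distrib_mat[OF T_carrier(1) DT T_carrier(1)])
    also have "D * T * T = D * (T * T)"
      by (rule assoc_mult_mat[OF coord_projector_carrier T_carrier(1) T_carrier(1)])
    finally show ?thesis unfolding T_idem R_def .
  qed
  have "R * R\<^sup>H = R * T - R * (T * D)"
    unfolding RH by (rule mult_minus_distrib_mat[OF cR T_carrier(1) TD])
  also have "R * (T * D) = R * T * D"
    by (rule assoc_mult_mat[OF cR T_carrier(1) coord_projector_carrier, symmetric])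
  finally have eq: "R - R * D = R * R\<^sup>H" unfolding RT by simp
  have "\<bar>fnorm R - fnorm (R * D)\<bar> \<le> fnorm (R - R * D)"
    using cR by (intro frobenius_norm_diff_ineq) auto
  also have "\<dots> \<le> (fnorm R)\<^sup>2"
    unfolding eq using frobenius_norm_mult[of R "R\<^sup>H"] by (simp add: power2_eq_square)
  finally show ?thesis .
qed

text \<open>In the Sylvester equation write \<open>T = D + \<Delta>\<close>. The part with \<open>D\<close> gives the first-order term and
  \<open>U\<^sup>H E E\<^sup>H U\<close>; the commutator with \<open>\<Delta>\<close> is a product of two small factors.\<close>

lemma corner_first_order:
  fixes \<gamma> :: real
  assumes \<gamma>: "0 < \<gamma>" "\<And>a b. a \<in> \<pi> \<Longrightarrow> b \<in> {..<m} - \<pi> \<Longrightarrow> \<gamma> \<le> \<bar>(\<sigma> a)\<^sup>2 - (\<sigma> b)\<^sup>2\<bar>"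
    and E: "E \<in> carrier_mat m n" "A' = A + E"
  shows "fnorm ((T - D * T) * D - first_order E)
    \<le> 1 / \<gamma> * ((fnorm E)\<^sup>2 + 2 * fnorm F * fnorm (T - D))"
proof -
  let ?G = "U\<^sup>H * (F * U)" and ?\<Delta> = "T - D" and ?EE = "U\<^sup>H * ((E * E\<^sup>H) * U)"
  let ?K = "U\<^sup>H * ((A * E\<^sup>H + E * A\<^sup>H) * U)"
  have G: "?G \<in> carrier_mat m m" using F_carrier UD(3) by auto
  have EE: "?EE \<in> carrier_mat m m" using E(1) UD(3) by auto
  have \<Delta>: "?\<Delta> \<in> carrier_mat m m" by (auto intro!: minus_carrier_mat)
  have T_split: "T = D + ?\<Delta>" by (intro eq_matI) auto
  have G_split: "?G = ?K + ?EE"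
  proof -
    have c: "A * E\<^sup>H + E * A\<^sup>H \<in> carrier_mat m m" "E * E\<^sup>H \<in> carrier_mat m m"
      using E(1) svdD(1) by auto
    have "F * U = (A * E\<^sup>H + E * A\<^sup>H) * U + (E * E\<^sup>H) * U"
      unfolding E(2) gram_perturbation[OF E(1)] by (rule add_mult_distrib_mat[OF c UD(3)])
    then show ?thesis
      using mult_add_distrib_mat[OF adjoint_carrier[OF UD(3)] mult_carrier_mat[OF c(1) UD(3)] mult_carrier_mat[OF c(2) UD(3)]]
      by simp
  qed
  let ?B = "?EE + (?G * ?\<Delta> - ?\<Delta> * ?G)"
  have B: "?B \<in> carrier_mat m m" "?G * ?\<Delta> \<in> carrier_mat m m" "?\<Delta> * ?G \<in> carrier_mat m m"
    using EE mult_carrier_mat[OF G \<Delta>] mult_carrier_mat[OF \<Delta> G] by (auto intro!: add_carrier_mat minus_carrier_mat)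
  have entry: "of_real ((\<sigma> b)\<^sup>2 - (\<sigma> a)\<^sup>2) * T $$ (a, b) = ?K $$ (a, b) + ?B $$ (a, b)"
    if "a < m" "b < m" "a \<notin> \<pi>" "b \<in> \<pi>" for a b
  proof -
    have "(?G * T) $$ (a, b) = (?G * D) $$ (a, b) + (?G * ?\<Delta>) $$ (a, b)"
      using index_add_mult_sum(1)[OF coord_projector_carrier \<Delta> G that(1,2)] T_split by metis
    also have "(?G * D) $$ (a, b) = ?G $$ (a, b)"
      using that G by (subst mult_coord_projector_index) auto
    also have "?G $$ (a, b) = ?K $$ (a, b) + ?EE $$ (a, b)"
      using that EE G_split UD(2) by (metis carrier_matD index_add_mat(1))
    finally have 1: "(?G * T) $$ (a, b) = ?K $$ (a, b) + ?EE $$ (a, b) + (?G * ?\<Delta>) $$ (a, b)" .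
    have "(T * ?G) $$ (a, b) = (D * ?G) $$ (a, b) + (?\<Delta> * ?G) $$ (a, b)"
      using index_add_mult_sum(2)[OF coord_projector_carrier \<Delta> G that(1,2)] T_split by metis
    also have "(D * ?G) $$ (a, b) = 0"
      using that G by (subst coord_projector_mult_index) auto
    finally have 2: "(T * ?G) $$ (a, b) = (?\<Delta> * ?G) $$ (a, b)" by simp
    have "?B $$ (a, b) = ?EE $$ (a, b) + ((?G * ?\<Delta>) $$ (a, b) - (?\<Delta> * ?G) $$ (a, b))"
      by (rule index_add_diff[OF EE B(2,3) that(1,2)])
    then show ?thesis
      unfolding sylvester_equation[OF that(1,2)] 1 2 by (simp only: algebra_simps)
  qed
  have "fnorm ((T - D * T) * D - first_order E) \<le> fnorm (of_real (1 / \<gamma>) \<cdot>\<^sub>m ?B)"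
  proof (rule frobenius_norm_mono)
    fix a b assume "a < dim_row (of_real (1 / \<gamma>) \<cdot>\<^sub>m ?B)" "b < dim_col (of_real (1 / \<gamma>) \<cdot>\<^sub>m ?B)"
    then have ab: "a < m" "b < m" using B(1) by (auto simp del: index_add_mat)
    have rhs: "norm ((of_real (1 / \<gamma>) \<cdot>\<^sub>m ?B) $$ (a, b)) = 1 / \<gamma> * norm (?B $$ (a, b))"
      using \<gamma>(1) by (intro norm_smult_index[OF B(1) ab]) simp
    have corner: "((T - D * T) * D) $$ (a, b) = (if a \<notin> \<pi> \<and> b \<in> \<pi> then T $$ (a, b) else 0)"
      using ab by (simp add: mult_coord_projector_index coord_projector_mult_index)
    have lhs: "((T - D * T) * D - first_order E) $$ (a, b)
        = (if a \<notin> \<pi> \<and> b \<in> \<pi> then T $$ (a, b) - ?K $$ (a, b) / of_real ((\<sigma> b)\<^sup>2 - (\<sigma> a)\<^sup>2) else 0)"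
      using ab corner by (simp add: first_order_def del: of_real_diff)
    show "norm (((T - D * T) * D - first_order E) $$ (a, b)) \<le> norm ((of_real (1 / \<gamma>) \<cdot>\<^sub>m ?B) $$ (a, b))"
    proof (cases "a \<notin> \<pi> \<and> b \<in> \<pi>")
      case True
      define g where "g = (\<sigma> b)\<^sup>2 - (\<sigma> a)\<^sup>2"
      have g: "\<gamma> \<le> \<bar>g\<bar>" using \<gamma>(2)[of b a] True ab by (auto simp: g_def)
      then have g0: "(of_real g :: 'k) \<noteq> 0" using \<gamma>(1) by auto
      have "of_real g * T $$ (a, b) = ?K $$ (a, b) + ?B $$ (a, b)"
        unfolding g_def using entry ab True by blast
      then have "T $$ (a, b) - ?K $$ (a, b) / of_real g = ?B $$ (a, b) / of_real g"
        by (rule diff_divide_eq_if_mult_eq[OF g0])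
      then have "norm (((T - D * T) * D - first_order E) $$ (a, b)) = norm (?B $$ (a, b)) / \<bar>g\<bar>"
        unfolding lhs g_def[symmetric] using True by (simp only: if_True norm_divide norm_of_real simp_thms)
      also have "\<dots> \<le> norm (?B $$ (a, b)) / \<gamma>"
        using g \<gamma>(1) by (intro divide_left_mono) auto
      finally show ?thesis unfolding rhs by (simp only: times_divide_eq_left mult_1)
    next
      case False
      then show ?thesis unfolding lhs by (simp only: if_False norm_zero norm_ge_zero)
    qed
  qed (use B(1) in \<open>auto simp del: index_add_mat\<close>)
  also have "\<dots> = 1 / \<gamma> * fnorm ?B"
    unfolding frobenius_norm_smult using \<gamma>(1) by (simp add: norm_divide)
  also have "\<dots> \<le> 1 / \<gamma> * ((fnorm E)\<^sup>2 + 2 * fnorm F * fnorm ?\<Delta>)"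
  proof (rule mult_left_mono)
    have nG: "fnorm ?G = fnorm F"
      using UD(1,2) svdD(1) svd'D(1)
      by (simp add: frobenius_norm_unitary_left[OF svdD(2)] frobenius_norm_unitary_right[OF svdD(2)])
    have nEE: "fnorm ?EE \<le> (fnorm E)\<^sup>2"
    proof -
      have "fnorm ?EE = fnorm (E * E\<^sup>H)"
        using UD(1,2) E(1)
        by (simp add: frobenius_norm_unitary_left[OF svdD(2)] frobenius_norm_unitary_right[OF svdD(2)])
      then show ?thesis using frobenius_norm_mult[of E "E\<^sup>H"] by (simp add: power2_eq_square)
    qed
    have "fnorm ?B \<le> fnorm ?EE + fnorm (?G * ?\<Delta> - ?\<Delta> * ?G)"
      using EE B(2,3) by (intro frobenius_norm_triangle) auto
    moreover have "fnorm (?G * ?\<Delta> - ?\<Delta> * ?G) \<le> fnorm (?G * ?\<Delta>) + fnorm (?\<Delta> * ?G)"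
      using B(2,3) by (intro frobenius_norm_diff_triangle) auto
    moreover have "fnorm (?G * ?\<Delta>) \<le> fnorm F * fnorm ?\<Delta>"
      using frobenius_norm_mult[of ?G ?\<Delta>] UD(1,2) nG by simp
    moreover have "fnorm (?\<Delta> * ?G) \<le> fnorm F * fnorm ?\<Delta>"
      using frobenius_norm_mult[of ?\<Delta> ?G] UD(1,2) nG by (simp add: mult.commute)
    ultimately show "fnorm ?B \<le> (fnorm E)\<^sup>2 + 2 * fnorm F * fnorm ?\<Delta>"
      using nEE by linarith
  qed (use \<gamma>(1) in auto)
  finally show ?thesis .
qed

end

end

context separated_svd
begin

text \<open>The chordal distance, computed from some pair of orthonormal bases, agrees with its first-order
  term up to \<open>C \<parallel>E\<parallel>\<^sup>2\<close>.\<close>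

definition expands :: "real \<Rightarrow> 'k mat \<Rightarrow> bool" where
  "expands C E \<longleftrightarrow> (\<exists>Q Q'. orthonormal_basis_mat m k (singular_map m n \<pi> A) Q \<and>
     orthonormal_basis_mat m k (singular_map m n \<pi> (A + E)) Q' \<and>
     \<bar>fnorm (Q' - Q * (Q\<^sup>H * Q')) - fnorm (first_order E)\<bar> \<le> C * (fnorm E)\<^sup>2)"

text \<open>The constants come from \<open>\<parallel>F\<parallel> \<le> K \<parallel>E\<parallel>\<close> with \<open>K = 2 \<parallel>A\<parallel> + 1\<close> and from the gap \<open>\<gamma>\<close>. Taking
  \<open>K \<parallel>E\<parallel> < \<gamma> / 2\<close> also keeps the singular values with index in \<open>\<pi>\<close> apart from the others.\<close>

lemma singular_map_expansion:
  obtains C \<delta> :: real where "0 < \<delta>" "0 \<le> C"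
    "\<And>E. E \<in> carrier_mat m n \<Longrightarrow> fnorm E < \<delta> \<Longrightarrow> A + E \<in> singular_domain m n \<pi>"
    "\<And>E. E \<in> carrier_mat m n \<Longrightarrow> fnorm E < \<delta> \<Longrightarrow> expands C E"
proof -
  obtain \<gamma> :: real where \<gamma>: "0 < \<gamma>" "\<And>a b. a \<in> \<pi> \<Longrightarrow> b \<in> {..<m} - \<pi> \<Longrightarrow> \<gamma> \<le> \<bar>(\<sigma> a)\<^sup>2 - (\<sigma> b)\<^sup>2\<bar>"
    by (rule gap_exists) blast
  define K where "K = 2 * fnorm A + 1"
  have K: "1 \<le> K" by (simp add: K_def)
  define C where "C = (2 * K / \<gamma>)\<^sup>2 + 1 / \<gamma> * (1 + 2 * K * (4 * K / \<gamma>))"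
  define \<delta> where "\<delta> = min 1 (\<gamma> / (2 * K))"
  let ?D = "coord_projector m \<pi> :: 'k mat"
  have main: "A + E \<in> singular_domain m n \<pi> \<and> expands C E"
    if E: "E \<in> carrier_mat m n" and small: "fnorm E < \<delta>" for E
  proof -
    define e where "e = fnorm E"
    have e: "0 \<le> e" "e \<le> 1" "e < \<gamma> / (2 * K)" using small by (auto simp: e_def \<delta>_def)
    have AE: "A + E \<in> carrier_mat m n" using svdD(1) E by auto
    obtain U' \<sigma>' V' where svd': "full_svd m n (A + E) U' \<sigma>' V'"
      using full_svd_exists[OF AE] .
    define f where "f = fnorm ((A + E) * (A + E)\<^sup>H - A * A\<^sup>H)"
    have f: "f \<le> K * e" "0 \<le> f"
      using gram_perturbation_norm[OF E] e by (simp_all add: f_def K_def e_def)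
    have "K * e < \<gamma> / 2" using e(3) K by (simp add: field_simps)
    then have f_small: "f < \<gamma> / 2" using f by simp
    have sep': "separated m \<pi> \<sigma>'"
      unfolding separated_def
    proof (intro ballI notI)
      fix a b assume ab: "a \<in> \<pi>" "b \<in> {..<m} - \<pi>" and eq: "\<sigma>' a = \<sigma>' b"
      have "a < m" "b < m" using ab \<pi> by auto
      then have "\<bar>(\<sigma>' a)\<^sup>2 - (\<sigma> a)\<^sup>2\<bar> \<le> f" "\<bar>(\<sigma>' b)\<^sup>2 - (\<sigma> b)\<^sup>2\<bar> \<le> f"
        using singular_value_perturbation[OF svd svd'] by (auto simp: f_def)
      then show False using \<gamma>(2)[OF ab] f_small eq by auto
    qed
    obtain Q Q' where Q: "orthonormal_basis_mat m k (column_span m U \<pi>) Q"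
      "orthonormal_basis_mat m k (column_span m U' \<pi>) Q'"
      "fnorm (Q' - Q * (Q\<^sup>H * Q')) = fnorm (T U' - ?D * T U')"
      using chordal_coordinates[OF svd'] .
    let ?T = "T U'"
    note T = T_carrier[OF svd']
    define r where "r = fnorm (?T - ?D * ?T)"
    define x where "x = fnorm (?T - ?D)"
    define y where "y = fnorm ((?T - ?D * ?T) * ?D)"
    define l where "l = fnorm (first_order E)"
    have gap: "r \<le> 2 / \<gamma> * f" "fnorm (?D - ?D * ?T) \<le> 2 / \<gamma> * f"
      using norm_projector_gap[OF svd' \<gamma>] f_small by (auto simp: r_def f_def)
    have "?T - ?D = (?T - ?D * ?T) - (?D - ?D * ?T)"
      using T by (intro eq_matI) auto
    then have "x \<le> r + fnorm (?D - ?D * ?T)"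
      using frobenius_norm_diff_triangle[of "?T - ?D * ?T" "?D - ?D * ?T"] T by (simp add: x_def r_def)
    then have "x \<le> 4 / \<gamma> * f" using gap by simp
    also have "\<dots> \<le> 4 / \<gamma> * (K * e)" using f \<gamma>(1) by (intro mult_left_mono) auto
    finally have x: "x \<le> 4 * K / \<gamma> * e" "0 \<le> x" by (simp_all add: x_def)
    have "r \<le> 2 / \<gamma> * (K * e)"
      using gap(1) f \<gamma>(1) by (intro order_trans[OF gap(1)] mult_left_mono) auto
    then have r: "r \<le> 2 * K / \<gamma> * e" "0 \<le> r" by (simp_all add: r_def)
    have "\<bar>r - y\<bar> \<le> r\<^sup>2"
      using norm_corner[OF svd'] by (simp add: r_def y_def)
    also have "\<dots> \<le> (2 * K / \<gamma> * e)\<^sup>2" using r by (intro power_mono) auto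
    also have "\<dots> = (2 * K / \<gamma>)\<^sup>2 * e\<^sup>2" by (rule power_mult_distrib)
    finally have ry: "\<bar>r - y\<bar> \<le> (2 * K / \<gamma>)\<^sup>2 * e\<^sup>2" .
    have "\<bar>y - l\<bar> \<le> fnorm ((?T - ?D * ?T) * ?D - first_order E)"
      unfolding y_def l_def using T by (intro frobenius_norm_diff_ineq) auto
    also have "\<dots> \<le> 1 / \<gamma> * (e\<^sup>2 + 2 * f * x)"
      using corner_first_order[OF svd' \<gamma> E refl] by (simp add: e_def f_def x_def)
    also have "\<dots> \<le> 1 / \<gamma> * (e\<^sup>2 + 2 * (K * e) * (4 * K / \<gamma> * e))"
      using f x \<gamma>(1) e K by (intro mult_left_mono add_left_mono mult_mono) auto
    also have "\<dots> = 1 / \<gamma> * (1 + 2 * K * (4 * K / \<gamma>)) * e\<^sup>2"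
      by (simp add: power2_eq_square algebra_simps)
    finally have "\<bar>r - l\<bar> \<le> C * e\<^sup>2"
      using ry by (simp add: C_def distrib_right)
    then have "\<bar>fnorm (Q' - Q * (Q\<^sup>H * Q')) - fnorm (first_order E)\<bar>
           \<le> C * (fnorm E)\<^sup>2"
      by (simp add: Q(3) r_def l_def e_def)
    with Q(1,2) show ?thesis
      unfolding expands_def singular_map_eq[OF \<pi> svd sep] singular_map_eq[OF \<pi> svd' sep']
      using singular_domain_if_separated[OF \<pi> svd' sep'] by blast
  qed
  have "0 < \<delta>" "0 \<le> C" using \<gamma>(1) K by (auto simp: \<delta>_def C_def)
  then show thesis using that[of \<delta> C] main by blast
qed

text \<open>The entries of \<open>U\<^sup>H E V\<close>, extended by 0 beyond the last column so that both index orders make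
  sense for all row indices; \<open>\<sigma>\<close> vanishes wherever the extension is used.\<close>

definition coord :: "'k mat \<Rightarrow> nat \<Rightarrow> nat \<Rightarrow> 'k" where
  "coord E a b = (if b < n then (U\<^sup>H * (E * V)) $$ (a, b) else 0)"

lemma \<sigma>_zero: "n \<le> a \<Longrightarrow> a < m \<Longrightarrow> \<sigma> a = 0"
  using svdD(6)[of a] svdD(9) by simp

lemma first_order_index:
  assumes E: "E \<in> carrier_mat m n" and ab: "a < m" "b < m"
  shows "first_order E $$ (a, b) = (if a \<notin> \<pi> \<and> b \<in> \<pi>
     then (of_real (\<sigma> a) * conjugate (coord E b a) + coord E a b * of_real (\<sigma> b)) / of_real ((\<sigma> b)\<^sup>2 - (\<sigma> a)\<^sup>2)
     else 0)"
proof -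
  let ?r = "vec_space.rank m A"
  let ?S = "sigma_mat m n ?r \<sigma> :: 'k mat" and ?e = "U\<^sup>H * (E * V)"
  have e: "?e \<in> carrier_mat m n" using UD(3) VD(3) E by auto
  have S_e: "?S * ?e\<^sup>H \<in> carrier_mat m m"
    by (rule mult_carrier_mat[OF sigma_mat_carrier adjoint_carrier[OF e]])
  have 1: "U\<^sup>H * (A * E\<^sup>H * U) = ?S * ?e\<^sup>H"
  proof -
    have "U\<^sup>H * (A * E\<^sup>H * U) = U\<^sup>H * ((U * ?S * V\<^sup>H) * E\<^sup>H * U)" using svdD(4) by simp
    then show ?thesis
      using UD(1,2) VD(1,2) E
      by (simp add: adjoint_mult mult_mat_assoc unitary_cancel[OF svdD(2)])
  qed
  have "(U\<^sup>H * (A * E\<^sup>H * U))\<^sup>H = U\<^sup>H * (E * A\<^sup>H * U)"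
    using UD(1,2) E svdD(1) by (simp add: adjoint_mult mult_mat_assoc)
  then have 2: "U\<^sup>H * (E * A\<^sup>H * U) = (?S * ?e\<^sup>H)\<^sup>H" unfolding 1 by simp
  have c: "A * E\<^sup>H \<in> carrier_mat m m" "E * A\<^sup>H \<in> carrier_mat m m"
    using E svdD(1) by auto
  have "(A * E\<^sup>H + E * A\<^sup>H) * U = A * E\<^sup>H * U + E * A\<^sup>H * U"
    by (rule add_mult_distrib_mat[OF c UD(3)])
  then have sum: "U\<^sup>H * ((A * E\<^sup>H + E * A\<^sup>H) * U) = ?S * ?e\<^sup>H + (?S * ?e\<^sup>H)\<^sup>H"
    using mult_add_distrib_mat[OF adjoint_carrier[OF UD(3)] mult_carrier_mat[OF c(1) UD(3)] mult_carrier_mat[OF c(2) UD(3)]]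
    unfolding 1 2 by simp
  have entry: "(?S * ?e\<^sup>H) $$ (a, b) = of_real (\<sigma> a) * conjugate (coord E b a)" if "a < m" "b < m" for a b
  proof -
    have "(?S * ?e\<^sup>H) $$ (a, b) = (\<Sum>l<n. ?S $$ (a, l) * conjugate (?e $$ (b, l)))"
      using that UD VD E by (subst index_mult_mat_sum) auto
    also have "\<dots> = (\<Sum>l<n. if l = a then of_real (\<sigma> a) * conjugate (?e $$ (b, a)) else 0)"
      using that svdD(6)[of a] by (intro sum.cong) (auto simp: sigma_mat_def)
    also have "\<dots> = of_real (\<sigma> a) * conjugate (coord E b a)"
      using that \<sigma>_zero[of a] by (simp add: coord_def)
    finally show ?thesis .
  qed
  have "(?S * ?e\<^sup>H)\<^sup>H $$ (a, b) = conjugate ((?S * ?e\<^sup>H) $$ (b, a))"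
    using S_e ab by (intro index_adjoint) auto
  also have "\<dots> = coord E a b * of_real (\<sigma> b)"
    unfolding entry[OF ab(2,1)] by (simp add: conjugate_dist_mul mult.commute)
  finally have "(U\<^sup>H * ((A * E\<^sup>H + E * A\<^sup>H) * U)) $$ (a, b)
      = of_real (\<sigma> a) * conjugate (coord E b a) + coord E a b * of_real (\<sigma> b)"
    unfolding sum using S_e ab entry[OF ab]
    by (subst index_add_mat(1)) auto
  then show ?thesis
    using ab by (simp add: first_order_def del: of_real_diff)
qed

lemma coord_smult:
  assumes "E \<in> carrier_mat m n" "a < m"
  shows "coord (c \<cdot>\<^sub>m E) a b = c * coord E a b"
proof -
  have "U\<^sup>H * (c \<cdot>\<^sub>m E * V) = c \<cdot>\<^sub>m (U\<^sup>H * (E * V))"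
    using assms UD(3) VD(3) mult_smult_assoc_mat[of E m n V n c] mult_smult_distrib[of "U\<^sup>H" m m "E * V" n c]
    by simp
  then show ?thesis
    using assms UD VD by (simp add: coord_def)
qed

lemma first_order_scale:
  assumes E: "E \<in> carrier_mat m n"
  shows "fnorm (first_order (of_real t \<cdot>\<^sub>m E)) = \<bar>t\<bar> * fnorm (first_order E)"
proof -
  have "first_order (of_real t \<cdot>\<^sub>m E) = of_real t \<cdot>\<^sub>m first_order E"
    using E by (intro eq_matI) (auto simp: first_order_index coord_smult conjugate_dist_mul algebra_simps add_divide_distrib)
  then show ?thesis by (simp add: frobenius_norm_smult)
qed

lemma norm_coord: "E \<in> carrier_mat m n \<Longrightarrow>
    (fnorm E)\<^sup>2 = (\<Sum>a<m. \<Sum>b<n. (norm (coord E a b))\<^sup>2)"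
proof -
  assume E: "E \<in> carrier_mat m n"
  have "fnorm E = fnorm (U\<^sup>H * (E * V))"
    using E UD VD by (simp add: frobenius_norm_unitary_left[OF svdD(2)] frobenius_norm_unitary_right[OF svdD(3)])
  then show ?thesis
    using E UD VD by (simp add: frobenius_norm_sq coord_def)
qed

lemma pair_condition_nonneg: "0 \<le> pair_condition \<sigma> a b"
  by (simp add: pair_condition_def)

lemma pair_condition_sq:
  "(pair_condition \<sigma> a b)\<^sup>2 = ((\<sigma> a)\<^sup>2 + (\<sigma> b)\<^sup>2) / ((\<sigma> a)\<^sup>2 - (\<sigma> b)\<^sup>2)\<^sup>2"
proof -
  have "((\<sigma> a)\<^sup>2 - (\<sigma> b)\<^sup>2)\<^sup>2 = (\<sigma> a - \<sigma> b)\<^sup>2 * (\<sigma> a + \<sigma> b)\<^sup>2"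
    by (simp add: power2_eq_square algebra_simps)
  then show ?thesis
    by (simp add: pair_condition_def power_mult_distrib power_divide)
qed

text \<open>Cauchy-Schwarz bounds the entry at \<open>(a, b)\<close> by the pair condition times the norm of the pair of
  coordinates at \<open>(a, b)\<close> and \<open>(b, a)\<close>. As exactly one of \<open>a\<close>, \<open>b\<close> lies in \<open>\<pi>\<close>, no coordinate is used
  for two different entries.\<close>

lemma first_order_bound:
  assumes E: "E \<in> carrier_mat m n" and \<kappa>: "0 \<le> \<kappa>"
    "\<And>b a. b \<in> \<pi> \<Longrightarrow> a \<in> {..<m} - \<pi> \<Longrightarrow> pair_condition \<sigma> b a \<le> \<kappa>"
  shows "fnorm (first_order E) \<le> \<kappa> * fnorm E"
proof -
  let ?w = "\<lambda>a b. (norm (coord E a b))\<^sup>2"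
  let ?i = "\<lambda>a b. if a \<notin> \<pi> \<and> b \<in> \<pi> then 1 else 0 :: real"
  have entry: "(norm (first_order E $$ (a, b)))\<^sup>2 \<le> \<kappa>\<^sup>2 * (?i a b * ?w a b + ?i a b * ?w b a)"
    if ab: "a < m" "b < m" for a b
  proof (cases "a \<notin> \<pi> \<and> b \<in> \<pi>")
    case True
    define x where "x = norm (coord E b a)"
    define y where "y = norm (coord E a b)"
    define g where "g = (\<sigma> b)\<^sup>2 - (\<sigma> a)\<^sup>2"
    have "norm (of_real (\<sigma> a) * conjugate (coord E b a) + coord E a b * of_real (\<sigma> b)) \<le> \<sigma> a * x + y * \<sigma> b"
      using svdD(7)[OF ab(1)] svdD(7)[OF ab(2)]
      by (intro order_trans[OF norm_triangle_ineq]) (simp add: norm_mult x_def y_def)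
    then have "(norm (of_real (\<sigma> a) * conjugate (coord E b a) + coord E a b * of_real (\<sigma> b)))\<^sup>2 \<le> (\<sigma> a * x + y * \<sigma> b)\<^sup>2"
      by (intro power_mono) auto
    also have "\<dots> \<le> ((\<sigma> b)\<^sup>2 + (\<sigma> a)\<^sup>2) * (y\<^sup>2 + x\<^sup>2)"
    proof -
      have "((\<sigma> b)\<^sup>2 + (\<sigma> a)\<^sup>2) * (y\<^sup>2 + x\<^sup>2) - (\<sigma> a * x + y * \<sigma> b)\<^sup>2 = (\<sigma> b * x - \<sigma> a * y)\<^sup>2"
        by (simp add: power2_eq_square algebra_simps)
      then show ?thesis using zero_le_power2[of "\<sigma> b * x - \<sigma> a * y"] by linarith
    qed
    finally have num: "(norm (of_real (\<sigma> a) * conjugate (coord E b a) + coord E a b * of_real (\<sigma> b)))\<^sup>2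
        \<le> ((\<sigma> b)\<^sup>2 + (\<sigma> a)\<^sup>2) * (y\<^sup>2 + x\<^sup>2)" .
    have "(norm (first_order E $$ (a, b)))\<^sup>2
        = (norm (of_real (\<sigma> a) * conjugate (coord E b a) + coord E a b * of_real (\<sigma> b)))\<^sup>2 / g\<^sup>2"
      unfolding first_order_index[OF E ab] g_def[symmetric] using True
      by (simp add: norm_divide power_divide)
    also have "\<dots> \<le> ((\<sigma> b)\<^sup>2 + (\<sigma> a)\<^sup>2) * (y\<^sup>2 + x\<^sup>2) / g\<^sup>2"
      using num by (rule divide_right_mono) simp
    also have "\<dots> = (pair_condition \<sigma> b a)\<^sup>2 * (y\<^sup>2 + x\<^sup>2)"
      by (simp add: pair_condition_sq g_def)
    also have "\<dots> \<le> \<kappa>\<^sup>2 * (y\<^sup>2 + x\<^sup>2)"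
      using \<kappa>(2)[of b a] True ab by (intro mult_right_mono power_mono pair_condition_nonneg) auto
    finally show ?thesis using True by (simp add: x_def y_def)
  next
    case False
    then show ?thesis unfolding first_order_index[OF E ab] by (simp add: if_not_P)
  qed
  have "(fnorm (first_order E))\<^sup>2 \<le> (\<Sum>a<m. \<Sum>b<m. \<kappa>\<^sup>2 * (?i a b * ?w a b + ?i a b * ?w b a))"
    unfolding frobenius_norm_sq first_order_dim by (intro sum_mono entry) auto
  also have "\<dots> = \<kappa>\<^sup>2 * ((\<Sum>a<m. \<Sum>b<m. ?i a b * ?w a b) + (\<Sum>a<m. \<Sum>b<m. ?i a b * ?w b a))"
    by (simp only: sum_distrib_left[symmetric] sum.distrib)
  also have "(\<Sum>a<m. \<Sum>b<m. ?i a b * ?w b a) = (\<Sum>a<m. \<Sum>b<m. ?i b a * ?w a b)"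
    by (rule sum.swap)
  also have "(\<Sum>a<m. \<Sum>b<m. ?i a b * ?w a b) + (\<Sum>a<m. \<Sum>b<m. ?i b a * ?w a b)
      = (\<Sum>a<m. \<Sum>b<m. ?i a b * ?w a b + ?i b a * ?w a b)"
    by (simp only: sum.distrib)
  also have "\<kappa>\<^sup>2 * \<dots> \<le> \<kappa>\<^sup>2 * (\<Sum>a<m. \<Sum>b<m. ?w a b)"
    by (intro mult_left_mono sum_mono) auto
  also have "(\<Sum>a<m. \<Sum>b<m. ?w a b) \<le> (\<Sum>a<m. \<Sum>b<n. ?w a b)"
  proof (rule sum_mono)
    fix a
    have "(\<Sum>b<m. ?w a b) = (\<Sum>b\<in>{..<m} \<inter> {..<n}. ?w a b)"
      by (intro sum.mono_neutral_right) (auto simp: coord_def)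
    also have "\<dots> \<le> (\<Sum>b<n. ?w a b)" by (intro sum_mono2) auto
    finally show "(\<Sum>b<m. ?w a b) \<le> (\<Sum>b<n. ?w a b)" .
  qed
  finally have "(fnorm (first_order E))\<^sup>2 \<le> (\<kappa> * fnorm E)\<^sup>2"
    unfolding power_mult_distrib norm_coord[OF E] by (simp add: mult_left_mono)
  then show ?thesis by (rule power2_le_imp_le) (simp add: \<kappa>(1))
qed

end

section \<open>The extremal direction\<close>

lemma extremal_coefficients:
  fixes x y q :: real
  assumes q: "q \<noteq> 0" "q = x\<^sup>2 + y\<^sup>2"
  shows "x - 2 * (x * y / q) * y = (x\<^sup>2 - y\<^sup>2) / q * x"
    "2 * (x * y / q) * x - y = (x\<^sup>2 - y\<^sup>2) / q * y"
    "y * ((x\<^sup>2 - y\<^sup>2) / q * y) + (x\<^sup>2 - y\<^sup>2) / q * x * x = x\<^sup>2 - y\<^sup>2"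
proof -
  have "x * q - 2 * (x * y) * y = (x\<^sup>2 - y\<^sup>2) * x"
    by (simp add: q(2) power2_eq_square algebra_simps)
  then show "x - 2 * (x * y / q) * y = (x\<^sup>2 - y\<^sup>2) / q * x"
    using q(1) by (simp add: field_simps)
  have "2 * (x * y) * x - y * q = (x\<^sup>2 - y\<^sup>2) * y"
    by (simp add: q(2) power2_eq_square algebra_simps)
  then show "2 * (x * y / q) * x - y = (x\<^sup>2 - y\<^sup>2) / q * y"
    using q(1) by (simp add: field_simps)
  have "y * ((x\<^sup>2 - y\<^sup>2) / q * y) + (x\<^sup>2 - y\<^sup>2) / q * x * x = (x\<^sup>2 - y\<^sup>2) / q * q"
    by (simp only: q(2) power2_eq_square algebra_simps)
  then show "y * ((x\<^sup>2 - y\<^sup>2) / q * y) + (x\<^sup>2 - y\<^sup>2) / q * x * x = x\<^sup>2 - y\<^sup>2"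
    using q(1) by simp
qed

lemma elem_mat_dim [simp]: "dim_row (elem_mat p i j) = p" "dim_col (elem_mat p i j) = p"
  by (simp_all add: elem_mat_def)

lemma elem_mat_index:
  "a < p \<Longrightarrow> b < p \<Longrightarrow> elem_mat p i j $$ (a, b) = (if a = i \<and> b = j then 1 else 0 :: 'k::real_or_complex)"
  by (simp add: elem_mat_def index_mult_mat_sum mat_of_cols_index mat_of_rows_index unit_vec_def
      lessThan_Suc)

context separated_svd
begin

text \<open>In coordinates the two summands combine to entries proportional to \<open>\<sigma>\<^sub>i\<close> at \<open>(j, i)\<close> and
  \<open>\<sigma>\<^sub>j\<close> at \<open>(i, j)\<close>, which is the equality case of Cauchy-Schwarz. When one of the two singular values is 0 the
  first summand alone has this form, with \<open>g = 1\<close> or \<open>g = -1\<close>.\<close>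

lemma extremal_perturbation_coordinates:
  defines "r \<equiv> vec_space.rank m A"
  assumes i: "i < m" and j: "j < m" and ij: "\<sigma> i \<noteq> \<sigma> j"
  defines "g \<equiv> ((\<sigma> i)\<^sup>2 - (\<sigma> j)\<^sup>2) / ((\<sigma> i)\<^sup>2 + (\<sigma> j)\<^sup>2)"
  shows "extremal_perturbation m n r U \<sigma> V i j \<in> carrier_mat m n"
    "\<And>a b. a < m \<Longrightarrow> b < m \<Longrightarrow> coord (extremal_perturbation m n r U \<sigma> V i j) a b
      = of_real (if a = j \<and> b = i then g * \<sigma> i else if a = i \<and> b = j then g * \<sigma> j else 0)"
    "(fnorm (extremal_perturbation m n r U \<sigma> V i j))\<^sup>2 = g\<^sup>2 * ((\<sigma> i)\<^sup>2 + (\<sigma> j)\<^sup>2)"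
proof -
  let ?S = "sigma_mat m n r \<sigma> :: 'k mat"
  let ?E = "extremal_perturbation m n r U \<sigma> V i j"
  let ?c = "2 * (\<sigma> i * \<sigma> j / ((\<sigma> i)\<^sup>2 + (\<sigma> j)\<^sup>2))"
  let ?W = "elem_mat m j i - elem_mat m i j :: 'k mat" and ?W' = "elem_mat n i j - elem_mat n j i :: 'k mat"
  have q: "0 < (\<sigma> i)\<^sup>2 + (\<sigma> j)\<^sup>2"
    using ij by (metis sum_power2_gt_zero_iff)
  define Z where "Z = ?W * ?S + (if i < r \<and> j < r then of_real ?c \<cdot>\<^sub>m (?S * ?W') else 0\<^sub>m m n)"
  have W: "?W \<in> carrier_mat m m" "?W' \<in> carrier_mat n n" by (auto intro!: minus_carrier_mat)
  have WS: "?W * ?S \<in> carrier_mat m n" "?S * ?W' \<in> carrier_mat m n"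
    using mult_carrier_mat[OF W(1), of ?S n] mult_carrier_mat[OF _ W(2), of ?S m] by auto
  have Z: "Z \<in> carrier_mat m n" using WS by (auto simp: Z_def intro!: add_carrier_mat)
  have split: "U * (Y1 + Y2) * V\<^sup>H = U * Y1 * V\<^sup>H + U * Y2 * V\<^sup>H"
    if "Y1 \<in> carrier_mat m n" "Y2 \<in> carrier_mat m n" for Y1 Y2
    using mult_add_distrib_mat[OF UD(3) that]
      add_mult_distrib_mat[OF mult_carrier_mat[OF UD(3) that(1)] mult_carrier_mat[OF UD(3) that(2)] adjoint_carrier[OF VD(3)]]
    by (simp only:)
  have E_eq: "?E = U * Z * V\<^sup>H"
  proof (cases "i < r \<and> j < r")
    case True
    have "U * (of_real ?c \<cdot>\<^sub>m (?S * ?W')) * V\<^sup>H = of_real ?c \<cdot>\<^sub>m (U * (?S * ?W') * V\<^sup>H)"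
      using mult_smult_distrib[OF UD(3) WS(2), of "of_real ?c"]
        mult_smult_assoc_mat[OF mult_carrier_mat[OF UD(3) WS(2)] adjoint_carrier[OF VD(3)], of "of_real ?c"]
      by (simp only:)
    moreover have "U * (?S * ?W') = U * ?S * ?W'" "U * (?W * ?S) = U * ?W * ?S"
      using UD(1,2) by (simp_all add: mult_mat_assoc)
    ultimately show ?thesis
      using split[OF WS(1) smult_carrier_mat[OF WS(2)], of "of_real ?c"] True
      unfolding Z_def extremal_perturbation_def by (simp only: if_True simp_thms)
  next
    case False
    have "U * (?W * ?S) = U * ?W * ?S"
      using UD(1,2) by (simp add: mult_mat_assoc)
    moreover have "U * 0\<^sub>m m n * V\<^sup>H = 0\<^sub>m m n"
      using UD(3) VD(1,2) by simp
    ultimately show ?thesis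
      using split[OF WS(1) zero_carrier_mat] False
      unfolding Z_def extremal_perturbation_def by (simp only: if_False simp_thms)
  qed
  show E: "?E \<in> carrier_mat m n"
    unfolding E_eq by (rule mult_carrier_mat[OF mult_carrier_mat[OF UD(3) Z] adjoint_carrier[OF VD(3)]])
  have coord_Z: "U\<^sup>H * (?E * V) = Z"
    unfolding E_eq using UD VD Z
    by (simp add: mult_mat_assoc unitary_cancel[OF svdD(2)])
  have S_index: "?S $$ (a, b) = (if a = b then of_real (\<sigma> a) else 0)" if "a < m" "b < n" for a b
    using that svdD(6)[of a] by (auto simp: sigma_mat_def r_def)
  have Z_index: "Z $$ (a, b) = of_real (if a = j \<and> b = i then g * \<sigma> i else if a = i \<and> b = j then g * \<sigma> j else 0)"
    if ab: "a < m" "b < n" for a b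
  proof -
    have 1: "(?W * ?S) $$ (a, b) = of_real ((if a = j \<and> b = i then \<sigma> i else 0) - (if a = i \<and> b = j then \<sigma> j else 0))"
    proof -
      have "(?W * ?S) $$ (a, b) = (\<Sum>l<m. ?W $$ (a, l) * ?S $$ (l, b))"
        using ab by (subst index_mult_mat_sum) auto
      also have "\<dots> = (\<Sum>l<m. (if l = i then (if a = j then ?S $$ (i, b) else 0) else 0)
          - (if l = j then (if a = i then ?S $$ (j, b) else 0) else 0))"
        using ab by (intro sum.cong) (auto simp: elem_mat_index)
      also have "\<dots> = (if a = j then ?S $$ (i, b) else 0) - (if a = i then ?S $$ (j, b) else 0)"
        using i j by (simp add: sum_subtractf)
      finally show ?thesis using i j ab by (auto simp: S_index)
    qed
    have 2: "(?S * ?W') $$ (a, b) = of_real ((if a = i \<and> b = j then \<sigma> i else 0) - (if a = j \<and> b = i then \<sigma> j else 0))"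
      if "i < n" "j < n"
    proof -
      have "(?S * ?W') $$ (a, b) = (\<Sum>l<n. ?S $$ (a, l) * ?W' $$ (l, b))"
        using ab by (subst index_mult_mat_sum) auto
      also have "\<dots> = (\<Sum>l<n. (if l = i then (if b = j then ?S $$ (a, i) else 0) else 0)
          - (if l = j then (if b = i then ?S $$ (a, j) else 0) else 0))"
        using ab by (intro sum.cong) (auto simp: elem_mat_index)
      also have "\<dots> = (if b = j then ?S $$ (a, i) else 0) - (if b = i then ?S $$ (a, j) else 0)"
        using that by (simp add: sum_subtractf)
      finally show ?thesis using that ab by (auto simp: S_index)
    qed
    have neq: "i \<noteq> j" using ij by auto
    show ?thesis
    proof (cases "i < r \<and> j < r")
      case True
      then have n: "i < n" "j < n" using svdD(9) by (auto simp: r_def)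
      define c where "c = ?c"
      have eqs: "\<sigma> i - c * \<sigma> j = g * \<sigma> i" "c * \<sigma> i - \<sigma> j = g * \<sigma> j"
        unfolding c_def g_def using less_imp_neq[OF q, THEN not_sym]
        by (rule extremal_coefficients(1)[OF _ refl], rule extremal_coefficients(2)[OF _ refl])
      have "Z $$ (a, b) = (?W * ?S) $$ (a, b) + of_real c * (?S * ?W') $$ (a, b)"
        unfolding Z_def c_def[symmetric] using True ab WS by simp
      also have "\<dots> = of_real (((if a = j \<and> b = i then \<sigma> i else 0) - (if a = i \<and> b = j then \<sigma> j else 0))
          + c * ((if a = i \<and> b = j then \<sigma> i else 0) - (if a = j \<and> b = i then \<sigma> j else 0)))"
        unfolding 1 2[OF n] by (simp only: of_real_mult of_real_add)
      also have "((if a = j \<and> b = i then \<sigma> i else 0) - (if a = i \<and> b = j then \<sigma> j else 0))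
          + c * ((if a = i \<and> b = j then \<sigma> i else 0) - (if a = j \<and> b = i then \<sigma> j else 0))
          = (if a = j \<and> b = i then g * \<sigma> i else if a = i \<and> b = j then g * \<sigma> j else 0)"
        using eqs neq by auto
      finally show ?thesis .
    next
      case False
      then have "\<sigma> i = 0 \<or> \<sigma> j = 0" using svdD(6)[of i] svdD(6)[of j] i j by (auto simp: r_def)
      then have "g * \<sigma> i = \<sigma> i" "g * \<sigma> j = - \<sigma> j"
        using q by (auto simp: g_def)
      moreover have "Z $$ (a, b) = (?W * ?S) $$ (a, b)"
        unfolding Z_def using False ab WS by auto
      ultimately show ?thesis
        unfolding 1 of_real_eq_iff using neq by auto
    qed
  qed
  show coord_E: "coord ?E a b = of_real (if a = j \<and> b = i then g * \<sigma> i else if a = i \<and> b = j then g * \<sigma> j else 0)"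
    if "a < m" "b < m" for a b
  proof (cases "b < n")
    case True
    then show ?thesis by (simp only: coord_def coord_Z if_True Z_index[OF that(1) True])
  next
    case False
    then have outside: "coord ?E a b = 0" by (simp only: coord_def if_False)
    have "\<sigma> b = 0" by (rule \<sigma>_zero[OF leI[OF False] that(2)])
    then have "(if a = j \<and> b = i then g * \<sigma> i else if a = i \<and> b = j then g * \<sigma> j else 0) = 0"
      by (cases "b = i"; cases "b = j") simp_all
    then show ?thesis unfolding outside by (simp only: of_real_0)
  qed
  have "(fnorm ?E)\<^sup>2 = (\<Sum>a<m. \<Sum>b<n. (norm (Z $$ (a, b)))\<^sup>2)"
    unfolding norm_coord[OF E] by (intro sum.cong refl) (simp only: coord_def coord_Z lessThan_iff if_True)
  also have "\<dots> = (\<Sum>a<m. \<Sum>b<n. (if a = j then (if b = i then (g * \<sigma> i)\<^sup>2 else 0) else 0)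
      + (if a = i then (if b = j then (g * \<sigma> j)\<^sup>2 else 0) else 0))"
  proof (intro sum.cong refl)
    fix a b assume ab: "a \<in> {..<m}" "b \<in> {..<n}"
    have "i \<noteq> j" using ij by auto
    then have "(if a = j \<and> b = i then g * \<sigma> i else if a = i \<and> b = j then g * \<sigma> j else 0)\<^sup>2
        = (if a = j then (if b = i then (g * \<sigma> i)\<^sup>2 else 0) else 0)
        + (if a = i then (if b = j then (g * \<sigma> j)\<^sup>2 else 0) else 0)"
      by (cases "a = j"; cases "a = i"; simp)
    then show "(norm (Z $$ (a, b)))\<^sup>2 = (if a = j then (if b = i then (g * \<sigma> i)\<^sup>2 else 0) else 0)
        + (if a = i then (if b = j then (g * \<sigma> j)\<^sup>2 else 0) else 0)"
      using ab by (simp only: Z_index lessThan_iff norm_of_real power2_abs)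
  qed
  also have "\<dots> = (\<Sum>a<m. (if a = j then (if i < n then (g * \<sigma> i)\<^sup>2 else 0) else 0)
      + (if a = i then (if j < n then (g * \<sigma> j)\<^sup>2 else 0) else 0))"
    by (intro sum.cong refl) (auto simp: sum.distrib)
  also have "\<dots> = (if i < n then (g * \<sigma> i)\<^sup>2 else 0) + (if j < n then (g * \<sigma> j)\<^sup>2 else 0)"
    using i j by (simp add: sum.distrib)
  also have "\<dots> = (g * \<sigma> i)\<^sup>2 + (g * \<sigma> j)\<^sup>2"
    using \<sigma>_zero[of i] \<sigma>_zero[of j] i j by auto
  also have "\<dots> = g\<^sup>2 * ((\<sigma> i)\<^sup>2 + (\<sigma> j)\<^sup>2)"
    by (simp add: power_mult_distrib distrib_left)
  finally show "(fnorm ?E)\<^sup>2 = g\<^sup>2 * ((\<sigma> i)\<^sup>2 + (\<sigma> j)\<^sup>2)" .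
qed

lemma extremal_perturbation_attains:
  defines "r \<equiv> vec_space.rank m A"
  assumes i: "i \<in> \<pi>" and j: "j \<in> {..<m} - \<pi>"
  shows "extremal_perturbation m n r U \<sigma> V i j \<in> carrier_mat m n"
    "fnorm (first_order (extremal_perturbation m n r U \<sigma> V i j)) = 1"
    "pair_condition \<sigma> i j * fnorm (extremal_perturbation m n r U \<sigma> V i j) = 1"
proof -
  let ?E = "extremal_perturbation m n r U \<sigma> V i j"
  define g where "g = ((\<sigma> i)\<^sup>2 - (\<sigma> j)\<^sup>2) / ((\<sigma> i)\<^sup>2 + (\<sigma> j)\<^sup>2)"
  have ij: "i < m" "j < m" "\<sigma> i \<noteq> \<sigma> j" "i \<noteq> j"
    using i j \<pi> sep by (auto simp: separated_def)
  note c = extremal_perturbation_coordinates[OF ij(1,2,3), folded r_def g_def]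
  show E: "?E \<in> carrier_mat m n" by (rule c(1))
  have q: "0 < (\<sigma> i)\<^sup>2 + (\<sigma> j)\<^sup>2"
    using ij(3) by (metis sum_power2_gt_zero_iff)
  have d: "(\<sigma> i)\<^sup>2 - (\<sigma> j)\<^sup>2 \<noteq> 0"
    using ij svdD(7)[of i] svdD(7)[of j] by (simp add: power2_eq_iff_nonneg)
  have "first_order ?E $$ (a, b) = (if a = j then (if b = i then 1 else 0) else 0)" if ab: "a < m" "b < m" for a b
  proof (cases "a \<notin> \<pi> \<and> b \<in> \<pi>")
    case True
    show ?thesis
    proof (cases "a = j \<and> b = i")
      case True
      have "\<sigma> j * (g * \<sigma> j) + g * \<sigma> i * \<sigma> i = (\<sigma> i)\<^sup>2 - (\<sigma> j)\<^sup>2"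
        unfolding g_def using less_imp_neq[OF q, THEN not_sym] by (rule extremal_coefficients(3)[OF _ refl])
      then have "of_real (\<sigma> j) * of_real (g * \<sigma> j) + of_real (g * \<sigma> i) * of_real (\<sigma> i)
          = (of_real ((\<sigma> i)\<^sup>2 - (\<sigma> j)\<^sup>2) :: 'k)"
        by (simp only: of_real_mult[symmetric] of_real_add[symmetric])
      moreover have "(of_real ((\<sigma> i)\<^sup>2 - (\<sigma> j)\<^sup>2) :: 'k) \<noteq> 0"
        using d by (simp only: of_real_eq_0_iff not_False_eq_True)
      ultimately show ?thesis
        unfolding first_order_index[OF E ab] using True i j ij
        by (simp add: c(2) del: of_real_mult of_real_diff of_real_add of_real_power)
    next
      case False
      then show ?thesis
        unfolding first_order_index[OF E ab] using True i j ab by (auto simp: c(2))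
    qed
  next
    case False
    then show ?thesis
      unfolding first_order_index[OF E ab] using i j by auto
  qed
  then have "(fnorm (first_order ?E))\<^sup>2
      = (\<Sum>a<m. \<Sum>b<m. if a = j then (if b = i then 1 else 0) else 0)"
    unfolding frobenius_norm_sq first_order_dim by (intro sum.cong refl) auto
  also have "\<dots> = (\<Sum>a<m. if a = j then 1 else 0)"
    using ij by (intro sum.cong refl) auto
  also have "\<dots> = 1" using ij by simp
  finally show "fnorm (first_order ?E) = 1"
    using frobenius_norm_nonneg[of "first_order ?E"] by (metis abs_of_nonneg abs_square_eq_1)
  have "(pair_condition \<sigma> i j * fnorm ?E)\<^sup>2 = 1"
    unfolding power_mult_distrib pair_condition_sq c(3) using q d
    by (simp add: g_def power_divide power2_eq_square[of "_ + _"])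
  then show "pair_condition \<sigma> i j * fnorm ?E = 1"
    using mult_nonneg_nonneg[OF pair_condition_nonneg[of i j] frobenius_norm_nonneg[of ?E]]
    by (metis abs_of_nonneg abs_square_eq_1)
qed

end

section \<open>Attaining the condition number\<close>

text \<open>If the chordal distance is at most \<open>c = \<kappa> x + C x\<^sup>2\<close>, the other distances are at most
  \<open>c / sqrt (1 - c\<^sup>2)\<close>; this is that bound divided by \<open>x\<close>.\<close>

definition distance_upper :: "real \<Rightarrow> real \<Rightarrow> real \<Rightarrow> real" where
  "distance_upper \<kappa> C x = (\<kappa> + C * x) / sqrt (1 - (\<kappa> * x + C * x\<^sup>2)\<^sup>2)"

lemma tendsto_distance_upper: "(distance_upper \<kappa> C \<longlongrightarrow> \<kappa>) (at 0)"
proof -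
  have "((\<lambda>x. (\<kappa> + C * x) / sqrt (1 - (\<kappa> * x + C * x\<^sup>2)\<^sup>2)) \<longlongrightarrow> (\<kappa> + C * 0) / sqrt (1 - (\<kappa> * 0 + C * 0\<^sup>2)\<^sup>2)) (at 0)"
    by (intro tendsto_intros) auto
  then show ?thesis by (simp add: distance_upper_def[abs_def])
qed

lemma distance_upper_mono:
  assumes "0 \<le> \<kappa>" "0 \<le> C" "0 \<le> x" "x \<le> y" "\<kappa> * y + C * y\<^sup>2 < 1"
  shows "distance_upper \<kappa> C x \<le> distance_upper \<kappa> C y"
proof -
  let ?p = "\<lambda>x. \<kappa> * x + C * x\<^sup>2"
  have p: "0 \<le> ?p x" "?p x \<le> ?p y" "?p y < 1"
    using assms by (auto intro!: add_mono mult_left_mono power_mono)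
  then have "(?p x)\<^sup>2 \<le> (?p y)\<^sup>2" "(?p y)\<^sup>2 < 1"
    by (auto intro: power_mono simp: power_less_one_iff)
  then have "0 < sqrt (1 - (?p y)\<^sup>2)" "sqrt (1 - (?p y)\<^sup>2) \<le> sqrt (1 - (?p x)\<^sup>2)" by auto
  then show ?thesis
    unfolding distance_upper_def using assms by (intro frac_le add_left_mono mult_left_mono) auto
qed

context separated_svd
begin

abbreviation (input) "distances \<equiv> {chordal_dist m k, grassmann_dist m k, procrustes_dist m k}
  :: ('k vec set \<Rightarrow> 'k vec set \<Rightarrow> real) set"

lemma distance_bounds:
  assumes \<kappa>: "0 \<le> \<kappa>" "\<And>b a. b \<in> \<pi> \<Longrightarrow> a \<in> {..<m} - \<pi> \<Longrightarrow> pair_condition \<sigma> b a \<le> \<kappa>"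
  obtains C \<delta> :: real where "0 < \<delta>" "0 \<le> C" "\<kappa> * \<delta> + C * \<delta>\<^sup>2 < 1"
    "\<And>E. E \<in> carrier_mat m n \<Longrightarrow> fnorm E < \<delta> \<Longrightarrow> A + E \<in> singular_domain m n \<pi>"
    "\<And>E dst. E \<in> carrier_mat m n \<Longrightarrow> fnorm E < \<delta> \<Longrightarrow> dst \<in> distances \<Longrightarrow>
       fnorm (first_order E) - C * (fnorm E)\<^sup>2
         \<le> dst (singular_map m n \<pi> A) (singular_map m n \<pi> (A + E))"
    "\<And>E dst. E \<in> carrier_mat m n \<Longrightarrow> fnorm E < \<delta> \<Longrightarrow> dst \<in> distances \<Longrightarrow>
       dst (singular_map m n \<pi> A) (singular_map m n \<pi> (A + E))
         \<le> distance_upper \<kappa> C (fnorm E) * fnorm E"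
proof -
  obtain C \<delta>1 :: real where \<delta>1: "0 < \<delta>1" and C: "0 \<le> C"
    and dom: "\<And>E. E \<in> carrier_mat m n \<Longrightarrow> fnorm E < \<delta>1 \<Longrightarrow> A + E \<in> singular_domain m n \<pi>"
    and expansion: "\<And>E. E \<in> carrier_mat m n \<Longrightarrow> fnorm E < \<delta>1 \<Longrightarrow> expands C E"
    by (rule singular_map_expansion) blast
  \<comment> \<open>this choice gives \<open>\<kappa> x + C x\<^sup>2 < 1\<close> for all \<open>x \<le> \<delta>\<close>\<close>
  define \<delta> where "\<delta> = min \<delta>1 (1 / (\<kappa> + C + 1))"
  have pos: "0 < \<kappa> + C + 1" using \<kappa>(1) C by simp
  have \<delta>: "0 < \<delta>" "\<delta> \<le> \<delta>1" "\<delta> \<le> 1" "(\<kappa> + C) * \<delta> < 1"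
  proof -
    show "0 < \<delta>" "\<delta> \<le> \<delta>1" using \<delta>1 pos by (auto simp: \<delta>_def)
    have "\<delta> \<le> 1 / (\<kappa> + C + 1)" by (simp add: \<delta>_def)
    then have "\<delta> * (\<kappa> + C + 1) \<le> 1" using pos by (simp add: field_simps)
    moreover have "0 \<le> \<delta> * (\<kappa> + C)" using \<open>0 < \<delta>\<close> \<kappa>(1) C by simp
    ultimately show "\<delta> \<le> 1" "(\<kappa> + C) * \<delta> < 1" using \<open>0 < \<delta>\<close> by (auto simp: algebra_simps)
  qed
  have small: "\<kappa> * x + C * x\<^sup>2 < 1" if "0 \<le> x" "x \<le> \<delta>" for x
  proof -
    have "x\<^sup>2 \<le> x" using that \<delta>(3) mult_left_mono[of x 1 x] by (simp add: power2_eq_square)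
    then have "\<kappa> * x + C * x\<^sup>2 \<le> \<kappa> * x + C * x" using C by (intro add_left_mono mult_left_mono)
    also have "\<dots> = (\<kappa> + C) * x" by (simp add: algebra_simps)
    also have "\<dots> \<le> (\<kappa> + C) * \<delta>" using that \<kappa>(1) C by (intro mult_left_mono) auto
    finally show ?thesis using \<delta>(4) by simp
  qed
  have bounds: "fnorm (first_order E) - C * (fnorm E)\<^sup>2
         \<le> dst (singular_map m n \<pi> A) (singular_map m n \<pi> (A + E)) \<and>
       dst (singular_map m n \<pi> A) (singular_map m n \<pi> (A + E))
         \<le> distance_upper \<kappa> C (fnorm E) * fnorm E"
    if E: "E \<in> carrier_mat m n" "fnorm E < \<delta>"
      and dst: "dst \<in> distances" for E dst
  proof -
    define e where "e = fnorm E"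
    have e: "0 \<le> e" "e \<le> \<delta>" using E(2) by (auto simp: e_def)
    obtain Q Q' where Q: "orthonormal_basis_mat m k (singular_map m n \<pi> A) Q"
      and Q': "orthonormal_basis_mat m k (singular_map m n \<pi> (A + E)) Q'"
      and c: "\<bar>fnorm (Q' - Q * (Q\<^sup>H * Q')) - fnorm (first_order E)\<bar> \<le> C * e\<^sup>2"
      using expansion[OF E(1)] E(2) \<delta>(2) by (auto simp: e_def expands_def)
    define c where "c = fnorm (Q' - Q * (Q\<^sup>H * Q'))"
    have c_low: "fnorm (first_order E) - C * e\<^sup>2 \<le> c" using c by (auto simp: c_def)
    have "c \<le> fnorm (first_order E) + C * e\<^sup>2" using c by (auto simp: c_def)
    then have c_up: "c \<le> \<kappa> * e + C * e\<^sup>2"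
      using first_order_bound[OF E(1) \<kappa>] by (simp add: e_def)
    have p1: "\<kappa> * e + C * e\<^sup>2 < 1" by (rule small[OF e])
    have c0: "0 \<le> c" by (simp add: c_def)
    note cmp = distances_comparable[OF Q Q', folded c_def, OF _ dst]
    have sq: "c\<^sup>2 \<le> (\<kappa> * e + C * e\<^sup>2)\<^sup>2" "(\<kappa> * e + C * e\<^sup>2)\<^sup>2 < 1"
      using c_up c0 p1 by (auto intro: power_mono simp: power_less_one_iff)
    have "dst (singular_map m n \<pi> A) (singular_map m n \<pi> (A + E)) \<le> c / sqrt (1 - c\<^sup>2)"
      using cmp c_up p1 by simp
    also have "\<dots> \<le> (\<kappa> * e + C * e\<^sup>2) / sqrt (1 - (\<kappa> * e + C * e\<^sup>2)\<^sup>2)"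
      using c_up c0 sq by (intro frac_le) auto
    also have "\<dots> = distance_upper \<kappa> C e * e"
      by (simp add: distance_upper_def power2_eq_square algebra_simps)
    finally show ?thesis
      using cmp c_low c_up p1 by (simp add: e_def)
  qed
  show thesis
    using that[of \<delta> C] \<delta>(1,2) C small[of \<delta>] dom bounds by force
qed

end

text \<open>The supremum over the ball of radius \<open>\<epsilon>\<close> is squeezed between a lower bound \<open>l \<epsilon>\<close> for the ratio at one
  point of the ball and an upper bound \<open>u \<epsilon>\<close> for all ratios.\<close>

lemma condition_number_eqI:
  assumes lower: "\<And>\<epsilon>. 0 < \<epsilon> \<Longrightarrow> \<epsilon> < \<delta> \<Longrightarrow> \<exists>x'\<in>X. 0 < dX x x' \<and> dX x x' \<le> \<epsilon> \<and> l \<epsilon> \<le> dY (f x) (f x') / dX x x'"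
    and upper: "\<And>\<epsilon> x'. 0 < \<epsilon> \<Longrightarrow> \<epsilon> < \<delta> \<Longrightarrow> x' \<in> X \<Longrightarrow> 0 < dX x x' \<Longrightarrow> dX x x' \<le> \<epsilon> \<Longrightarrow>
      dY (f x) (f x') / dX x x' \<le> u \<epsilon>"
    and lim: "(l \<longlongrightarrow> \<kappa>) (at_right 0)" "(u \<longlongrightarrow> \<kappa>) (at_right 0)" and "0 < \<delta>"
  shows "condition_number X dX dY f x = ereal \<kappa>"
  unfolding condition_number_def
proof (rule tendsto_Lim)
  let ?S = "\<lambda>\<epsilon>. SUP x'\<in>{x' \<in> X. 0 < dX x x' \<and> dX x x' \<le> \<epsilon>}. ereal (dY (f x) (f x') / dX x x')"
  have ev: "\<forall>\<^sub>F \<epsilon> in at_right (0::real). 0 < \<epsilon> \<and> \<epsilon> < \<delta>"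
    using eventually_at_right_less[of 0] eventually_at_right_field[of "\<lambda>x. x < \<delta>" 0] \<open>0 < \<delta>\<close>
    by (auto intro: eventually_conj)
  show "(?S \<longlongrightarrow> ereal \<kappa>) (at_right 0)"
  proof (rule tendsto_sandwich)
    show "\<forall>\<^sub>F \<epsilon> in at_right 0. ereal (l \<epsilon>) \<le> ?S \<epsilon>"
      using ev
    proof eventually_elim
      case (elim \<epsilon>)
      then obtain x' where "x' \<in> X" "0 < dX x x'" "dX x x' \<le> \<epsilon>" "l \<epsilon> \<le> dY (f x) (f x') / dX x x'"
        using lower by blast
      then show ?case by (intro SUP_upper2[of x']) auto
    qed
    show "\<forall>\<^sub>F \<epsilon> in at_right 0. ?S \<epsilon> \<le> ereal (u \<epsilon>)"
      using ev
    proof eventually_elim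
      case (elim \<epsilon>)
      then show ?case using upper by (intro SUP_least) auto
    qed
    show "((\<lambda>\<epsilon>. ereal (l \<epsilon>)) \<longlongrightarrow> ereal \<kappa>) (at_right 0)" "((\<lambda>\<epsilon>. ereal (u \<epsilon>)) \<longlongrightarrow> ereal \<kappa>) (at_right 0)"
      using lim by (auto intro: tendsto_ereal)
  qed
qed simp

theorem proposition1:
  fixes A U V :: "'k::real_or_complex mat" and \<sigma> :: "nat \<Rightarrow> real"
    and \<pi> :: "nat set" and m n k r i j :: nat
    and d\<^sub>\<kappa> d :: "'k vec set \<Rightarrow> 'k vec set \<Rightarrow> real"
  assumes "\<pi> \<subseteq> {..<m}" and "card \<pi> = k"
    and "A \<in> singular_domain m n \<pi>"
    and "vec_space.rank m A = r"
    and "full_svd m n A U \<sigma> V"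
    and "d\<^sub>\<kappa> \<in> {chordal_dist m k, grassmann_dist m k, procrustes_dist m k}"
    and "d \<in> {chordal_dist m k, grassmann_dist m k, procrustes_dist m k}"
    and "i \<in> \<pi>" and "j \<in> {..<m} - \<pi>"
    and "pair_condition \<sigma> i j =
           Max ((\<lambda>(i', j'). pair_condition \<sigma> i' j') ` (\<pi> \<times> ({..<m} - \<pi>)))"
  shows "let \<kappa> = condition_number (singular_domain m n \<pi>) frobenius_dist d\<^sub>\<kappa>
                   (singular_map m n \<pi>) A;
             A' = extremal_perturbation m n r U \<sigma> V i j
         in \<kappa> = ereal (Max ((\<lambda>(i', j'). pair_condition \<sigma> i' j') ` (\<pi> \<times> ({..<m} - \<pi>)))) \<and>
            (\<forall>\<^sub>F t in at (0::real). A + of_real t \<cdot>\<^sub>m A' \<in> singular_domain m n \<pi>) \<and>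
            (\<exists>\<epsilon>. (\<epsilon> \<longlongrightarrow> 0) (at 0) \<and>
              (\<forall>\<^sub>F t in at (0::real).
                 ereal (d (singular_map m n \<pi> A) (singular_map m n \<pi> (A + of_real t \<cdot>\<^sub>m A'))) =
                 \<kappa> * ereal (frobenius_norm (of_real t \<cdot>\<^sub>m A')) * ereal (1 + \<epsilon> t)))"
proof -
  have sep: "separated m \<pi> \<sigma>"
    by (rule separated_if_singular_domain[OF assms(1,3,5)])
  interpret separated_svd m n k \<pi> A U V \<sigma>
    by unfold_locales (fact assms sep)+
  define \<kappa> where "\<kappa> = pair_condition \<sigma> i j"
  define B where "B = extremal_perturbation m n r U \<sigma> V i j"
  define b where "b = fnorm B"
  have B: "B \<in> carrier_mat m n" and LB: "fnorm (first_order B) = 1" and \<kappa>b: "\<kappa> * b = 1"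
    using extremal_perturbation_attains[OF assms(8,9)] by (auto simp: B_def b_def \<kappa>_def assms(4))
  have \<kappa>_nonneg: "0 \<le> \<kappa>" by (simp add: \<kappa>_def pair_condition_nonneg)
  have b_pos: "0 < b" using \<kappa>b frobenius_norm_nonneg[of B] by (cases "b = 0") (auto simp: b_def less_le)
  have \<kappa>_max: "pair_condition \<sigma> b' a' \<le> \<kappa>" if "b' \<in> \<pi>" "a' \<in> {..<m} - \<pi>" for b' a'
  proof -
    have "finite (\<pi> \<times> ({..<m} - \<pi>))" using assms(1) finite_subset by blast
    then show ?thesis
      unfolding \<kappa>_def assms(10) using that by (intro Max_ge finite_imageI) auto
  qed
  obtain C \<delta> :: real where \<delta>: "0 < \<delta>" and C: "0 \<le> C" and \<delta>_small: "\<kappa> * \<delta> + C * \<delta>\<^sup>2 < 1"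
    and dom: "\<And>E. E \<in> carrier_mat m n \<Longrightarrow> fnorm E < \<delta> \<Longrightarrow> A + E \<in> singular_domain m n \<pi>"
    and low: "\<And>E dst. E \<in> carrier_mat m n \<Longrightarrow> fnorm E < \<delta> \<Longrightarrow> dst \<in> distances \<Longrightarrow>
       fnorm (first_order E) - C * (fnorm E)\<^sup>2
         \<le> dst (singular_map m n \<pi> A) (singular_map m n \<pi> (A + E))"
    and up: "\<And>E dst. E \<in> carrier_mat m n \<Longrightarrow> fnorm E < \<delta> \<Longrightarrow> dst \<in> distances \<Longrightarrow>
       dst (singular_map m n \<pi> A) (singular_map m n \<pi> (A + E))
         \<le> distance_upper \<kappa> C (fnorm E) * fnorm E"
    by (rule distance_bounds[OF \<kappa>_nonneg \<kappa>_max]) blast+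
  have norm_tB: "fnorm (of_real t \<cdot>\<^sub>m B) = \<bar>t\<bar> * b" for t
    by (simp add: frobenius_norm_smult b_def)
  have first_tB: "fnorm (first_order (of_real t \<cdot>\<^sub>m B)) = \<bar>t\<bar>" for t
    using first_order_scale[OF B] LB by simp
  have tB: "of_real t \<cdot>\<^sub>m B \<in> carrier_mat m n" for t using B by simp
  have diff: "A + (X - A) = X" "frobenius_dist A X = fnorm (X - A)" if "X \<in> carrier_mat m n" for X
  proof -
    have "A - X = - (X - A)" using that svdD(1) by (intro eq_matI) auto
    then show "frobenius_dist A X = fnorm (X - A)" by (simp add: frobenius_dist_def)
    show "A + (X - A) = X" using that svdD(1) by (intro eq_matI) auto
  qed
  have add: "A + E - A = E" if "E \<in> carrier_mat m n" for E
    using that svdD(1) by (intro eq_matI) auto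
  have cond: "condition_number (singular_domain m n \<pi>) frobenius_dist d\<^sub>\<kappa> (singular_map m n \<pi>) A = ereal \<kappa>"
  proof (rule condition_number_eqI[OF _ _ _ _ \<delta>])
    fix \<epsilon> :: real assume \<epsilon>: "0 < \<epsilon>" "\<epsilon> < \<delta>"
    \<comment> \<open>since \<open>\<kappa> b = 1\<close>, this multiple of \<open>B\<close> has norm \<open>\<epsilon>\<close>\<close>
    define t where "t = \<kappa> * \<epsilon>"
    let ?E = "of_real t \<cdot>\<^sub>m B"
    have abs_t: "\<bar>t\<bar> = \<kappa> * \<epsilon>" using \<epsilon> \<kappa>_nonneg by (simp add: t_def)
    then have "\<bar>t\<bar> * b = \<epsilon>" using \<kappa>b by (simp add: mult_ac)
    then have nE: "fnorm ?E = \<epsilon>" by (simp only: norm_tB)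
    have AE: "A + ?E \<in> carrier_mat m n" by (rule add_carrier_mat[OF tB])
    have dist: "frobenius_dist A (A + ?E) = \<epsilon>"
      unfolding diff(2)[OF AE] add[OF tB] by (rule nE)
    have "\<kappa> * \<epsilon> - C * \<epsilon>\<^sup>2 \<le> d\<^sub>\<kappa> (singular_map m n \<pi> A) (singular_map m n \<pi> (A + ?E))"
      using low[OF tB _ assms(6), of t] \<epsilon> unfolding nE first_tB abs_t by simp
    then have "\<kappa> - C * \<epsilon> \<le> d\<^sub>\<kappa> (singular_map m n \<pi> A) (singular_map m n \<pi> (A + ?E)) / \<epsilon>"
      using \<epsilon> by (simp add: field_simps power2_eq_square)
    then show "\<exists>x'\<in>singular_domain m n \<pi>. 0 < frobenius_dist A x' \<and> frobenius_dist A x' \<le> \<epsilon> \<and>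
        \<kappa> - C * \<epsilon> \<le> d\<^sub>\<kappa> (singular_map m n \<pi> A) (singular_map m n \<pi> x') / frobenius_dist A x'"
      using dom[OF tB, of t] nE dist \<epsilon> by (intro bexI[of _ "A + ?E"]) auto
  next
    fix \<epsilon> :: real and X assume \<epsilon>: "0 < \<epsilon>" "\<epsilon> < \<delta>" and X: "X \<in> singular_domain m n \<pi>"
      and dX: "0 < frobenius_dist A X" "frobenius_dist A X \<le> \<epsilon>"
    have cX: "X \<in> carrier_mat m n" using X by (simp add: singular_domain_def)
    let ?e = "fnorm (X - A)"
    have E: "X - A \<in> carrier_mat m n" using cX svdD(1) by (auto intro: minus_carrier_mat)
    have e: "0 < ?e" "?e \<le> \<epsilon>" using dX diff(2)[OF cX] by auto
    have "d\<^sub>\<kappa> (singular_map m n \<pi> A) (singular_map m n \<pi> X) \<le> distance_upper \<kappa> C ?e * ?e"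
      using up[OF E _ assms(6)] e \<epsilon> unfolding diff(1)[OF cX] by simp
    then have "d\<^sub>\<kappa> (singular_map m n \<pi> A) (singular_map m n \<pi> X) / ?e \<le> distance_upper \<kappa> C ?e"
      using e by (simp add: divide_le_eq)
    also have "\<dots> \<le> distance_upper \<kappa> C \<epsilon>"
    proof (rule distance_upper_mono[OF \<kappa>_nonneg C _ e(2)])
      have "\<kappa> * \<epsilon> + C * \<epsilon>\<^sup>2 \<le> \<kappa> * \<delta> + C * \<delta>\<^sup>2"
        using \<epsilon> \<kappa>_nonneg C by (intro add_mono mult_left_mono power_mono) auto
      then show "\<kappa> * \<epsilon> + C * \<epsilon>\<^sup>2 < 1" using \<delta>_small by simp
    qed simp
    finally show "d\<^sub>\<kappa> (singular_map m n \<pi> A) (singular_map m n \<pi> X) / frobenius_dist A X \<le> distance_upper \<kappa> C \<epsilon>"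
      unfolding diff(2)[OF cX] .
  next
    have "((\<lambda>\<epsilon>. \<kappa> - C * \<epsilon>) \<longlongrightarrow> \<kappa> - C * 0) (at_right 0)" by (intro tendsto_intros)
    then show "((\<lambda>\<epsilon>. \<kappa> - C * \<epsilon>) \<longlongrightarrow> \<kappa>) (at_right 0)" by simp
    show "(distance_upper \<kappa> C \<longlongrightarrow> \<kappa>) (at_right 0)"
      using tendsto_distance_upper by (rule tendsto_mono[rotated]) (simp add: at_le)
  qed
  define dist where "dist t = d (singular_map m n \<pi> A) (singular_map m n \<pi> (A + of_real t \<cdot>\<^sub>m B))" for t
  define \<epsilon> where "\<epsilon> t = dist t / \<bar>t\<bar> - 1" for t
  have near: "\<forall>\<^sub>F t in at (0::real). t \<noteq> 0 \<and> \<bar>t\<bar> * b < \<delta>"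
    unfolding eventually_at using b_pos \<delta>
    by (intro exI[of _ "\<delta> / b"]) (auto simp: field_simps)
  have "(\<epsilon> \<longlongrightarrow> 0) (at 0)"
  proof (rule tendsto_sandwich)
    show "\<forall>\<^sub>F t in at 0. - (C * b\<^sup>2 * \<bar>t\<bar>) \<le> \<epsilon> t"
      using near
    proof eventually_elim
      case (elim t)
      then have "\<bar>t\<bar> - C * (\<bar>t\<bar> * b)\<^sup>2 \<le> dist t"
        using low[OF tB _ assms(7), of t] unfolding norm_tB first_tB dist_def by simp
      then have "(\<bar>t\<bar> - C * (\<bar>t\<bar> * b)\<^sup>2) / \<bar>t\<bar> \<le> dist t / \<bar>t\<bar>"
        by (rule divide_right_mono) simp
      moreover have "(s - C * (s * b)\<^sup>2) / s = 1 - C * b\<^sup>2 * s" if "s \<noteq> 0" for s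
        using that by (simp add: field_simps power2_eq_square)
      then have "(\<bar>t\<bar> - C * (\<bar>t\<bar> * b)\<^sup>2) / \<bar>t\<bar> = 1 - C * b\<^sup>2 * \<bar>t\<bar>"
        using elim by simp
      ultimately show ?case by (simp add: \<epsilon>_def)
    qed
    show "\<forall>\<^sub>F t in at 0. \<epsilon> t \<le> distance_upper \<kappa> C (\<bar>t\<bar> * b) * b - 1"
      using near
    proof eventually_elim
      case (elim t)
      then have "dist t \<le> distance_upper \<kappa> C (\<bar>t\<bar> * b) * (\<bar>t\<bar> * b)"
        using up[OF tB _ assms(7), of t] unfolding norm_tB dist_def by simp
      then have "dist t / \<bar>t\<bar> \<le> distance_upper \<kappa> C (\<bar>t\<bar> * b) * (\<bar>t\<bar> * b) / \<bar>t\<bar>"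
        by (rule divide_right_mono) simp
      then show ?case using elim by (simp add: \<epsilon>_def)
    qed
    have "((\<lambda>t. - (C * b\<^sup>2 * \<bar>t\<bar>)) \<longlongrightarrow> - (C * b\<^sup>2 * \<bar>0\<bar>)) (at (0::real))"
      by (intro tendsto_intros)
    then show "((\<lambda>t. - (C * b\<^sup>2 * \<bar>t\<bar>)) \<longlongrightarrow> 0) (at (0::real))" by simp
    have "filterlim (\<lambda>t. \<bar>t\<bar> * b) (at 0) (at (0::real))"
    proof (rule filterlim_atI)
      have "((\<lambda>t. \<bar>t\<bar> * b) \<longlongrightarrow> \<bar>0\<bar> * b) (at (0::real))" by (intro tendsto_intros)
      then show "((\<lambda>t. \<bar>t\<bar> * b) \<longlongrightarrow> 0) (at (0::real))" by simp
      show "\<forall>\<^sub>F t in at 0. \<bar>t\<bar> * b \<noteq> 0" using near by eventually_elim (use b_pos in auto)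
    qed
    then have "((\<lambda>t. distance_upper \<kappa> C (\<bar>t\<bar> * b)) \<longlongrightarrow> \<kappa>) (at 0)"
      by (rule filterlim_compose[OF tendsto_distance_upper])
    then have "((\<lambda>t. distance_upper \<kappa> C (\<bar>t\<bar> * b) * b - 1) \<longlongrightarrow> \<kappa> * b - 1) (at 0)"
      by (intro tendsto_intros)
    then show "((\<lambda>t. distance_upper \<kappa> C (\<bar>t\<bar> * b) * b - 1) \<longlongrightarrow> 0) (at 0)" using \<kappa>b by simp
  qed
  moreover have "\<forall>\<^sub>F t in at 0. ereal (dist t) = ereal \<kappa> * ereal (fnorm (of_real t \<cdot>\<^sub>m B)) * ereal (1 + \<epsilon> t)"
    using near
  proof eventually_elim
    case (elim t)
    have "\<kappa> * (\<bar>t\<bar> * b) = \<bar>t\<bar>" using \<kappa>b by (simp add: mult_ac)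
    then have "\<kappa> * fnorm (of_real t \<cdot>\<^sub>m B) * (1 + \<epsilon> t) = dist t"
      unfolding norm_tB using elim by (simp add: \<epsilon>_def)
    then show ?case by (simp only: times_ereal.simps)
  qed
  moreover have "\<forall>\<^sub>F t in at (0::real). A + of_real t \<cdot>\<^sub>m B \<in> singular_domain m n \<pi>"
    using near by eventually_elim (use dom[OF tB] norm_tB in auto)
  moreover have "ereal \<kappa> = ereal (Max ((\<lambda>(i', j'). pair_condition \<sigma> i' j') ` (\<pi> \<times> ({..<m} - \<pi>))))"
    by (simp only: \<kappa>_def assms(10))
  ultimately show ?thesis
    unfolding Let_def cond B_def[symmetric] dist_def by blast
qed

end
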